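(* For every fixed $\epsilon>0$ there is an algorithm with quasi-polynomial running time (i.e., $2^{(\log n)^{O(1)}}$, where $n$ is the input size) that computes a $(1+\epsilon)$-approximate solution for UFP-cover, provided that the sizes of the tasks are in a quasi-polynomial range, i.e., all task sizes $p_i$ are positive integers bounded by $2^{(\log n)^{O(1)}}$.
   Context: UFP-cover (covering version of Unsplittable Flow on a Path): the input is a path $G=(V,E)$ where each edge $e$ has a demand $u_e\ge 0$, and a set $T$ of $n$ tasks; each task $i$ has a start vertex $s_i$, an end vertex $t_i$ (so it uses the subpath from $s_i$ to $t_i$), a size $p_i>0$ and a cost $c_i\ge 0$. For an edge $e$, let $T_e$ be the set of tasks whose path uses $e$. A subset $T'\subseteq T$ is feasible if $\sum_{i\in T'\cap T_e}p_i\ge u_e$ for every edge $e$. The goal is to find a feasible $T'$ minimizing $\sum_{i\in T'}c_i$. A $(1+\epsilon)$-approximation outputs a feasible set of cost at most $(1+\epsilon)$ times the optimum. *)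

theory Defs
  imports Complex_Main "HOL-Library.Log_Nat"
begin

section \<open>Machine model\<close>

text \<open>
  A first-order, call-by-value functional language on finite binary trees with natural numbers at
  the leaves. An execution is charged one unit per evaluated construct, and arithmetic is in
  addition charged the bit lengths of its operands (logarithmic cost criterion). Values can be
  kept as pointers into a shared heap, so that every unit of cost can be simulated by a Turing
  machine in time polynomial in the input size plus the cost accumulated so far; conversely the
  language simulates Turing machines with constant overhead per step. The quasi-polynomial time
  bounds of this model and of Turing machines therefore agree.
\<close>

datatype val = VNat nat | VPair val val

datatype unop = OFst | OSnd | OIsPair

datatype binop = OCons | OAdd | OSub | OMul | ODiv | OLess | OEq

datatype expr =
    Var nat
  | Const nat
  | Unary unop expr
  | Binary binop expr expr
  | LetIn expr expr
  | IfNonzero expr expr expr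
  | Call nat "expr list"

text \<open>
  A program is the list of the bodies of its (mutually recursive) functions; \<open>Call f es\<close> refers to
  the body at position \<open>f\<close>. Variables are positions in the environment, the most recently bound
  one first.
\<close>

type_synonym program = "expr list"

definition of_truth :: "bool \<Rightarrow> val" where
  "of_truth b = VNat (if b then 1 else 0)"

fun unop_sem :: "unop \<Rightarrow> val \<Rightarrow> val option" where
  "unop_sem OFst (VPair a b) = Some a"
| "unop_sem OSnd (VPair a b) = Some b"
| "unop_sem OIsPair (VPair a b) = Some (of_truth True)"
| "unop_sem OIsPair (VNat n) = Some (of_truth False)"
| "unop_sem _ _ = None"

fun binop_sem :: "binop \<Rightarrow> val \<Rightarrow> val \<Rightarrow> val option" where
  "binop_sem OCons a b = Some (VPair a b)"
| "binop_sem OAdd (VNat m) (VNat n) = Some (VNat (m + n))"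
| "binop_sem OSub (VNat m) (VNat n) = Some (VNat (m - n))"
| "binop_sem OMul (VNat m) (VNat n) = Some (VNat (m * n))"
| "binop_sem ODiv (VNat m) (VNat n) = Some (VNat (m div n))"
| "binop_sem OLess (VNat m) (VNat n) = Some (of_truth (m < n))"
| "binop_sem OEq (VNat m) (VNat n) = Some (of_truth (m = n))"
| "binop_sem _ _ _ = None"

fun leaf_bits :: "val \<Rightarrow> nat" where
  "leaf_bits (VNat n) = floorlog 2 n"
| "leaf_bits (VPair a b) = 0"

definition binop_cost :: "binop \<Rightarrow> val \<Rightarrow> val \<Rightarrow> nat" where
  "binop_cost f a b = (if f = OCons then 1 else 1 + leaf_bits a + leaf_bits b)"

text \<open>
  \<open>eval P env e v k\<close>: in program \<open>P\<close> and environment \<open>env\<close>, evaluation of \<open>e\<close> terminates with value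
  \<open>v\<close> at total cost \<open>k\<close>. Ill-typed operations, unbound variables and undefined functions are stuck.
\<close>

inductive eval :: "program \<Rightarrow> val list \<Rightarrow> expr \<Rightarrow> val \<Rightarrow> nat \<Rightarrow> bool"
  and evals :: "program \<Rightarrow> val list \<Rightarrow> expr list \<Rightarrow> val list \<Rightarrow> nat \<Rightarrow> bool"
  for P :: program
where
  eval_Var: "i < length env \<Longrightarrow> eval P env (Var i) (env ! i) 1"
| eval_Const: "eval P env (Const n) (VNat n) 1"
| eval_Un: "eval P env e a k \<Longrightarrow> unop_sem f a = Some v \<Longrightarrow> eval P env (Unary f e) v (k + 1)"
| eval_Bin: "eval P env e1 a k1 \<Longrightarrow> eval P env e2 b k2 \<Longrightarrow> binop_sem f a b = Some v \<Longrightarrow>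
    eval P env (Binary f e1 e2) v (k1 + k2 + binop_cost f a b)"
| eval_Let: "eval P env e1 a k1 \<Longrightarrow> eval P (a # env) e2 v k2 \<Longrightarrow>
    eval P env (LetIn e1 e2) v (k1 + k2 + 1)"
| eval_If_true: "eval P env e a k1 \<Longrightarrow> a \<noteq> VNat 0 \<Longrightarrow> eval P env e1 v k2 \<Longrightarrow>
    eval P env (IfNonzero e e1 e2) v (k1 + k2 + 1)"
| eval_If_false: "eval P env e (VNat 0) k1 \<Longrightarrow> eval P env e2 v k2 \<Longrightarrow>
    eval P env (IfNonzero e e1 e2) v (k1 + k2 + 1)"
| eval_Call: "f < length P \<Longrightarrow> evals P env es vs k1 \<Longrightarrow> eval P vs (P ! f) v k2 \<Longrightarrow>
    eval P env (Call f es) v (k1 + k2 + 1)"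
| evals_Nil: "evals P env [] [] 0"
| evals_Cons: "eval P env e v k1 \<Longrightarrow> evals P env es vs k2 \<Longrightarrow>
    evals P env (e # es) (v # vs) (k1 + k2)"

inductive_cases eval_VarE: "eval P env (Var i) v k"
inductive_cases eval_ConstE: "eval P env (Const n) v k"
inductive_cases eval_UnaryE: "eval P env (Unary f e) v k"
inductive_cases eval_BinaryE: "eval P env (Binary f e1 e2) v k"
inductive_cases eval_LetInE: "eval P env (LetIn e1 e2) v k"
inductive_cases eval_IfNonzeroE: "eval P env (IfNonzero e e1 e2) v k"
inductive_cases eval_CallE: "eval P env (Call f es) v k"
inductive_cases evals_NilE: "evals P env [] vs k"
inductive_cases evals_ConsE: "evals P env (e # es) vs k"

lemma eval_deterministic:
  "eval P env e v k \<Longrightarrow> eval P env e v' k' \<Longrightarrow> v' = v \<and> k' = k"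
  "evals P env es vs k \<Longrightarrow> evals P env es vs' k' \<Longrightarrow> vs' = vs \<and> k' = k"
proof (induction arbitrary: v' k' and vs' k' rule: eval_evals.inducts)
  case eval_Var then show ?case by (elim eval_VarE) simp
next
  case eval_Const then show ?case by (elim eval_ConstE) simp
next
  case eval_Un
  show ?case by (rule eval_UnaryE[OF eval_Un.prems]) (metis eval_Un.IH eval_Un.hyps option.inject Suc_eq_plus1)
next
  case eval_Bin
  show ?case
    by (rule eval_BinaryE[OF eval_Bin.prems]) (metis eval_Bin.IH eval_Bin.hyps option.inject Suc_eq_plus1)
next
  case eval_Let
  show ?case by (rule eval_LetInE[OF eval_Let.prems]) (metis eval_Let.IH Suc_eq_plus1)
next
  case eval_If_true
  show ?case
    by (rule eval_IfNonzeroE[OF eval_If_true.prems]) (metis eval_If_true.IH eval_If_true.hyps Suc_eq_plus1)+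
next
  case eval_If_false
  show ?case by (rule eval_IfNonzeroE[OF eval_If_false.prems]) (metis eval_If_false.IH Suc_eq_plus1)+
next
  case eval_Call
  show ?case by (rule eval_CallE[OF eval_Call.prems]) (metis eval_Call.IH Suc_eq_plus1)
next
  case evals_Nil then show ?case by (elim evals_NilE) simp
next
  case evals_Cons
  show ?case by (rule evals_ConsE[OF evals_Cons.prems]) (metis evals_Cons.IH Suc_eq_plus1)
qed

definition computes :: "program \<Rightarrow> val \<Rightarrow> val \<Rightarrow> nat \<Rightarrow> bool" where
  "computes P x y k \<longleftrightarrow> P \<noteq> [] \<and> eval P [x] (P ! 0) y k"

section \<open>Encoding of data\<close>

fun enc_list :: "val list \<Rightarrow> val" where
  "enc_list [] = VNat 0"
| "enc_list (v # vs) = VPair v (enc_list vs)"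

text \<open>Only used for nonnegative rationals: reduced numerator and denominator.\<close>

definition enc_rat :: "rat \<Rightarrow> val" where
  "enc_rat q = VPair (VNat (nat (fst (quotient_of q)))) (VNat (nat (snd (quotient_of q))))"

fun val_size :: "val \<Rightarrow> nat" where
  "val_size (VNat n) = 1 + floorlog 2 n"
| "val_size (VPair a b) = 1 + val_size a + val_size b"

definition encodes_set :: "val \<Rightarrow> nat set \<Rightarrow> bool" where
  "encodes_set v S \<longleftrightarrow> (\<exists>is. distinct is \<and> set is = S \<and> v = enc_list (map VNat is))"

section \<open>UFP-cover\<close>

text \<open>
  The path has the vertices \<open>0, \<dots>, m\<close>, where \<open>m\<close> is the number of demands, and edge \<open>e < m\<close> joins
  the vertices \<open>e\<close> and \<open>e + 1\<close>. Tasks are identified with their positions in the list of tasks.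
\<close>

record task =
  start_vertex :: nat
  end_vertex :: nat
  task_size :: rat
  task_cost :: rat

record ufp_instance =
  demands :: "rat list"
  tasks :: "task list"

definition valid_instance :: "ufp_instance \<Rightarrow> bool" where
  "valid_instance I \<longleftrightarrow>
     (\<forall>u \<in> set (demands I). u \<ge> 0) \<and>
     (\<forall>j \<in> set (tasks I). start_vertex j \<le> end_vertex j \<and> end_vertex j \<le> length (demands I) \<and>
        task_size j > 0 \<and> task_cost j \<ge> 0)"

definition task_indices :: "ufp_instance \<Rightarrow> nat set" where
  "task_indices I = {..<length (tasks I)}"

definition tasks_using :: "ufp_instance \<Rightarrow> nat \<Rightarrow> nat set" where
  "tasks_using I e =
     {i \<in> task_indices I. start_vertex (tasks I ! i) \<le> e \<and> e < end_vertex (tasks I ! i)}"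

definition feasible :: "ufp_instance \<Rightarrow> nat set \<Rightarrow> bool" where
  "feasible I S \<longleftrightarrow> S \<subseteq> task_indices I \<and>
     (\<forall>e < length (demands I).
        (\<Sum>i \<in> S \<inter> tasks_using I e. task_size (tasks I ! i)) \<ge> demands I ! e)"

definition total_cost :: "ufp_instance \<Rightarrow> nat set \<Rightarrow> rat" where
  "total_cost I S = (\<Sum>i \<in> S. task_cost (tasks I ! i))"

text \<open>Meaningful only if a feasible set exists.\<close>

definition opt_cost :: "ufp_instance \<Rightarrow> rat" where
  "opt_cost I = Min (total_cost I ` {S. feasible I S})"

definition approx_solution :: "real \<Rightarrow> ufp_instance \<Rightarrow> nat set \<Rightarrow> bool" where
  "approx_solution \<epsilon> I S \<longleftrightarrow>
     feasible I S \<and> real_of_rat (total_cost I S) \<le> (1 + \<epsilon>) * real_of_rat (opt_cost I)"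

definition enc_task :: "task \<Rightarrow> val" where
  "enc_task j = enc_list
     [VNat (start_vertex j), VNat (end_vertex j), enc_rat (task_size j), enc_rat (task_cost j)]"

definition enc_instance :: "ufp_instance \<Rightarrow> val" where
  "enc_instance I =
     VPair (enc_list (map enc_rat (demands I))) (enc_list (map enc_task (tasks I)))"

definition input_size :: "ufp_instance \<Rightarrow> nat" where
  "input_size I = val_size (enc_instance I)"

section \<open>Quasi-polynomial bounds\<close>

definition quasi_poly :: "(nat \<Rightarrow> real) \<Rightarrow> bool" where
  "quasi_poly f \<longleftrightarrow> (\<exists>k::nat. \<forall>\<^sub>F n in sequentially. f n \<le> 2 powr (log 2 (real n) ^ k))"

definition integral_sizes_upto :: "ufp_instance \<Rightarrow> real \<Rightarrow> bool" where
  "integral_sizes_upto I b \<longleftrightarrow>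
     (\<forall>j \<in> set (tasks I). task_size j \<in> \<int> \<and> real_of_rat (task_size j) \<le> b)"

end

theory Submission
  imports Defs
begin

text \<open>
  Split the path at its middle edge \<open>m\<close>. Every set \<open>Q\<close> of tasks that use \<open>m\<close> is dominated, at every
  edge, by a set of cost at most \<open>(1 + \<epsilon>)\<close> times that of \<open>Q\<close> which has a description of polylogarithmic
  length. Indeed, up to a negligible part \<open>Q\<close> consists of polylogarithmically many groups of
  nearly equal size and cost; within a group only the left and right end points matter, it suffices to
  keep these up to a small fraction of the group, and the loss is compensated by a few further tasks of
  the group that reach farthest to the left and to the right. Enumerating all descriptions and
  recursing into both halves of the path, with the chosen tasks credited against the demands, gives
  recursion depth \<open>log n\<close> and quasi-polynomial branching. The sets chosen at different
  recursion nodes replace disjoint parts of an optimal solution, so the losses do not accumulate.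
\<close>

section \<open>Unit costs\<close>

text \<open>The program never constructs a dominating set: it tries all instruction sequences of a
  fixed length, keeps the cheapest outcome, and is sound whatever that length is. Domination enters
  only in the analysis, which must show that good sets are reachable by short sequences; this is why
  classes and strips are described by comparisons with pivot tasks and by counts. Domination has to
  hold at all edges at once because the chosen set is credited in both halves. The bound on sizes
  keeps the number of size classes polylogarithmic. Costs are unrestricted: tasks far cheaper than
  the dearest task to be replaced can all be bought. The sequence length is
  \<open>L * L * A\<close>, where \<open>L\<close> is read off the input and \<open>A\<close>
  depends on \<open>\<epsilon>\<close> only, so one program serves all quasi-polynomial ranges. The
  loss per crossing set is a factor \<open>1 + 26/D\<close>: \<open>(1 + 1/D) * (1 + 12/D)\<close>
  from the groups plus \<open>1/D\<close> from the cheap tasks.\<close>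

text \<open>The last argument is an upper bound, so weakening is built into every rule.
  \<open>Const c\<close> is charged \<open>c + 1\<close> so that no constant is longer than its
  charge, and \<open>OMul\<close> is left out because repeated squaring doubles bit lengths at each
  step.\<close>

inductive runs :: "program \<Rightarrow> val list \<Rightarrow> expr \<Rightarrow> val \<Rightarrow> nat \<Rightarrow> bool"
  and runs_list :: "program \<Rightarrow> val list \<Rightarrow> expr list \<Rightarrow> val list \<Rightarrow> nat \<Rightarrow> bool"
  for P :: program
where
  runs_Var: "i < length env \<Longrightarrow> 1 \<le> n \<Longrightarrow> runs P env (Var i) (env ! i) n"
| runs_Const: "c + 1 \<le> n \<Longrightarrow> runs P env (Const c) (VNat c) n"
| runs_Un: "runs P env e a k \<Longrightarrow> unop_sem f a = Some v \<Longrightarrow> k + 1 \<le> n \<Longrightarrow> runs P env (Unary f e) v n"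
| runs_Bin: "runs P env e1 a k1 \<Longrightarrow> runs P env e2 b k2 \<Longrightarrow> f \<noteq> OMul \<Longrightarrow> binop_sem f a b = Some v \<Longrightarrow>
    k1 + k2 + 1 \<le> n \<Longrightarrow> runs P env (Binary f e1 e2) v n"
| runs_Let: "runs P env e1 a k1 \<Longrightarrow> runs P (a # env) e2 v k2 \<Longrightarrow> k1 + k2 + 1 \<le> n \<Longrightarrow>
    runs P env (LetIn e1 e2) v n"
| runs_If_true: "runs P env e a k1 \<Longrightarrow> a \<noteq> VNat 0 \<Longrightarrow> runs P env e1 v k2 \<Longrightarrow> k1 + k2 + 1 \<le> n \<Longrightarrow>
    runs P env (IfNonzero e e1 e2) v n"
| runs_If_false: "runs P env e (VNat 0) k1 \<Longrightarrow> runs P env e2 v k2 \<Longrightarrow> k1 + k2 + 1 \<le> n \<Longrightarrow>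
    runs P env (IfNonzero e e1 e2) v n"
| runs_Call: "f < length P \<Longrightarrow> runs_list P env es vs k1 \<Longrightarrow> runs P vs (P ! f) v k2 \<Longrightarrow>
    k1 + k2 + 1 \<le> n \<Longrightarrow> runs P env (Call f es) v n"
| runs_Nil: "runs_list P env [] [] n"
| runs_Cons: "runs P env e v k1 \<Longrightarrow> runs_list P env es vs k2 \<Longrightarrow> k1 + k2 \<le> n \<Longrightarrow>
    runs_list P env (e # es) (v # vs) n"

fun max_bits :: "val \<Rightarrow> nat" where
  "max_bits (VNat n) = floorlog 2 n"
| "max_bits (VPair a b) = max (max_bits a) (max_bits b)"

lemma leaf_bits_le_max_bits: "leaf_bits v \<le> max_bits v"
  by (cases v) auto

lemma less_power_floorlog: "n < 2 ^ floorlog 2 n"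
  using floorlog_bounds[of n 2] by (cases "n = 0") (auto simp: floorlog_def)

lemma floorlog_le_iff_less: "floorlog 2 n \<le> k \<longleftrightarrow> n < 2 ^ k"
proof
  assume "floorlog 2 n \<le> k"
  then have "(2::nat) ^ floorlog 2 n \<le> 2 ^ k" by simp
  then show "n < 2 ^ k" using less_power_floorlog[of n] by linarith
qed (auto intro: floorlog_leI)

lemma max_bits_of_truth: "max_bits (of_truth b) \<le> 1"
  by (simp add: of_truth_def floorlog_le_iff_less)

lemma max_bits_unop: "unop_sem f a = Some v \<Longrightarrow> max_bits v \<le> max_bits a + 1"
  by (cases f; cases a) (auto intro: le_trans[OF max_bits_of_truth])

lemma max_bits_binop:
  assumes "binop_sem f a b = Some v" "f \<noteq> OMul" "max_bits a \<le> B" "max_bits b \<le> B"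
  shows "max_bits v \<le> B + 1"
proof (cases f)
  case OCons
  then show ?thesis using assms by auto
next
  case OAdd
  then obtain m n where "a = VNat m" "b = VNat n" using assms by (cases a; cases b) auto
  then show ?thesis using assms OAdd by (auto simp: floorlog_le_iff_less)
next
  case OSub
  then obtain m n where "a = VNat m" "b = VNat n" using assms by (cases a; cases b) auto
  then show ?thesis using assms OSub by (auto simp: floorlog_le_iff_less)
next
  case ODiv
  then obtain m n where mn: "a = VNat m" "b = VNat n" using assms by (cases a; cases b) auto
  have "m div n \<le> m" by simp
  then show ?thesis using assms ODiv mn by (auto simp: floorlog_le_iff_less simp del: div_le_dividend)
next
  case OLess
  then obtain m n where "a = VNat m" "b = VNat n" using assms by (cases a; cases b) auto
  then show ?thesis using assms OLess max_bits_of_truth[of "m < n"] by auto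
next
  case OEq
  then obtain m n where "a = VNat m" "b = VNat n" using assms by (cases a; cases b) auto
  then show ?thesis using assms OEq max_bits_of_truth[of "m = n"] by auto
qed (use assms in auto)

lemma binop_cost_le:
  assumes "max_bits a \<le> C" "max_bits b \<le> C"
  shows "binop_cost f a b \<le> 1 + 2 * C"
  using assms leaf_bits_le_max_bits[of a] leaf_bits_le_max_bits[of b]
  by (auto simp: binop_cost_def)

text \<open>Without multiplication, a run of \<open>n\<close> unit steps lengthens numbers by at most \<open>n\<close> bits, so
  the logarithmic cost is at most quadratic in the unit cost.\<close>

lemma runs_imp_eval:
  "runs P env e v n \<Longrightarrow> \<forall>x\<in>set env. max_bits x \<le> B \<Longrightarrow>
     max_bits v \<le> B + n \<and> (\<exists>k. eval P env e v k \<and> k \<le> n * (1 + 2 * (B + n)))"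
  "runs_list P env es vs n \<Longrightarrow> \<forall>x\<in>set env. max_bits x \<le> B \<Longrightarrow>
     (\<forall>x\<in>set vs. max_bits x \<le> B + n) \<and> (\<exists>k. evals P env es vs k \<and> k \<le> n * (1 + 2 * (B + n)))"
proof (induction arbitrary: B and B rule: runs_runs_list.inducts)
  case (runs_Var i env n)
  have "max_bits (env ! i) \<le> B + n" using runs_Var by (simp add: trans_le_add1)
  moreover have "1 \<le> n * (1 + 2 * (B + n))" using runs_Var by simp
  ultimately show ?case using runs_Var by (blast intro: eval_Var)
next
  case (runs_Const c n env)
  have "floorlog 2 c \<le> c" by (simp add: floorlog_le_iff_less)
  then have "max_bits (VNat c) \<le> B + n" using runs_Const by simp
  moreover have "1 \<le> n * (1 + 2 * (B + n))" using runs_Const by simp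
  ultimately show ?case by (blast intro: eval_Const)
next
  case (runs_Un env e a k f v n)
  from runs_Un.IH(2)[OF runs_Un.prems] obtain j
    where a: "max_bits a \<le> B + k" and j: "eval P env e a j" "j \<le> k * (1 + 2 * (B + k))" by blast
  have "max_bits v \<le> B + n" using max_bits_unop[OF runs_Un.hyps(1)] a runs_Un.hyps(2) by linarith
  moreover have "j + 1 \<le> n * (1 + 2 * (B + n))"
  proof -
    have "j + 1 \<le> (k + 1) * (1 + 2 * (B + k))" using j(2) by simp
    also have "\<dots> \<le> n * (1 + 2 * (B + n))" using runs_Un.hyps(2) by (intro mult_mono) auto
    finally show ?thesis .
  qed
  ultimately show ?case using eval_Un[OF j(1) runs_Un.hyps(1)] by blast
next
  case (runs_Bin env e1 a k1 e2 b k2 f v n)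
  from runs_Bin.IH(2)[OF runs_Bin.prems] obtain j1
    where a: "max_bits a \<le> B + k1" and j1: "eval P env e1 a j1" "j1 \<le> k1 * (1 + 2 * (B + k1))" by blast
  from runs_Bin.IH(4)[OF runs_Bin.prems] obtain j2
    where b: "max_bits b \<le> B + k2" and j2: "eval P env e2 b j2" "j2 \<le> k2 * (1 + 2 * (B + k2))" by blast
  have le: "k1 + k2 + 1 \<le> n" by fact
  have "max_bits v \<le> (B + k1 + k2) + 1"
    by (rule max_bits_binop[OF runs_Bin.hyps(2) runs_Bin.hyps(1)]) (use a b in auto)
  then have "max_bits v \<le> B + n" using le by linarith
  moreover have "j1 + j2 + binop_cost f a b \<le> n * (1 + 2 * (B + n))"
  proof -
    have "binop_cost f a b \<le> 1 + 2 * (B + n)" by (rule binop_cost_le) (use a b le in auto)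
    moreover have "j1 \<le> k1 * (1 + 2 * (B + n))"
      by (rule le_trans[OF j1(2)]) (use le in \<open>auto intro!: mult_mono\<close>)
    moreover have "j2 \<le> k2 * (1 + 2 * (B + n))"
      by (rule le_trans[OF j2(2)]) (use le in \<open>auto intro!: mult_mono\<close>)
    ultimately have "j1 + j2 + binop_cost f a b \<le> (k1 + k2 + 1) * (1 + 2 * (B + n))"
      by (simp add: algebra_simps)
    also have "\<dots> \<le> n * (1 + 2 * (B + n))" using le by (intro mult_mono) auto
    finally show ?thesis .
  qed
  ultimately show ?case using eval_Bin[OF j1(1) j2(1) runs_Bin.hyps(2)] by blast
next
  case (runs_Let env e1 a k1 e2 v k2 n)
  from runs_Let.IH(2)[OF runs_Let.prems] obtain j1
    where a: "max_bits a \<le> B + k1" and j1: "eval P env e1 a j1" "j1 \<le> k1 * (1 + 2 * (B + k1))" by blast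
  have "\<forall>x\<in>set (a # env). max_bits x \<le> B + k1" using a runs_Let.prems by (auto intro: trans_le_add1)
  from runs_Let.IH(4)[OF this] obtain j2 where v: "max_bits v \<le> B + k1 + k2"
    and j2: "eval P (a # env) e2 v j2" "j2 \<le> k2 * (1 + 2 * (B + k1 + k2))" by blast
  have le: "k1 + k2 + 1 \<le> n" by fact
  have "max_bits v \<le> B + n" using v le by linarith
  moreover have "j1 + j2 + 1 \<le> n * (1 + 2 * (B + n))"
  proof -
    have "j1 \<le> k1 * (1 + 2 * (B + n))"
      by (rule le_trans[OF j1(2)]) (use le in \<open>auto intro!: mult_mono\<close>)
    moreover have "j2 \<le> k2 * (1 + 2 * (B + n))"
      by (rule le_trans[OF j2(2)]) (use le in \<open>auto intro!: mult_mono\<close>)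
    ultimately have "j1 + j2 + 1 \<le> (k1 + k2 + 1) * (1 + 2 * (B + n))" by (simp add: algebra_simps)
    also have "\<dots> \<le> n * (1 + 2 * (B + n))" using le by (intro mult_mono) auto
    finally show ?thesis .
  qed
  ultimately show ?case using eval_Let[OF j1(1) j2(1)] by blast
next
  case (runs_If_true env e a k1 e1 v k2 n e2)
  from runs_If_true.IH(2)[OF runs_If_true.prems] obtain j1
    where j1: "eval P env e a j1" "j1 \<le> k1 * (1 + 2 * (B + k1))" by blast
  from runs_If_true.IH(4)[OF runs_If_true.prems] obtain j2
    where v: "max_bits v \<le> B + k2" and j2: "eval P env e1 v j2" "j2 \<le> k2 * (1 + 2 * (B + k2))" by blast
  have le: "k1 + k2 + 1 \<le> n" by fact
  have "max_bits v \<le> B + n" using v le by linarith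
  moreover have "j1 + j2 + 1 \<le> n * (1 + 2 * (B + n))"
  proof -
    have "j1 \<le> k1 * (1 + 2 * (B + n))"
      by (rule le_trans[OF j1(2)]) (use le in \<open>auto intro!: mult_mono\<close>)
    moreover have "j2 \<le> k2 * (1 + 2 * (B + n))"
      by (rule le_trans[OF j2(2)]) (use le in \<open>auto intro!: mult_mono\<close>)
    ultimately have "j1 + j2 + 1 \<le> (k1 + k2 + 1) * (1 + 2 * (B + n))" by (simp add: algebra_simps)
    also have "\<dots> \<le> n * (1 + 2 * (B + n))" using le by (intro mult_mono) auto
    finally show ?thesis .
  qed
  ultimately show ?case using eval_If_true[OF j1(1) runs_If_true.hyps(1) j2(1)] by blast
next
  case (runs_If_false env e k1 e2 v k2 n e1)
  from runs_If_false.IH(2)[OF runs_If_false.prems] obtain j1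
    where j1: "eval P env e (VNat 0) j1" "j1 \<le> k1 * (1 + 2 * (B + k1))" by blast
  from runs_If_false.IH(4)[OF runs_If_false.prems] obtain j2
    where v: "max_bits v \<le> B + k2" and j2: "eval P env e2 v j2" "j2 \<le> k2 * (1 + 2 * (B + k2))" by blast
  have le: "k1 + k2 + 1 \<le> n" by fact
  have "max_bits v \<le> B + n" using v le by linarith
  moreover have "j1 + j2 + 1 \<le> n * (1 + 2 * (B + n))"
  proof -
    have "j1 \<le> k1 * (1 + 2 * (B + n))"
      by (rule le_trans[OF j1(2)]) (use le in \<open>auto intro!: mult_mono\<close>)
    moreover have "j2 \<le> k2 * (1 + 2 * (B + n))"
      by (rule le_trans[OF j2(2)]) (use le in \<open>auto intro!: mult_mono\<close>)
    ultimately have "j1 + j2 + 1 \<le> (k1 + k2 + 1) * (1 + 2 * (B + n))" by (simp add: algebra_simps)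
    also have "\<dots> \<le> n * (1 + 2 * (B + n))" using le by (intro mult_mono) auto
    finally show ?thesis .
  qed
  ultimately show ?case using eval_If_false[OF j1(1) j2(1)] by blast
next
  case (runs_Call f env es vs k1 v k2 n)
  from runs_Call.IH(3)[OF runs_Call.prems] obtain j1
    where vs: "\<forall>x\<in>set vs. max_bits x \<le> B + k1"
      and j1: "evals P env es vs j1" "j1 \<le> k1 * (1 + 2 * (B + k1))" by blast
  from runs_Call.IH(5)[OF vs] obtain j2 where v: "max_bits v \<le> B + k1 + k2"
    and j2: "eval P vs (P ! f) v j2" "j2 \<le> k2 * (1 + 2 * (B + k1 + k2))" by blast
  have le: "k1 + k2 + 1 \<le> n" by fact
  have "max_bits v \<le> B + n" using v le by linarith
  moreover have "j1 + j2 + 1 \<le> n * (1 + 2 * (B + n))"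
  proof -
    have "j1 \<le> k1 * (1 + 2 * (B + n))"
      by (rule le_trans[OF j1(2)]) (use le in \<open>auto intro!: mult_mono\<close>)
    moreover have "j2 \<le> k2 * (1 + 2 * (B + n))"
      by (rule le_trans[OF j2(2)]) (use le in \<open>auto intro!: mult_mono\<close>)
    ultimately have "j1 + j2 + 1 \<le> (k1 + k2 + 1) * (1 + 2 * (B + n))" by (simp add: algebra_simps)
    also have "\<dots> \<le> n * (1 + 2 * (B + n))" using le by (intro mult_mono) auto
    finally show ?thesis .
  qed
  ultimately show ?case using eval_Call[OF runs_Call.IH(1) j1(1) j2(1)] by blast
next
  case (runs_Nil env n)
  show ?case using evals_Nil[of P env] by (metis empty_iff list.set(1) zero_le)
next
  case (runs_Cons env e v k1 es vs k2 n)
  from runs_Cons.IH(2)[OF runs_Cons.prems] obtain j1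
    where v: "max_bits v \<le> B + k1" and j1: "eval P env e v j1" "j1 \<le> k1 * (1 + 2 * (B + k1))" by blast
  from runs_Cons.IH(4)[OF runs_Cons.prems] obtain j2
    where vs: "\<forall>x\<in>set vs. max_bits x \<le> B + k2"
      and j2: "evals P env es vs j2" "j2 \<le> k2 * (1 + 2 * (B + k2))" by blast
  have le: "k1 + k2 \<le> n" by fact
  have "\<forall>x\<in>set (v # vs). max_bits x \<le> B + n" using v vs le by fastforce
  moreover have "j1 + j2 \<le> n * (1 + 2 * (B + n))"
  proof -
    have "j1 \<le> k1 * (1 + 2 * (B + n))"
      by (rule le_trans[OF j1(2)]) (use le in \<open>auto intro!: mult_mono\<close>)
    moreover have "j2 \<le> k2 * (1 + 2 * (B + n))"
      by (rule le_trans[OF j2(2)]) (use le in \<open>auto intro!: mult_mono\<close>)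
    ultimately have "j1 + j2 \<le> (k1 + k2) * (1 + 2 * (B + n))" by (simp add: algebra_simps)
    also have "\<dots> \<le> n * (1 + 2 * (B + n))" using le by (intro mult_mono) auto
    finally show ?thesis .
  qed
  ultimately show ?case using evals_Cons[OF j1(1) j2(1)] by blast
qed

lemma runs_mono: "runs P env e v k \<Longrightarrow> k \<le> n \<Longrightarrow> runs P env e v n"
  by (erule runs.cases) (auto intro: runs_runs_list.intros)

section \<open>Weakest preconditions of unit-cost runs\<close>

text \<open>Calls stay opaque in \<open>wp\<close>: each one is resolved by the specification of the
  callee. Unfolding the bodies instead would not terminate on recursive functions.\<close>

definition call_wp :: "program \<Rightarrow> nat \<Rightarrow> val list \<Rightarrow> (val \<Rightarrow> nat \<Rightarrow> bool) \<Rightarrow> bool" where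
  "call_wp P f vs Q \<longleftrightarrow> f < length P \<and> (\<exists>v n. runs P vs (P ! f) v n \<and> Q v n)"

text \<open>The postcondition receives the value and a bound on the unit cost.\<close>

fun wp :: "program \<Rightarrow> expr \<Rightarrow> val list \<Rightarrow> (val \<Rightarrow> nat \<Rightarrow> bool) \<Rightarrow> bool"
  and wps :: "program \<Rightarrow> expr list \<Rightarrow> val list \<Rightarrow> (val list \<Rightarrow> nat \<Rightarrow> bool) \<Rightarrow> bool" where
  "wp P (Var i) env Q \<longleftrightarrow> i < length env \<and> Q (env ! i) 1"
| "wp P (Const c) env Q \<longleftrightarrow> Q (VNat c) (c + 1)"
| "wp P (Unary f e) env Q \<longleftrightarrow>
     wp P e env (\<lambda>a k. case unop_sem f a of None \<Rightarrow> False | Some v \<Rightarrow> Q v (k + 1))"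
| "wp P (Binary f e1 e2) env Q \<longleftrightarrow> f \<noteq> OMul \<and>
     wp P e1 env (\<lambda>a k1. wp P e2 env (\<lambda>b k2.
       case binop_sem f a b of None \<Rightarrow> False | Some v \<Rightarrow> Q v (k1 + k2 + 1)))"
| "wp P (LetIn e1 e2) env Q \<longleftrightarrow>
     wp P e1 env (\<lambda>a k1. wp P e2 (a # env) (\<lambda>v k2. Q v (k1 + k2 + 1)))"
| "wp P (IfNonzero e e1 e2) env Q \<longleftrightarrow>
     wp P e env (\<lambda>a k1. if a = VNat 0 then wp P e2 env (\<lambda>v k2. Q v (k1 + k2 + 1))
       else wp P e1 env (\<lambda>v k2. Q v (k1 + k2 + 1)))"
| "wp P (Call f es) env Q \<longleftrightarrow> wps P es env (\<lambda>vs k1. call_wp P f vs (\<lambda>v k2. Q v (k1 + k2 + 1)))"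
| "wps P [] env Q \<longleftrightarrow> Q [] 0"
| "wps P (e # es) env Q \<longleftrightarrow> wp P e env (\<lambda>v k1. wps P es env (\<lambda>vs k2. Q (v # vs) (k1 + k2)))"

lemma wp_imp_runs:
  "wp P e env Q \<Longrightarrow> \<exists>v n. runs P env e v n \<and> Q v n"
  "wps P es env R \<Longrightarrow> \<exists>vs n. runs_list P env es vs n \<and> R vs n"
proof (induction P e env Q and P es env R rule: wp_wps.induct)
  case (1 P i env Q)
  then show ?case using runs_Var[of i env 1 P] by auto
next
  case (2 P c env Q)
  then show ?case using runs_Const[of c "c + 1" P env] by auto
next
  case (3 P f e env Q)
  from 3(2) have "wp P e env (\<lambda>a k. case unop_sem f a of None \<Rightarrow> False | Some v \<Rightarrow> Q v (k + 1))" by simp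
  from 3(1)[OF this] show ?case by (fastforce split: option.splits intro: runs_Un)
next
  case (4 P f e1 e2 env Q)
  then show ?case by (fastforce split: option.splits intro: runs_Bin)
next
  case (5 P e1 e2 env Q)
  then show ?case by (fastforce intro: runs_Let)
next
  case (6 P e e1 e2 env Q)
  from 6(4) have "wp P e env (\<lambda>a k1. if a = VNat 0 then wp P e2 env (\<lambda>v k2. Q v (k1 + k2 + 1))
       else wp P e1 env (\<lambda>v k2. Q v (k1 + k2 + 1)))" by simp
  from 6(3)[OF this] obtain a k1 where a: "runs P env e a k1"
    and *: "if a = VNat 0 then wp P e2 env (\<lambda>v k2. Q v (k1 + k2 + 1))
       else wp P e1 env (\<lambda>v k2. Q v (k1 + k2 + 1))" by blast
  show ?case
  proof (cases "a = VNat 0")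
    case True
    with * 6(1)[of a k1] obtain v k2 where "runs P env e2 v k2" "Q v (k1 + k2 + 1)" by auto
    then show ?thesis using a True by (blast intro: runs_If_false)
  next
    case False
    with * 6(2)[of a k1] obtain v k2 where "runs P env e1 v k2" "Q v (k1 + k2 + 1)" by auto
    then show ?thesis using a False by (blast intro: runs_If_true)
  qed
next
  case (7 P f es env Q)
  then show ?case by (fastforce simp: call_wp_def intro: runs_Call)
next
  case (8 P env Q)
  then show ?case by (auto intro: runs_Nil)
next
  case (9 P e es env Q)
  then show ?case by (fastforce intro: runs_Cons)
qed

lemma runs_wpI: "wp P e env (\<lambda>v' k. v' = v \<and> k \<le> n) \<Longrightarrow> runs P env e v n"
  using wp_imp_runs(1) runs_mono by blast

lemma call_wpI: "runs P vs (P ! f) v n \<Longrightarrow> f < length P \<Longrightarrow> Q v n \<Longrightarrow> call_wp P f vs Q"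
  unfolding call_wp_def by blast

section \<open>The program\<close>

abbreviation (input) "Fst e \<equiv> Unary OFst e"
abbreviation (input) "Snd e \<equiv> Unary OSnd e"
abbreviation (input) "Add a b \<equiv> Binary OAdd a b"
abbreviation (input) "Sub a b \<equiv> Binary OSub a b"
abbreviation (input) "Div a b \<equiv> Binary ODiv a b"
abbreviation (input) "Less a b \<equiv> Binary OLess a b"
abbreviation (input) "Pr a b \<equiv> Binary OCons a b"

definition "fMul = (1::nat)"
definition "fDens = (2::nat)"
definition "fConv = (3::nat)"
definition "fCeils = (4::nat)"
definition "fLen = (5::nat)"
definition "fSum = (6::nat)"
definition "fLog = (7::nat)"
definition "fNth = (8::nat)"
definition "fCov = (9::nat)"
definition "fApp = (10::nat)"
definition "fMids = (11::nat)"
definition "fTest = (12::nat)"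
definition "fFilt = (13::nat)"
definition "fPick = (14::nat)"
definition "fBetter = (15::nat)"
definition "fSearch = (16::nat)"
definition "fOps = (17::nat)"
definition "fTry = (18::nat)"
definition "fStep = (19::nat)"
definition "fFinish = (20::nat)"
definition "fRec = (21::nat)"
definition "fIdxs = (22::nat)"

text \<open>Multiplication by repeated doubling, since \<open>runs\<close> excludes
  \<open>OMul\<close>; the last summand tests the parity of the second factor.\<close>

definition mul_body :: expr where
  "mul_body = IfNonzero (Var 1)
     (LetIn (Call fMul [Var 0, Div (Var 1) (Const 2)])
       (Add (Add (Var 0) (Var 0))
         (IfNonzero (Sub (Var 2) (Add (Div (Var 2) (Const 2)) (Div (Var 2) (Const 2)))) (Var 1) (Const 0))))
     (Const 0)"

definition dens_body :: expr where
  "dens_body = IfNonzero (Var 0)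
     (Call fMul [Call fDens [Snd (Var 0)], Snd (Fst (Snd (Snd (Snd (Fst (Var 0))))))])
     (Const 1)"

definition conv_body :: expr where
  "conv_body = IfNonzero (Var 0)
     (LetIn (Fst (Var 0))
       (Pr
         (Pr (Fst (Var 0)) (Pr (Fst (Snd (Var 0))) (Pr (Fst (Fst (Snd (Snd (Var 0)))))
           (Pr (Call fMul [Div (Var 3) (Snd (Fst (Snd (Snd (Snd (Var 0)))))), Fst (Fst (Snd (Snd (Snd (Var 0)))))])
             (Pr (Var 2) (Const 0))))))
         (Call fConv [Snd (Var 1), Add (Var 2) (Const 1), Var 3])))
     (Const 0)"

definition ceils_body :: expr where
  "ceils_body = IfNonzero (Var 0)
     (Pr (Div (Sub (Add (Fst (Fst (Var 0))) (Snd (Fst (Var 0)))) (Const 1)) (Snd (Fst (Var 0))))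
       (Call fCeils [Snd (Var 0)]))
     (Const 0)"

definition len_body :: expr where
  "len_body = IfNonzero (Var 0) (Add (Call fLen [Snd (Var 0)]) (Const 1)) (Const 0)"

definition sum_body :: expr where
  "sum_body = IfNonzero (Var 0)
     (Add (Call fNth [Fst (Var 0), Var 1]) (Call fSum [Snd (Var 0), Var 1])) (Const 0)"

definition log_body :: expr where
  "log_body = IfNonzero (Var 0) (Add (Call fLog [Div (Var 0) (Const 2)]) (Const 1)) (Const 0)"

definition nth_body :: expr where
  "nth_body = IfNonzero (Var 1) (Call fNth [Snd (Var 0), Sub (Var 1) (Const 1)]) (Fst (Var 0))"

definition cov_body :: expr where
  "cov_body = IfNonzero (Var 0)
     (Add (IfNonzero (Less (Var 1) (Fst (Fst (Var 0)))) (Const 0)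
            (IfNonzero (Less (Var 1) (Fst (Snd (Fst (Var 0))))) (Fst (Snd (Snd (Fst (Var 0))))) (Const 0)))
       (Call fCov [Snd (Var 0), Var 1]))
     (Const 0)"

definition app_body :: expr where
  "app_body = IfNonzero (Var 0) (Pr (Fst (Var 0)) (Call fApp [Snd (Var 0), Var 1])) (Var 1)"

definition mids_body :: expr where
  "mids_body = IfNonzero (Var 0)
     (LetIn (Call fMids [Snd (Var 0), Var 1, Var 2, Var 3])
       (LetIn (Fst (Var 1))
         (IfNonzero (Less (Fst (Var 0)) (Var 3)) (Var 1)
         (IfNonzero (Less (Var 4) (Fst (Var 0))) (Var 1)
         (IfNonzero (Less (Var 5) (Fst (Snd (Var 0)))) (Var 1)
         (IfNonzero (Less (Var 4) (Fst (Snd (Var 0)))) (Pr (Var 0) (Var 1)) (Var 1)))))))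
     (Const 0)"

definition test_body :: expr where
  "test_body = IfNonzero (Less (Var 0) (Const 4))
     (IfNonzero (Less (Call fNth [Var 2, Var 0]) (Call fNth [Var 1, Var 0])) (Const 0) (Const 1))
     (LetIn (Sub (Var 0) (Const 4))
       (IfNonzero (Less (Call fNth [Var 2, Var 0]) (Call fNth [Var 3, Var 0])) (Const 0) (Const 1)))"

definition filt_body :: expr where
  "filt_body = IfNonzero (Var 2)
     (LetIn (Call fFilt [Var 0, Var 1, Snd (Var 2), Var 3])
       (IfNonzero (Call fTest [Var 1, Var 2, Fst (Var 3)])
         (Pr (Pr (Fst (Var 3)) (Fst (Var 0))) (Snd (Var 0)))
         (Pr (Fst (Var 0)) (Pr (Fst (Var 3)) (Snd (Var 0))))))
     (Pr (Const 0) (Var 3))"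

definition pick_body :: expr where
  "pick_body = IfNonzero (Var 0)
     (IfNonzero (Var 1) (Call fPick [Snd (Var 0), Snd (Var 1), Pr (Fst (Var 1)) (Var 2)]) (Pr (Var 1) (Var 2)))
     (Pr (Var 1) (Var 2))"

definition better_body :: expr where
  "better_body = IfNonzero (Var 0)
     (IfNonzero (Var 1) (IfNonzero (Less (Fst (Var 1)) (Fst (Var 0))) (Var 1) (Var 0)) (Var 0))
     (Var 1)"

text \<open>The search functions carry a context \<open>(G, a, m, b, A, TM)\<close>, where \<open>G = (us, T, K)\<close>: demands,
  tasks, and length of the instruction sequences; the current interval and its middle; the
  tasks chosen so far; and the tasks from which the middle edge is to be covered.\<close>

definition search_body :: expr where
  "search_body = IfNonzero (Var 1)
     (LetIn (Sub (Var 1) (Const 1))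
       (Call fBetter
         [Call fSearch [Var 1, Var 0, Var 3, Var 4, Var 5],
          Call fOps [Var 1, Var 0, Var 3, Var 4, Var 5, Const 9]]))
     (Call fFinish [Var 0, Var 4])"

definition ops_body :: expr where
  "ops_body = IfNonzero (Var 5)
     (LetIn (Sub (Var 5) (Const 1))
       (Call fBetter
         [Call fTry [Var 1, Var 2, Var 3, Var 4, Var 5, Var 0, Snd (Snd (Snd (Snd (Snd (Var 1)))))],
          Call fOps [Var 1, Var 2, Var 3, Var 4, Var 5, Var 0]]))
     (Const 0)"

definition try_body :: expr where
  "try_body = IfNonzero (Var 6)
     (Call fBetter
       [Call fStep [Var 0, Var 1, Var 2, Var 3, Var 4, Var 5, Var 6],
        Call fTry [Var 0, Var 1, Var 2, Var 3, Var 4, Var 5, Snd (Var 6)]])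
     (Const 0)"

definition step_body :: expr where
  "step_body = IfNonzero (Less (Var 5) (Const 8))
     (LetIn (Call fFilt [Var 5, Fst (Var 6), Var 2, Var 3])
       (Call fSearch [Var 1, Var 2, Fst (Var 0), Snd (Var 0), Var 5]))
     (LetIn (Call fPick [Var 6, Var 2, Var 4])
       (Call fSearch [Var 1, Var 2, Call fApp [Fst (Var 0), Var 4], Const 0, Snd (Var 0)]))"

definition finish_body :: expr where
  "finish_body =
     LetIn (Call fApp [Var 1, Fst (Snd (Snd (Snd (Snd (Var 0)))))])
     (IfNonzero (Less (Call fCov [Var 0, Fst (Snd (Snd (Var 1)))])
                      (Call fNth [Fst (Fst (Var 1)), Fst (Snd (Snd (Var 1)))]))
       (Const 0)
       (LetIn (Call fRec [Fst (Var 1), Fst (Snd (Var 1)), Fst (Snd (Snd (Var 1))), Var 0])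
       (IfNonzero (Var 0)
         (LetIn (Call fRec [Fst (Var 2), Add (Fst (Snd (Snd (Var 2)))) (Const 1),
                            Fst (Snd (Snd (Snd (Var 2)))), Var 1])
         (IfNonzero (Var 0)
           (Pr (Add (Add (Fst (Var 1)) (Fst (Var 0))) (Call fSum [Var 4, Const 3]))
               (Call fApp [Var 4, Call fApp [Snd (Var 1), Snd (Var 0)]]))
           (Const 0)))
         (Const 0))))"

definition rec_body :: expr where
  "rec_body = IfNonzero (Less (Var 1) (Var 2))
     (LetIn (Div (Add (Var 1) (Var 2)) (Const 2))
     (LetIn (Call fMids [Fst (Snd (Var 1)), Var 2, Var 0, Var 3])
       (Call fSearch
         [Pr (Var 2) (Pr (Var 3) (Pr (Var 1) (Pr (Var 4) (Pr (Var 5) (Var 0))))),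
          Snd (Snd (Var 2)), Var 0, Const 0, Const 0])))
     (Pr (Const 0) (Const 0))"

definition idxs_body :: expr where
  "idxs_body = IfNonzero (Var 0)
     (Pr (Call fNth [Fst (Var 0), Const 4]) (Call fIdxs [Snd (Var 0)])) (Const 0)"

definition main_body :: "nat \<Rightarrow> expr" where
  "main_body A =
     LetIn (Call fConv [Snd (Var 0), Const 0, Call fDens [Snd (Var 0)]])
     (LetIn (Call fCeils [Fst (Var 1)])
     (LetIn (Call fLog [Add (Call fSum [Var 1, Const 2]) (Const 1)])
     (LetIn (Call fMul [Call fMul [Var 0, Var 0], Const A])
     (LetIn (Call fRec [Pr (Var 2) (Pr (Var 3) (Var 0)), Const 0, Call fLen [Var 2], Const 0])
       (IfNonzero (Var 0) (Call fIdxs [Snd (Var 0)]) (Const 0))))))"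

definition prog :: "nat \<Rightarrow> program" where
  "prog A = [main_body A, mul_body, dens_body, conv_body, ceils_body, len_body, sum_body, log_body,
     nth_body, cov_body, app_body, mids_body, test_body, filt_body, pick_body, better_body,
     search_body, ops_body, try_body, step_body, finish_body, rec_body, idxs_body]"

lemma prog_nth [simp]:
  "prog A ! 0 = main_body A" "prog A ! fMul = mul_body" "prog A ! fDens = dens_body"
  "prog A ! fConv = conv_body" "prog A ! fCeils = ceils_body" "prog A ! fLen = len_body"
  "prog A ! fSum = sum_body" "prog A ! fLog = log_body" "prog A ! fNth = nth_body"
  "prog A ! fCov = cov_body" "prog A ! fApp = app_body" "prog A ! fMids = mids_body"
  "prog A ! fTest = test_body" "prog A ! fFilt = filt_body" "prog A ! fPick = pick_body"
  "prog A ! fBetter = better_body" "prog A ! fSearch = search_body" "prog A ! fOps = ops_body"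
  "prog A ! fTry = try_body" "prog A ! fStep = step_body" "prog A ! fFinish = finish_body"
  "prog A ! fRec = rec_body" "prog A ! fIdxs = idxs_body"
  by (simp_all add: prog_def fMul_def fDens_def fConv_def fCeils_def fLen_def fSum_def fLog_def
      fNth_def fCov_def fApp_def fMids_def fTest_def fFilt_def fPick_def fBetter_def fSearch_def
      fOps_def fTry_def fStep_def fFinish_def fRec_def fIdxs_def)

lemma fun_less_length_prog [simp]:
  "fMul < length (prog A)" "fDens < length (prog A)" "fConv < length (prog A)"
  "fCeils < length (prog A)" "fLen < length (prog A)" "fSum < length (prog A)"
  "fLog < length (prog A)" "fNth < length (prog A)" "fCov < length (prog A)"
  "fApp < length (prog A)" "fMids < length (prog A)" "fTest < length (prog A)"
  "fFilt < length (prog A)" "fPick < length (prog A)" "fBetter < length (prog A)"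
  "fSearch < length (prog A)" "fOps < length (prog A)" "fTry < length (prog A)"
  "fStep < length (prog A)" "fFinish < length (prog A)" "fRec < length (prog A)"
  "fIdxs < length (prog A)"
  by (simp_all add: prog_def fMul_def fDens_def fConv_def fCeils_def fLen_def fSum_def fLog_def
      fNth_def fCov_def fApp_def fMids_def fTest_def fFilt_def fPick_def fBetter_def fSearch_def
      fOps_def fTry_def fStep_def fFinish_def fRec_def fIdxs_def)

section \<open>Specifications of the auxiliary functions\<close>

definition calls :: "nat \<Rightarrow> nat \<Rightarrow> val list \<Rightarrow> val \<Rightarrow> nat \<Rightarrow> bool" where
  "calls A f vs v n \<longleftrightarrow> runs (prog A) vs (prog A ! f) v n"

lemma calls_wpI: "wp (prog A) (prog A ! f) vs (\<lambda>v' k. v' = v \<and> k \<le> n) \<Longrightarrow> calls A f vs v n"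
  unfolding calls_def by (rule runs_wpI)

lemma call_callsI: "calls A f vs v n \<Longrightarrow> f < length (prog A) \<Longrightarrow> Q v n \<Longrightarrow> call_wp (prog A) f vs Q"
  unfolding calls_def by (rule call_wpI)

lemma calls_mono: "calls A f vs v k \<Longrightarrow> k \<le> n \<Longrightarrow> calls A f vs v n"
  unfolding calls_def by (rule runs_mono)

lemma of_truth_eq_0 [simp]: "of_truth b = VNat 0 \<longleftrightarrow> \<not> b"
  by (simp add: of_truth_def)

lemma floorlog_2_rec: "0 < b \<Longrightarrow> floorlog 2 b = floorlog 2 (b div 2) + 1"
  using compute_floorlog[of 2 b] by simp

lemma calls_mul: "calls A fMul [VNat a, VNat b] (VNat (a * b)) (40 * floorlog 2 b + 10)"
proof (induction b rule: less_induct)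
  case (less b)
  show ?case
  proof (cases "b = 0")
    case True
    show ?thesis by (rule calls_wpI) (simp add: mul_body_def True)
  next
    case False
    then have "b div 2 < b" by simp
    note IH = less.IH[OF this]
    have *: "a * b = a * (b div 2) + a * (b div 2) + (if odd b then a else 0)"
      by (cases "even b") (auto elim!: evenE oddE simp: algebra_simps)
    have **: "b \<le> b div 2 + b div 2 \<longleftrightarrow> even b" by presburger
    show ?thesis
      apply (rule calls_wpI)
      apply (simp add: mul_body_def False)
      apply (rule call_callsI[OF IH])
       apply simp
      using * ** floorlog_2_rec[of b] False apply (auto simp: algebra_simps)
      done
  qed
qed

definition enc_nats :: "nat list \<Rightarrow> val" where
  "enc_nats t = enc_list (map VNat t)"

definition enc_natss :: "nat list list \<Rightarrow> val" where
  "enc_natss ts = enc_list (map enc_nats ts)"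

lemma enc_nats_simps [simp]: "enc_nats [] = VNat 0" "enc_nats (x # t) = VPair (VNat x) (enc_nats t)"
  by (simp_all add: enc_nats_def)

lemma enc_natss_simps [simp]:
  "enc_natss [] = VNat 0" "enc_natss (t # ts) = VPair (enc_nats t) (enc_natss ts)"
  by (simp_all add: enc_natss_def)

text \<open>Failure is a leaf, and no pair equals \<open>VNat 0\<close>, so \<open>IfNonzero\<close>
  applied to a result tests for success.\<close>

fun enc_res :: "(nat \<times> nat list list) option \<Rightarrow> val" where
  "enc_res None = VNat 0"
| "enc_res (Some (c, ts)) = VPair (VNat c) (enc_natss ts)"

text \<open>A task is the list of its start vertex, end vertex, size, scaled cost, and position.\<close>

definition tasks_ok :: "nat list list \<Rightarrow> bool" where
  "tasks_ok ts \<longleftrightarrow> (\<forall>t\<in>set ts. length t = 5)"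

lemma tasks_ok_simps [simp]:
  "tasks_ok []" "tasks_ok (t # ts) \<longleftrightarrow> length t = 5 \<and> tasks_ok ts"
  "tasks_ok (ts @ us) \<longleftrightarrow> tasks_ok ts \<and> tasks_ok us"
  by (auto simp: tasks_ok_def)

lemma tasks_ok_subset: "tasks_ok ts \<Longrightarrow> set us \<subseteq> set ts \<Longrightarrow> tasks_ok us"
  by (auto simp: tasks_ok_def)

lemma enc_nats_length_5:
  assumes "length t = 5"
  shows "enc_nats t = VPair (VNat (t ! 0)) (VPair (VNat (t ! 1)) (VPair (VNat (t ! 2))
    (VPair (VNat (t ! 3)) (VPair (VNat (t ! 4)) (VNat 0)))))"
proof -
  have "\<exists>a b c d e. t = [a, b, c, d, e]"
    using assms by (auto simp: length_Suc_conv eval_nat_numeral)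
  then show ?thesis by auto
qed

definition uses :: "nat list \<Rightarrow> nat \<Rightarrow> bool" where
  "uses t e \<longleftrightarrow> t ! 0 \<le> e \<and> e < t ! 1"

definition cover :: "nat list list \<Rightarrow> nat \<Rightarrow> nat" where
  "cover ts e = (\<Sum>t\<leftarrow>ts. if uses t e then t ! 2 else 0)"

definition middle_tasks :: "nat list list \<Rightarrow> nat \<Rightarrow> nat \<Rightarrow> nat \<Rightarrow> nat list list" where
  "middle_tasks ts a m b = filter (\<lambda>t. a \<le> t ! 0 \<and> uses t m \<and> t ! 1 \<le> b) ts"

definition passes :: "nat \<Rightarrow> nat list \<Rightarrow> nat list \<Rightarrow> bool" where
  "passes op piv t \<longleftrightarrow>
     (if op < 4 then piv ! op \<le> t ! op else t ! (op - 4) \<le> piv ! (op - 4))"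

definition better ::
  "(nat \<times> nat list list) option \<Rightarrow> (nat \<times> nat list list) option \<Rightarrow> (nat \<times> nat list list) option" where
  "better x y = (case x of None \<Rightarrow> y | Some (c, ts) \<Rightarrow>
     (case y of None \<Rightarrow> x | Some (c', ts') \<Rightarrow> if c' < c then y else x))"

lemma calls_len: "calls A fLen [enc_list xs] (VNat (length xs)) (10 * length xs + 10)"
proof (induction xs)
  case Nil
  show ?case by (rule calls_wpI) (simp add: len_body_def)
next
  case (Cons x xs)
  show ?case
    apply (rule calls_wpI)
    apply (simp add: len_body_def)
    apply (rule call_callsI[OF Cons.IH])
    by simp_all
qed

lemma calls_nth: "i < length xs \<Longrightarrow> calls A fNth [enc_list xs, VNat i] (xs ! i) (15 * i + 10)"
proof (induction xs arbitrary: i)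
  case Nil
  then show ?case by simp
next
  case (Cons x xs)
  show ?case
  proof (cases i)
    case 0
    show ?thesis by (rule calls_wpI) (simp add: nth_body_def 0)
  next
    case (Suc j)
    then have "j < length xs" using Cons.prems by simp
    note IH = Cons.IH[OF this]
    show ?thesis
      apply (rule calls_wpI)
      apply (simp add: nth_body_def Suc)
      apply (rule call_callsI[OF IH])
      by simp_all
  qed
qed

lemma calls_nth_nats: "i < length t \<Longrightarrow> calls A fNth [enc_nats t, VNat i] (VNat (t ! i)) (15 * i + 10)"
  using calls_nth[of i "map VNat t" A] by (simp add: enc_nats_def)

lemma calls_sum:
  assumes "k < 5"
  shows "tasks_ok ts \<Longrightarrow> calls A fSum [enc_natss ts, VNat k] (VNat (\<Sum>t\<leftarrow>ts. t ! k)) (100 * length ts + 10)"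
proof (induction ts)
  case Nil
  show ?case by (rule calls_wpI) (simp add: sum_body_def)
next
  case (Cons t ts)
  then have "k < length t" "tasks_ok ts" using assms by simp_all
  show ?case
    apply (rule calls_wpI)
    apply (simp add: sum_body_def)
    apply (rule call_callsI[OF calls_nth_nats])
      apply fact
     apply simp
    apply simp?
    apply (rule call_callsI[OF Cons.IH])
      apply fact
    using assms by simp_all
qed

lemma calls_log: "calls A fLog [VNat n] (VNat (floorlog 2 n)) (20 * floorlog 2 n + 10)"
proof (induction n rule: less_induct)
  case (less n)
  show ?case
  proof (cases "n = 0")
    case True
    show ?thesis by (rule calls_wpI) (simp add: log_body_def True floorlog_def)
  next
    case False
    then have "n div 2 < n" by simp
    note IH = less.IH[OF this]
    show ?thesis
      apply (rule calls_wpI)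
      apply (simp add: log_body_def False)
      apply (rule call_callsI[OF IH])
      using floorlog_2_rec[of n] False by simp_all
  qed
qed

lemma calls_cov: "tasks_ok ts \<Longrightarrow> calls A fCov [enc_natss ts, VNat m] (VNat (cover ts m)) (50 * length ts + 10)"
proof (induction ts)
  case Nil
  show ?case by (rule calls_wpI) (simp add: cov_body_def cover_def)
next
  case (Cons t ts)
  then have ok: "length t = 5" "tasks_ok ts" by simp_all
  note IH = Cons.IH[OF ok(2)]
  consider "m < t ! 0" | "\<not> m < t ! 0" "m < t ! 1" | "\<not> m < t ! 0" "\<not> m < t ! 1" by blast
  then show ?case
  proof cases
    case 1
    then show ?thesis
      apply (intro calls_wpI)
      apply (simp add: cov_body_def enc_nats_length_5[OF ok(1)])
      apply (rule call_callsI[OF IH])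
      by (simp_all add: cover_def uses_def)
  next
    case 2
    then show ?thesis
      apply (intro calls_wpI)
      apply (simp add: cov_body_def enc_nats_length_5[OF ok(1)])
      apply (rule call_callsI[OF IH])
      by (simp_all add: cover_def uses_def)
  next
    case 3
    then show ?thesis
      apply (intro calls_wpI)
      apply (simp add: cov_body_def enc_nats_length_5[OF ok(1)])
      apply (rule call_callsI[OF IH])
      by (simp_all add: cover_def uses_def)
  qed
qed

lemma calls_app: "calls A fApp [enc_natss xs, enc_natss ys] (enc_natss (xs @ ys)) (15 * length xs + 10)"
proof (induction xs)
  case Nil
  show ?case by (rule calls_wpI) (simp add: app_body_def)
next
  case (Cons x xs)
  show ?case
    apply (rule calls_wpI)
    apply (simp add: app_body_def)
    apply (rule call_callsI[OF Cons.IH])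
    by simp_all
qed

lemma calls_mids:
  "tasks_ok ts \<Longrightarrow> calls A fMids [enc_natss ts, VNat a, VNat m, VNat b]
     (enc_natss (middle_tasks ts a m b)) (80 * length ts + 10)"
proof (induction ts)
  case Nil
  show ?case by (rule calls_wpI) (simp add: mids_body_def middle_tasks_def)
next
  case (Cons t ts)
  then have ok: "length t = 5" "tasks_ok ts" by simp_all
  note IH = Cons.IH[OF ok(2)]
  show ?case
    apply (rule calls_wpI)
    apply (simp add: mids_body_def)
    apply (rule call_callsI[OF IH])
     apply simp
    by (auto simp: enc_nats_length_5[OF ok(1)] middle_tasks_def uses_def)
qed

lemma calls_test:
  assumes "op < 8" "length piv = 5" "length t = 5"
  shows "calls A fTest [VNat op, enc_nats piv, enc_nats t] (of_truth (passes op piv t)) 250"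
proof (cases "op < 4")
  case True
  then have l: "op < length t" "op < length piv" using assms by simp_all
  show ?thesis
    apply (rule calls_wpI)
    apply (simp add: test_body_def True)
    apply (rule call_callsI[OF calls_nth_nats])
      apply fact
     apply simp
    apply simp?
    apply (rule call_callsI[OF calls_nth_nats])
      apply fact
     apply simp
    using True by (simp add: passes_def of_truth_def)
next
  case False
  then have l: "op - 4 < length t" "op - 4 < length piv" "op - 4 < 4" using assms by simp_all
  show ?thesis
    apply (rule calls_wpI)
    apply (simp add: test_body_def False)
    apply (rule call_callsI[OF calls_nth_nats])
      apply fact
     apply simp
    apply simp?
    apply (rule call_callsI[OF calls_nth_nats])
      apply fact
     apply simp
    using False l(3) by (simp add: passes_def of_truth_def)
qed

lemma calls_filt:
  assumes "op < 8" "length piv = 5"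
  shows "tasks_ok W \<Longrightarrow> calls A fFilt [VNat op, enc_nats piv, enc_natss W, enc_natss N]
    (VPair (enc_natss (filter (passes op piv) W)) (enc_natss (filter (\<lambda>t. \<not> passes op piv t) W @ N)))
    (300 * length W + 10)"
proof (induction W)
  case Nil
  show ?case by (rule calls_wpI) (simp add: filt_body_def)
next
  case (Cons t W)
  then have ok: "length t = 5" "tasks_ok W" by simp_all
  note IH = Cons.IH[OF ok(2)]
  show ?case
  proof (cases "passes op piv t")
    case True
    show ?thesis
      apply (rule calls_wpI)
      apply (simp add: filt_body_def True)
      apply (rule call_callsI[OF IH])
       apply simp
      apply simp?
      apply (rule call_callsI[OF calls_test[OF assms ok(1)]])
      using True by simp_all
  next
    case False
    show ?thesis
      apply (rule calls_wpI)
      apply (simp add: filt_body_def False)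
      apply (rule call_callsI[OF IH])
       apply simp
      apply simp?
      apply (rule call_callsI[OF calls_test[OF assms ok(1)]])
      using False by simp_all
  qed
qed

lemma calls_pick:
  "calls A fPick [enc_natss js, enc_natss W, enc_natss S]
     (VPair (enc_natss (drop (length js) W)) (enc_natss (rev (take (length js) W) @ S))) (20 * length js + 10)"
proof (induction js arbitrary: W S)
  case Nil
  show ?case by (rule calls_wpI) (simp add: pick_body_def)
next
  case (Cons j js)
  show ?case
  proof (cases W)
    case Nil
    then show ?thesis by (intro calls_wpI) (simp add: pick_body_def)
  next
    case W: (Cons w W')
    show ?thesis
      apply (rule calls_wpI)
      apply (simp add: pick_body_def W)
      apply (rule call_callsI[OF Cons.IH[of W' "w # S", simplified]])
      by simp_all
  qed
qed

lemma calls_better: "calls A fBetter [enc_res x, enc_res y] (enc_res (better x y)) 20"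
proof (cases x; cases y)
  fix p q assume "x = Some p" "y = Some q"
  moreover obtain c ts c' ts' where "p = (c, ts)" "q = (c', ts')" by fastforce
  ultimately show ?thesis by (intro calls_wpI) (auto simp: better_body_def better_def)
next
  fix p assume "x = Some p" "y = None"
  moreover obtain c ts where "p = (c, ts)" by fastforce
  ultimately show ?thesis by (intro calls_wpI) (auto simp: better_body_def better_def)
next
  fix q assume "x = None" "y = Some q"
  moreover obtain c ts where "q = (c, ts)" by fastforce
  ultimately show ?thesis by (intro calls_wpI) (auto simp: better_body_def better_def)
next
  assume "x = None" "y = None"
  then show ?thesis by (intro calls_wpI) (auto simp: better_body_def better_def)
qed

lemma calls_idxs: "tasks_ok ts \<Longrightarrow> calls A fIdxs [enc_natss ts] (enc_nats (map (\<lambda>t. t ! 4) ts)) (120 * length ts + 10)"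
proof (induction ts)
  case Nil
  show ?case by (rule calls_wpI) (simp add: idxs_body_def)
next
  case (Cons t ts)
  then have ok: "4 < length t" "tasks_ok ts" by simp_all
  note IH = Cons.IH[OF ok(2)]
  show ?case
    apply (rule calls_wpI)
    apply (simp add: idxs_body_def)
    apply (rule call_callsI[OF calls_nth_nats])
      apply fact
     apply simp
    apply simp?
    apply (rule call_callsI[OF IH])
    by simp_all
qed

section \<open>The search for a cheapest selection\<close>

type_synonym result = "(nat \<times> nat list list) option"

text \<open>The operand is a suffix \<open>js\<close> of the list of crossing tasks: its head serves
  as the pivot, its length as the number of tasks to select. A single loop over suffixes thus
  enumerates both kinds of operands, and nine codes suffice: four lower bounds, four upper bounds,
  one selection.\<close>

definition step_fun ::
  "(nat list list \<Rightarrow> nat list list \<Rightarrow> nat list list \<Rightarrow> result) \<Rightarrow> nat \<Rightarrow> nat list list \<Rightarrow>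
    nat list list \<Rightarrow> nat list list \<Rightarrow> nat list list \<Rightarrow> result" where
  "step_fun g op js W N S =
     (if op < 8 then g (filter (passes op (hd js)) W) (filter (\<lambda>t. \<not> passes op (hd js) t) W @ N) S
      else g (drop (length js) W @ N) [] (rev (take (length js) W) @ S))"

primrec try_fun ::
  "(nat list list \<Rightarrow> nat list list \<Rightarrow> nat list list \<Rightarrow> result) \<Rightarrow> nat \<Rightarrow> nat list list \<Rightarrow>
    nat list list \<Rightarrow> nat list list \<Rightarrow> nat list list \<Rightarrow> result" where
  "try_fun g op [] W N S = None"
| "try_fun g op (j # js) W N S = better (step_fun g op (j # js) W N S) (try_fun g op js W N S)"

primrec ops_fun ::
  "(nat list list \<Rightarrow> nat list list \<Rightarrow> nat list list \<Rightarrow> result) \<Rightarrow> nat list list \<Rightarrow> nat \<Rightarrow>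
    nat list list \<Rightarrow> nat list list \<Rightarrow> nat list list \<Rightarrow> result" where
  "ops_fun g TM 0 W N S = None"
| "ops_fun g TM (Suc op) W N S = better (try_fun g op TM W N S) (ops_fun g TM op W N S)"

text \<open>The state \<open>(W, N, S)\<close> splits \<open>TM\<close> into the selected tasks \<open>S\<close>, the current candidates \<open>W\<close>
  and the remaining tasks \<open>N\<close>. An instruction either restricts the candidates by comparing one
  coordinate with that of a pivot task, or selects a number of candidates and makes all
  unselected tasks candidates again.\<close>

primrec search_fun ::
  "(nat list list \<Rightarrow> result) \<Rightarrow> nat list list \<Rightarrow> nat \<Rightarrow>
    nat list list \<Rightarrow> nat list list \<Rightarrow> nat list list \<Rightarrow> result" where
  "search_fun fin TM 0 W N S = fin S"
| "search_fun fin TM (Suc K) W N S =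
     better (search_fun fin TM K W N S) (ops_fun (search_fun fin TM K) TM 9 W N S)"

text \<open>Only the middle edge is tested here, as every other edge becomes the middle of a later
  interval. \<open>A\<close> counts towards the cover but not towards the cost, which is charged
  where its tasks are chosen.\<close>

definition finish_fun ::
  "(nat \<Rightarrow> nat \<Rightarrow> nat list list \<Rightarrow> result) \<Rightarrow> nat list \<Rightarrow> nat \<Rightarrow> nat \<Rightarrow> nat \<Rightarrow> nat list list \<Rightarrow>
    nat list list \<Rightarrow> result" where
  "finish_fun R us a m b A S =
     (if cover (S @ A) m < us ! m then None
      else case R a m (S @ A) of None \<Rightarrow> None | Some (c1, l1) \<Rightarrow>
        (case R (m + 1) b (S @ A) of None \<Rightarrow> None | Some (c2, l2) \<Rightarrow>
          Some (c1 + c2 + (\<Sum>t\<leftarrow>S. t ! 3), S @ l1 @ l2)))"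

text \<open>\<open>h\<close> bounds the recursion depth. The answer for depth \<open>0\<close> is
  right only for an empty interval, which is what the bound \<open>b - a < 2 ^ h\<close> in the
  later lemmas ensures.\<close>

primrec rec_fun ::
  "nat list \<Rightarrow> nat list list \<Rightarrow> nat \<Rightarrow> nat \<Rightarrow> nat \<Rightarrow> nat \<Rightarrow> nat list list \<Rightarrow> result" where
  "rec_fun us T K 0 a b A = Some (0, [])"
| "rec_fun us T K (Suc h) a b A =
     (if a < b then
        (let m = (a + b) div 2; TM = middle_tasks T a m b in
          search_fun (finish_fun (rec_fun us T K h) us a m b A) TM K TM [] [])
      else Some (0, []))"

section \<open>Results of the search and reachable states\<close>

lemma better_cases: "better x y = x \<or> better x y = y"
  by (auto simp: better_def split: option.splits)

text \<open>\<open>better\<close> may exchange a result for a cheaper one, so completeness speaks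
  about a bound on the cost and not about a particular selection.\<close>

definition at_most :: "result \<Rightarrow> nat \<Rightarrow> bool" where
  "at_most r c \<longleftrightarrow> (\<exists>c' l. r = Some (c', l) \<and> c' \<le> c)"

lemma at_most_better: "at_most (better x y) c \<longleftrightarrow> at_most x c \<or> at_most y c"
  by (auto simp: at_most_def better_def split: option.splits)

lemma try_fun_Some:
  "try_fun g op js W N S = Some r \<Longrightarrow> \<exists>ks. ks \<noteq> [] \<and> set ks \<subseteq> set js \<and> step_fun g op ks W N S = Some r"
proof (induction js)
  case (Cons j js)
  show ?case
  proof (cases "try_fun g op js W N S = Some r")
    case True
    then obtain ks where "ks \<noteq> []" "set ks \<subseteq> set js" "step_fun g op ks W N S = Some r"
      using Cons.IH by blast
    then show ?thesis by (intro exI[of _ ks]) auto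
  next
    case False
    then have "step_fun g op (j # js) W N S = Some r"
      using Cons.prems better_cases[of "step_fun g op (j # js) W N S" "try_fun g op js W N S"] by auto
    then show ?thesis by blast
  qed
qed simp

lemma ops_fun_Some:
  "ops_fun g TM n W N S = Some r \<Longrightarrow> \<exists>op js. js \<noteq> [] \<and> step_fun g op js W N S = Some r"
proof (induction n)
  case (Suc n)
  then have "try_fun g n TM W N S = Some r \<or> ops_fun g TM n W N S = Some r"
    using better_cases[of "try_fun g n TM W N S" "ops_fun g TM n W N S"] by auto
  then show ?case using Suc.IH try_fun_Some by blast
qed simp

text \<open>Both kinds of instructions only rearrange \<open>W\<close>, \<open>N\<close> and
  \<open>S\<close>, so distinctness and the set of all their tasks are invariant.\<close>

lemma search_fun_Some:
  "search_fun fin TM K W N S = Some r \<Longrightarrow> distinct (W @ N @ S) \<Longrightarrow>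
    \<exists>S'. fin S' = Some r \<and> distinct S' \<and> set S' \<subseteq> set (W @ N @ S)"
proof (induction K arbitrary: W N S)
  case 0
  then show ?case by auto
next
  case (Suc K)
  consider "search_fun fin TM K W N S = Some r" | "ops_fun (search_fun fin TM K) TM 9 W N S = Some r"
    using Suc.prems better_cases[of "search_fun fin TM K W N S" "ops_fun (search_fun fin TM K) TM 9 W N S"]
    by auto
  then show ?case
  proof cases
    case 1
    then show ?thesis using Suc by blast
  next
    case 2
    then obtain op js where "step_fun (search_fun fin TM K) op js W N S = Some r"
      using ops_fun_Some by blast
    then obtain W' N' S' where *: "search_fun fin TM K W' N' S' = Some r"
      and W': "(W' = filter (passes op (hd js)) W \<and> N' = filter (\<lambda>t. \<not> passes op (hd js) t) W @ N \<and> S' = S) \<or>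
        (W' = drop (length js) W @ N \<and> N' = [] \<and> S' = rev (take (length js) W) @ S)"
      by (auto simp: step_fun_def split: if_splits)
    have td: "set (take k W) \<inter> set (drop k W) = {}" "set (take k W) \<union> set (drop k W) = set W" for k
    proof -
      show "set (take k W) \<inter> set (drop k W) = {}"
        using Suc.prems(2) by (simp add: set_take_disj_set_drop_if_distinct)
      show "set (take k W) \<union> set (drop k W) = set W" by (metis append_take_drop_id set_append)
    qed
    have "distinct (W' @ N' @ S') \<and> set (W' @ N' @ S') = set (W @ N @ S)"
      using W'
    proof
      assume "W' = filter (passes op (hd js)) W \<and> N' = filter (\<lambda>t. \<not> passes op (hd js) t) W @ N \<and> S' = S"
      then show ?thesis using Suc.prems(2) by auto
    next
      assume "W' = drop (length js) W @ N \<and> N' = [] \<and> S' = rev (take (length js) W) @ S"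
      then show ?thesis using Suc.prems(2) td[of "length js"] by auto
    qed
    then show ?thesis using Suc.IH[OF *] by auto
  qed
qed

text \<open>\<open>moves_refl\<close> admits every \<open>k\<close>, as the search also tries all
  shorter sequences. Pivots and counts appear here freed from their coding as suffixes of
  \<open>TM\<close>.\<close>

inductive moves :: "nat list list \<Rightarrow> nat \<Rightarrow> nat list list \<times> nat list list \<times> nat list list \<Rightarrow>
    nat list list \<times> nat list list \<times> nat list list \<Rightarrow> bool" for TM where
  moves_refl: "moves TM k st st"
| moves_filter: "op < 8 \<Longrightarrow> piv \<in> set TM \<Longrightarrow>
    moves TM k (filter (passes op piv) W, filter (\<lambda>t. \<not> passes op piv t) W @ N, S) st \<Longrightarrow>
    moves TM (Suc k) (W, N, S) st"
| moves_pick: "0 < j \<Longrightarrow> j \<le> length TM \<Longrightarrow>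
    moves TM k (drop j W @ N, [], rev (take j W) @ S) st \<Longrightarrow> moves TM (Suc k) (W, N, S) st"

lemma moves_mono: "moves TM k st st' \<Longrightarrow> k \<le> k' \<Longrightarrow> moves TM k' st st'"
proof (induction arbitrary: k' rule: moves.induct)
  case (moves_filter op piv k W N S st)
  then obtain l where "k' = Suc l" "k \<le> l" by (cases k') auto
  then show ?case using moves_filter by (auto intro: moves.moves_filter)
next
  case (moves_pick j k W N S st)
  then obtain l where "k' = Suc l" "k \<le> l" by (cases k') auto
  then show ?case using moves_pick by (auto intro: moves.moves_pick)
qed (rule moves_refl)

lemma moves_trans: "moves TM k st st' \<Longrightarrow> moves TM l st' st'' \<Longrightarrow> moves TM (k + l) st st''"
proof (induction rule: moves.induct)
  case (moves_refl k st)
  then show ?case by (rule moves_mono) simp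
qed (auto intro: moves_filter moves_pick)

lemma at_most_try_fun:
  assumes "at_most (step_fun g op js W N S) c" "js \<noteq> []"
  shows "at_most (try_fun g op (pre @ js) W N S) c"
proof (induction pre)
  case Nil
  then show ?case using assms by (cases js) (auto simp: at_most_better)
qed (auto simp: at_most_better)

lemma at_most_ops_fun:
  assumes "at_most (try_fun g op TM W N S) c"
  shows "op < n \<Longrightarrow> at_most (ops_fun g TM n W N S) c"
proof (induction n)
  case (Suc n)
  then show ?case using assms by (cases "op = n") (auto simp: at_most_better)
qed simp

lemma at_most_search_fun:
  assumes "at_most (fin S') c"
  shows "moves TM k (W, N, S) (W', N', S') \<Longrightarrow> at_most (search_fun fin TM k W N S) c"
proof (induction k "(W, N, S)" "(W', N', S')" arbitrary: W N S rule: moves.induct)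
  case (moves_refl k)
  then show ?case using assms by (induction k) (auto simp: at_most_better)
next
  case (moves_filter op piv k W N S)
  \<comment> \<open>The pivot is coded by the suffix that starts with it.\<close>
  obtain pre js where TM: "TM = pre @ piv # js" using moves_filter(2) by (meson split_list)
  have "at_most (step_fun (search_fun fin TM k) op (piv # js) W N S) c"
    using moves_filter by (simp add: step_fun_def)
  from at_most_try_fun[OF this, of pre]
  have "at_most (try_fun (search_fun fin TM k) op TM W N S) c" by (simp add: TM)
  from at_most_ops_fun[OF this, of 9] show ?case using moves_filter(1) by (simp add: at_most_better)
next
  case (moves_pick j k W N S)
  \<comment> \<open>The count is coded by the suffix of length \<open>j\<close>, which is non-empty
    since \<open>0 < j\<close>.\<close>
  define js where "js = drop (length TM - j) TM"
  have js: "length js = j" "js \<noteq> []" "TM = take (length TM - j) TM @ js"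
    using moves_pick(1,2) unfolding js_def by auto
  have "at_most (step_fun (search_fun fin TM k) 8 js W N S) c"
    using moves_pick js(1) by (simp add: step_fun_def)
  from at_most_try_fun[OF this js(2), of "take (length TM - j) TM"]
  have "at_most (try_fun (search_fun fin TM k) 8 TM W N S) c" using js(3) by simp
  from at_most_ops_fun[OF this, of 9] show ?case by (simp add: at_most_better)
qed

definition cost :: "nat list list \<Rightarrow> nat" where
  "cost ts = (\<Sum>t\<leftarrow>ts. t ! 3)"

lemma cover_append [simp]: "cover (xs @ ys) e = cover xs e + cover ys e"
  by (simp add: cover_def)

lemma cover_Nil [simp]: "cover [] e = 0"
  by (simp add: cover_def)

lemma cost_append [simp]: "cost (xs @ ys) = cost xs + cost ys"
  by (simp add: cost_def)

lemma length_le_of_distinct_subset: "distinct l \<Longrightarrow> set l \<subseteq> set T \<Longrightarrow> length l \<le> length T"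
  by (metis card_length card_mono distinct_card finite_set le_trans)

text \<open>Each task selected at a node crosses the middle edge, which lies in neither half, so the
  three parts of the output are disjoint. The clause \<open>t ! 0 < t ! 1\<close> is carried along
  because it rules out a task that starts at \<open>m + 1\<close> or later and ends by
  \<open>m\<close>, which would fit both halves.\<close>

lemma rec_fun_sound:
  assumes "distinct T"
  shows "rec_fun us T K h a b A = Some (c, l) \<Longrightarrow> b - a < 2 ^ h \<Longrightarrow>
    distinct l \<and> set l \<subseteq> {t \<in> set T. a \<le> t ! 0 \<and> t ! 0 < t ! 1 \<and> t ! 1 \<le> b} \<and> c = cost l \<and>
    (\<forall>e. a \<le> e \<and> e < b \<longrightarrow> us ! e \<le> cover (l @ A) e)"
proof (induction h arbitrary: a b A c l)
  case 0
  then show ?case by (auto simp: cost_def)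
next
  case (Suc h)
  show ?case
  proof (cases "a < b")
    case False
    then show ?thesis using Suc.prems by (auto simp: cost_def)
  next
    case True
    define m where "m = (a + b) div 2"
    define TM where "TM = middle_tasks T a m b"
    have m: "a \<le> m" "m < b" using True by (auto simp: m_def)
    \<comment> \<open>Leaving out the middle edge matters: with it the right half could have
      \<open>2 ^ h\<close> edges.\<close>
    have h: "m - a < 2 ^ h" "b - (m + 1) < 2 ^ h" using Suc.prems(2) True by (auto simp: m_def)
    have TM: "distinct TM" "set TM = {t \<in> set T. a \<le> t ! 0 \<and> t ! 0 \<le> m \<and> m < t ! 1 \<and> t ! 1 \<le> b}"
      using assms by (auto simp: TM_def middle_tasks_def uses_def)
    have "search_fun (finish_fun (rec_fun us T K h) us a m b A) TM K TM [] [] = Some (c, l)"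
      using Suc.prems(1) True by (simp add: Let_def m_def TM_def)
    from search_fun_Some[OF this] obtain S where S: "distinct S" "set S \<subseteq> set TM"
      and fin: "finish_fun (rec_fun us T K h) us a m b A S = Some (c, l)" using TM(1) by auto
    from fin obtain c1 l1 c2 l2 where cov: "us ! m \<le> cover (S @ A) m"
      and r1: "rec_fun us T K h a m (S @ A) = Some (c1, l1)"
      and r2: "rec_fun us T K h (m + 1) b (S @ A) = Some (c2, l2)"
      and c: "c = c1 + c2 + cost S" and l: "l = S @ l1 @ l2"
      by (auto simp: finish_fun_def cost_def split: if_splits option.splits)
    note 1 = Suc.IH[OF r1 h(1)] and 2 = Suc.IH[OF r2 h(2)]
    have "distinct l" unfolding l using S 1 2 TM(2) by (auto; force)
    moreover have "set l \<subseteq> {t \<in> set T. a \<le> t ! 0 \<and> t ! 0 < t ! 1 \<and> t ! 1 \<le> b}"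
      unfolding l using S 1 2 TM(2) m by (auto; force)
    moreover have "c = cost l" using 1 2 c l by simp
    moreover have "us ! e \<le> cover (l @ A) e" if e: "a \<le> e" "e < b" for e
    proof -
      consider "e < m" | "e = m" | "m + 1 \<le> e" by linarith
      then show ?thesis
      proof cases
        case 1
        then have "us ! e \<le> cover (l1 @ S @ A) e" using \<open>distinct l1 \<and> _\<close> e by blast
        then show ?thesis by (simp add: l)
      next
        case 2
        then show ?thesis using cov by (simp add: l)
      next
        case 3
        then have "us ! e \<le> cover (l2 @ S @ A) e" using \<open>distinct l2 \<and> _\<close> e by blast
        then show ?thesis by (simp add: l)
      qed
    qed
    ultimately show ?thesis by blast
  qed
qed

section \<open>Unit cost of the search\<close>

text \<open>Up to the call of \<open>fFinish\<close>, the search reads only the last component of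
  the context, so the others stay abstract values here.\<close>

locale search_context =
  fixes A :: nat and ctx c0 c1 c2 c3 c4 :: val and TM :: "nat list list" and n :: nat
  assumes ctx: "ctx = VPair c0 (VPair c1 (VPair c2 (VPair c3 (VPair c4 (enc_natss TM)))))"
    and TM_ok: "tasks_ok TM" and length_TM: "length TM \<le> n"
begin

definition state_ok :: "nat list list \<Rightarrow> nat list list \<Rightarrow> nat list list \<Rightarrow> bool" where
  "state_ok W N S \<longleftrightarrow> tasks_ok W \<and> tasks_ok N \<and> tasks_ok S \<and> length W + length N + length S \<le> n"

lemma calls_step:
  assumes g: "\<And>W N S. state_ok W N S \<Longrightarrow>
      calls A fSearch [ctx, VNat K, enc_natss W, enc_natss N, enc_natss S] (enc_res (g W N S)) s"
    and st: "state_ok W N S" and js: "js \<noteq> []" "tasks_ok js" "length js \<le> n"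
  shows "calls A fStep [ctx, VNat K, enc_natss W, enc_natss N, enc_natss S, VNat op, enc_natss js]
    (enc_res (step_fun g op js W N S)) (s + 400 * n + 100)"
proof (cases "op < 8")
  case True
  obtain j js' where jj: "js = j # js'" using js(1) by (cases js) auto
  have ok: "length j = 5" "tasks_ok W" "length W \<le> n" using st js(2) jj by (auto simp: state_ok_def)
  have st': "state_ok (filter (passes op j) W) (filter (\<lambda>t. \<not> passes op j t) W @ N) S"
    using st sum_length_filter_compl[of "passes op j" W] unfolding state_ok_def
    by (auto intro: tasks_ok_subset[OF ok(2)])
  show ?thesis
    apply (rule calls_wpI)
    apply (simp add: step_body_def True jj)
    apply (rule call_callsI[OF calls_filt[OF True ok(1,2)]])
     apply simp
    apply (simp add: step_body_def)
    apply (rule call_callsI[OF g[OF st', unfolded append.simps]])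
    using True ok(3) by (simp_all add: step_fun_def)
next
  case False
  let ?W = "drop (length js) W" and ?S = "rev (take (length js) W) @ S"
  have ok: "tasks_ok W" "length W \<le> n" using st by (auto simp: state_ok_def)
  have "tasks_ok ?W" "tasks_ok (rev (take (length js) W))"
    by (auto intro!: tasks_ok_subset[OF ok(1)] dest: in_set_dropD in_set_takeD)
  then have st': "state_ok (?W @ N) [] ?S" using st unfolding state_ok_def by auto
  have st'': "calls A fSearch [ctx, VNat K, enc_natss (?W @ N), VNat 0, enc_natss ?S]
      (enc_res (g (?W @ N) [] ?S)) s" using g[OF st'] by simp
  show ?thesis
    apply (rule calls_wpI)
    apply (simp add: step_body_def False)
    apply (rule call_callsI[OF calls_pick])
     apply simp
    apply simp?
    apply (rule call_callsI[OF calls_app])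
     apply simp
    apply simp?
    apply (rule call_callsI[OF st''])
    using False ok(2) js(3) by (simp_all add: step_fun_def)
qed

lemma calls_try:
  assumes g: "\<And>W N S. state_ok W N S \<Longrightarrow>
      calls A fSearch [ctx, VNat K, enc_natss W, enc_natss N, enc_natss S] (enc_res (g W N S)) s"
    and st: "state_ok W N S"
  shows "tasks_ok js \<Longrightarrow> length js \<le> n \<Longrightarrow>
    calls A fTry [ctx, VNat K, enc_natss W, enc_natss N, enc_natss S, VNat op, enc_natss js]
      (enc_res (try_fun g op js W N S)) (length js * (s + 400 * n + 200) + 10)"
proof (induction js)
  case Nil
  show ?case by (rule calls_wpI) (simp add: try_body_def)
next
  case (Cons j js)
  then have js: "tasks_ok js" "length js \<le> n" by simp_all
  note IH = Cons.IH[OF js]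
  have step: "calls A fStep [ctx, VNat K, enc_natss W, enc_natss N, enc_natss S, VNat op,
      VPair (enc_nats j) (enc_natss js)]
    (enc_res (step_fun g op (j # js) W N S)) (s + 400 * n + 100)"
    using calls_step[OF g st _ Cons.prems, of op] by simp
  show ?case
    apply (rule calls_wpI)
    apply (simp add: try_body_def)
    apply (rule call_callsI[OF step])
     apply simp
    apply simp?
    apply (rule call_callsI[OF IH])
     apply simp
    apply simp?
    apply (rule call_callsI[OF calls_better])
    by simp_all
qed

lemma calls_ops:
  assumes g: "\<And>W N S. state_ok W N S \<Longrightarrow>
      calls A fSearch [ctx, VNat K, enc_natss W, enc_natss N, enc_natss S] (enc_res (g W N S)) s"
    and st: "state_ok W N S"
  shows "calls A fOps [ctx, VNat K, enc_natss W, enc_natss N, enc_natss S, VNat op]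
      (enc_res (ops_fun g TM op W N S)) (op * (n * (s + 400 * n + 200) + 100) + 10)"
proof (induction op)
  case 0
  show ?case by (rule calls_wpI) (simp add: ops_body_def)
next
  case (Suc op)
  have "length TM * (s + 400 * n + 200) + 10 \<le> n * (s + 400 * n + 200) + 10"
    using length_TM by (simp add: mult_le_mono1)
  note try_TM = calls_mono[OF calls_try[OF g st TM_ok length_TM, of op] this]
  show ?case
    apply (rule calls_wpI)
    apply (simp add: ops_body_def)
    apply (simp add: ctx)
    apply (rule call_callsI[OF try_TM[unfolded ctx]])
     apply simp
    apply simp?
    apply (rule call_callsI[OF Suc.IH[unfolded ctx]])
     apply simp
    apply simp?
    apply (rule call_callsI[OF calls_better])
    by simp_all
qed

text \<open>One further instruction costs at most \<open>1 + 9 * n\<close> recursive searches: nine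
  codes with at most \<open>n\<close> operands each. The base \<open>20 * (n + 1)\<close> leaves
  room for the linear overhead because even the cheapest search is charged at least
  \<open>400 * n + 2000\<close>.\<close>

lemma calls_search:
  assumes fin: "\<And>S. tasks_ok S \<Longrightarrow> length S \<le> n \<Longrightarrow>
      calls A fFinish [ctx, enc_natss S] (enc_res (fin S)) F"
  shows "state_ok W N S \<Longrightarrow>
    calls A fSearch [ctx, VNat K, enc_natss W, enc_natss N, enc_natss S]
      (enc_res (search_fun fin TM K W N S)) ((F + 400 * n + 2000) * (20 * (n + 1)) ^ K)"
proof (induction K arbitrary: W N S)
  case 0
  then have S: "tasks_ok S" "length S \<le> n" by (auto simp: state_ok_def)
  show ?case
    apply (rule calls_wpI)
    apply (simp add: search_body_def)
    apply (rule call_callsI[OF fin[OF S]])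
    by simp_all
next
  case (Suc K)
  define s where "s = (F + 400 * n + 2000) * (20 * (n + 1)) ^ K"
  have g: "\<And>W N S. state_ok W N S \<Longrightarrow>
      calls A fSearch [ctx, VNat K, enc_natss W, enc_natss N, enc_natss S]
        (enc_res (search_fun fin TM K W N S)) s"
    using Suc.IH by (simp add: s_def)
  have "(F + 400 * n + 2000) * 1 \<le> s" unfolding s_def by (intro mult_le_mono) auto
  then have s: "400 * n + 2000 \<le> s" by simp
  have "9 * n * (400 * n + 2000) \<le> 9 * n * s" using s by (intro mult_le_mono) auto
  then have "s + (9 * (n * (s + 400 * n + 200) + 100) + 10) + 100 \<le> 20 * (n + 1) * s"
    using s by (simp add: algebra_simps)
  also have "\<dots> = (F + 400 * n + 2000) * (20 * (n + 1)) ^ Suc K" by (simp add: s_def)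
  finally have le: "s + (9 * (n * (s + 400 * n + 200) + 100) + 10) + 100
      \<le> (F + 400 * n + 2000) * (20 * (n + 1)) ^ Suc K" .
  show ?case
    apply (rule calls_mono[OF _ le])
    apply (rule calls_wpI)
    apply (simp add: search_body_def)
    apply (rule call_callsI[OF g[OF Suc.prems]])
     apply simp
    apply simp?
    apply (rule call_callsI[OF calls_ops[OF g Suc.prems, of 9]])
     apply simp
    apply simp?
    apply (rule call_callsI[OF calls_better])
    by simp_all
qed

end

lemma calls_finish:
  assumes R1: "calls A fRec [G, VNat a, VNat m, enc_natss (S @ X)] (enc_res (R a m (S @ X))) r"
    and R2: "calls A fRec [G, VNat (m + 1), VNat b, enc_natss (S @ X)] (enc_res (R (m + 1) b (S @ X))) r"
    and len: "\<And>c l. R a m (S @ X) = Some (c, l) \<Longrightarrow> length l \<le> n"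
    and ok: "tasks_ok S" "tasks_ok X" "length S \<le> n" "length (S @ X) \<le> M"
    and us: "m < length us" and G: "G = VPair (enc_nats us) G'"
    and ctx: "ctx = VPair G (VPair (VNat a) (VPair (VNat m) (VPair (VNat b) (VPair (enc_natss X) TMv))))"
  shows "calls A fFinish [ctx, enc_natss S] (enc_res (finish_fun R us a m b X S))
    (2 * r + 50 * M + 15 * length us + 200 * n + 300)"
proof (cases "cover (S @ X) m < us ! m")
  case True
  have ok': "tasks_ok (S @ X)" using ok by simp
  show ?thesis
    apply (rule calls_wpI)
    apply (simp add: finish_body_def ctx G)
    apply (rule call_callsI[OF calls_app])
     apply simp
    apply (simp del: cover_append tasks_ok_simps)?
    apply (rule call_callsI[OF calls_cov[OF ok']])
     apply simp
    apply (simp del: cover_append)?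
    apply (rule call_callsI[OF calls_nth_nats[OF us]])
     apply simp
    using True ok us by (simp add: finish_fun_def)
next
  case False
  have ok': "tasks_ok (S @ X)" using ok by simp
  have R2': "calls A fRec [VPair (enc_nats us) G', VNat (Suc m), VNat b, enc_natss (S @ X)]
      (enc_res (R (m + 1) b (S @ X))) r" using R2 by (simp add: G)
  show ?thesis
  proof (cases "R a m (S @ X)")
    case None
    show ?thesis
      apply (rule calls_wpI)
      apply (simp add: finish_body_def ctx G)
      apply (rule call_callsI[OF calls_app])
       apply simp
      apply (simp del: cover_append tasks_ok_simps)?
      apply (rule call_callsI[OF calls_cov[OF ok']])
       apply simp
      apply (simp del: cover_append)?
      apply (rule call_callsI[OF calls_nth_nats[OF us]])
       apply simp
      using False apply simp
      apply (rule call_callsI[OF R1[unfolded G]])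
       apply simp
      using ok us False None by (simp add: finish_fun_def)
  next
    case (Some p)
    obtain c1 l1 where p: "p = (c1, l1)" by fastforce
    have l1: "length l1 \<le> n" using len Some p by blast
    show ?thesis
    proof (cases "R (m + 1) b (S @ X)")
      case None
      show ?thesis
        apply (rule calls_wpI)
        apply (simp add: finish_body_def ctx G)
        apply (rule call_callsI[OF calls_app])
         apply simp
        apply (simp del: cover_append tasks_ok_simps)?
        apply (rule call_callsI[OF calls_cov[OF ok']])
         apply simp
        apply (simp del: cover_append)?
        apply (rule call_callsI[OF calls_nth_nats[OF us]])
         apply simp
        using False apply simp
        apply (rule call_callsI[OF R1[unfolded G]])
         apply simp
        apply (simp add: Some p)
        apply (rule call_callsI[OF R2'])
         apply simp
        using ok us False None Some p by (simp add: finish_fun_def)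
    next
      case Some2: (Some q)
      obtain c2 l2 where q: "q = (c2, l2)" by fastforce
      have three: "(3::nat) < 5" by simp
      show ?thesis
        apply (rule calls_wpI)
        apply (simp add: finish_body_def ctx G)
        apply (rule call_callsI[OF calls_app])
         apply simp
        apply (simp del: cover_append tasks_ok_simps)?
        apply (rule call_callsI[OF calls_cov[OF ok']])
         apply simp
        apply (simp del: cover_append)?
        apply (rule call_callsI[OF calls_nth_nats[OF us]])
         apply simp
        using False apply simp
        apply (rule call_callsI[OF R1[unfolded G]])
         apply simp
        apply (simp add: Some p)
        apply (rule call_callsI[OF R2'])
         apply simp
        using Some2 apply (simp add: q)
        apply (rule call_callsI[OF calls_sum[OF three ok(1)]])
         apply simp
        apply (simp add: Some p q)?
        apply (rule call_callsI[OF calls_app])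
         apply simp
        apply (simp add: Some p q)?
        apply (rule call_callsI[OF calls_app])
         apply simp
        using ok us l1 False Some Some2 p q by (simp add: finish_fun_def)
    qed
  qed
qed

text \<open>Each level adds at most \<open>n\<close> tasks to \<open>X\<close> and consumes one unit
  of \<open>h\<close>, so \<open>length X + h * n \<le> M\<close> is preserved. The factor per level
  is the branching of the search times a constant that absorbs the two recursive calls and all
  linear work.\<close>

lemma calls_rec:
  assumes T: "tasks_ok T" "distinct T" and n: "length T \<le> n"
    and G: "G = VPair (enc_nats us) (VPair (enc_natss T) (VNat K))"
  shows "b - a < 2 ^ h \<Longrightarrow> b \<le> length us \<Longrightarrow> tasks_ok X \<Longrightarrow> length X + h * n \<le> M \<Longrightarrow>
    calls A fRec [G, VNat a, VNat b, enc_natss X] (enc_res (rec_fun us T K h a b X))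
      (1000 * (n + M + length us + 10) * (10 * (20 * (n + 1)) ^ K) ^ h)"
proof (induction h arbitrary: a b X)
  case 0
  then have "\<not> a < b" by simp
  then show ?case by (intro calls_wpI) (simp add: rec_body_def)
next
  case (Suc h)
  define Y where "Y = 1000 * (n + M + length us + 10)"
  have Y: "1000 * n + 10000 \<le> Y" by (simp add: Y_def)
  define B where "B = (20 * (n + 1)) ^ K"
  define r where "r = Y * (10 * B) ^ h"
  have pos: "1 \<le> B" "1 \<le> (10 * B) ^ h" by (simp_all add: B_def)
  have rY: "Y \<le> r" using pos by (simp add: r_def)
  have R: "1000 * (n + M + length us + 10) * (10 * (20 * (n + 1)) ^ K) ^ Suc h = 10 * (r * B)"
    by (simp add: r_def Y_def B_def)
  define q where "q = r * B"
  have rB: "r \<le> q" using pos by (simp add: q_def)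
  show ?case
  proof (cases "a < b")
    case False
    have "100 \<le> 10 * q" using rY rB Y by linarith
    then have "calls A fRec [G, VNat a, VNat b, enc_natss X] (enc_res (rec_fun us T K (Suc h) a b X)) (10 * q)"
      using False by (intro calls_wpI) (simp add: rec_body_def)
    then show ?thesis unfolding R q_def .
  next
    case True
    define m where "m = (a + b) div 2"
    define TM where "TM = middle_tasks T a m b"
    have m: "a \<le> m" "m < b" using True by (auto simp: m_def)
    have h: "m - a < 2 ^ h" "b - (m + 1) < 2 ^ h" using Suc.prems(1) True by (auto simp: m_def)
    have us: "m < length us" "m \<le> length us" using m Suc.prems(2) by auto
    have TM: "tasks_ok TM" "length TM \<le> n"
    proof -
      show "tasks_ok TM" by (rule tasks_ok_subset[OF T(1)]) (auto simp: TM_def middle_tasks_def)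
      show "length TM \<le> n" using n length_filter_le le_trans unfolding TM_def middle_tasks_def by blast
    qed
    let ?ctx = "VPair G (VPair (VNat a) (VPair (VNat m) (VPair (VNat b) (VPair (enc_natss X) (enc_natss TM)))))"
    interpret search_context A ?ctx G "VNat a" "VNat m" "VNat b" "enc_natss X" TM n
      by unfold_locales (use TM in auto)
    define F where "F = 2 * r + 50 * M + 15 * length us + 200 * n + 300"
    have fin: "calls A fFinish [?ctx, enc_natss S] (enc_res (finish_fun (rec_fun us T K h) us a m b X S)) F"
      if S: "tasks_ok S" "length S \<le> n" for S
    proof -
      have SX: "tasks_ok (S @ X)" "length (S @ X) + h * n \<le> M" using S Suc.prems(3,4) by auto
      show ?thesis unfolding F_def
      proof (rule calls_finish)
        show "calls A fRec [G, VNat a, VNat m, enc_natss (S @ X)] (enc_res (rec_fun us T K h a m (S @ X))) r"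
          using Suc.IH[OF h(1) us(2) SX] by (simp add: r_def Y_def B_def)
        show "calls A fRec [G, VNat (m + 1), VNat b, enc_natss (S @ X)]
            (enc_res (rec_fun us T K h (m + 1) b (S @ X))) r"
          using Suc.IH[OF h(2) Suc.prems(2) SX] by (simp add: r_def Y_def B_def)
        show "length l \<le> n" if "rec_fun us T K h a m (S @ X) = Some (c, l)" for c l
        proof -
          have "distinct l" "set l \<subseteq> set T" using rec_fun_sound[OF T(2) that h(1)] by auto
          then show ?thesis using length_le_of_distinct_subset n le_trans by blast
        qed
        show "length (S @ X) \<le> M" using SX(2) by simp
      qed (use S Suc.prems us G in auto)
    qed
    have "state_ok TM [] []" using TM by (simp add: state_ok_def)
    note search = calls_search[OF fin this, of K, folded B_def, unfolded enc_natss_simps]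
    have F: "F + 400 * n + 2000 \<le> 2 * r + Y" by (simp add: F_def Y_def)
    \<comment> \<open>\<open>Y \<le> r\<close> turns the linear overhead into one more copy of
      \<open>r\<close>, hence \<open>3 * q\<close>; the factor \<open>10\<close> covers the
      rest.\<close>
    have "(F + 400 * n + 2000) * B \<le> (2 * r + Y) * B" using F by (rule mult_le_mono1)
    also have "\<dots> \<le> 3 * q" using rY unfolding q_def mult.assoc[symmetric] by (intro mult_le_mono1) simp
    finally have cost: "80 * n + 500 + (F + 400 * n + 2000) * B \<le> 10 * q"
      using rY rB Y by linarith
    have "calls A fRec [G, VNat a, VNat b, enc_natss X] (enc_res (rec_fun us T K (Suc h) a b X)) (10 * q)"
      apply (rule calls_mono[OF _ cost])
      apply (rule calls_wpI)
      apply (simp add: rec_body_def True G)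
      apply (rule call_callsI[OF calls_mids[OF T(1)]])
       apply simp
      apply (simp flip: m_def TM_def)
      apply (rule call_callsI[OF search[unfolded G]])
      using n True by (simp_all add: Let_def flip: m_def TM_def)
    then show ?thesis unfolding R q_def .
  qed
qed

section \<open>Dominating sets of crossing tasks\<close>

lemma diff_less_of_div_eq:
  fixes d :: nat
  assumes "0 < d" "a div d = b div d"
  shows "a - b < d"
proof -
  have "a < d * (a div d) + d" using dividend_less_times_div[OF assms(1), of a] by simp
  also have "d * (a div d) \<le> b" using assms(2) by simp
  finally show ?thesis using assms(1) by linarith
qed

text \<open>Cutting \<open>Q\<close> into strips of \<open>d\<close> consecutive values of \<open>f\<close>, a bijection that preserves strips
  lowers every threshold count by less than \<open>d\<close>. Large blocks of equal values do no harm, since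
  strips are determined by the number of elements that are less than or equal.\<close>

lemma strip_count:
  fixes f :: "'a \<Rightarrow> nat"
  assumes fin: "finite Q" and \<phi>: "bij_betw \<phi> Q R" and d: "0 < d"
    and lab: "\<And>x. x \<in> Q \<Longrightarrow> card {z \<in> Q. f z \<le> f (\<phi> x)} div d = card {z \<in> Q. f z \<le> f x} div d"
  shows "card {x \<in> Q. \<theta> \<le> f x} < card {y \<in> R. \<theta> \<le> f y} + d"
proof -
  let ?bad = "{x \<in> Q. \<theta> \<le> f x \<and> f (\<phi> x) < \<theta>}"
  have bad: "card ?bad < d"
  proof (cases "?bad = {}")
    case True
    show ?thesis unfolding True using d by simp
  next
    case False
    have finb: "finite ?bad" using fin by simp
    have "Max (f ` ?bad) \<in> f ` ?bad" using False finb by (intro Max_in) auto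
    \<comment> \<open>\<open>x1\<close> is a bad element with the largest value. All bad elements
      have values above \<open>f (\<phi> x1)\<close> and at most \<open>f x1\<close>, so their
      number is at most the difference of two ranks from the same strip.\<close>
    then obtain x1 where x1: "x1 \<in> ?bad" "f x1 = Max (f ` ?bad)" by auto
    let ?lo = "{z \<in> Q. f z \<le> f (\<phi> x1)}" and ?hi = "{z \<in> Q. f z \<le> f x1}"
    have "?bad \<subseteq> ?hi - ?lo" using x1 finb by (auto simp: Max_ge)
    then have "card ?bad \<le> card (?hi - ?lo)" using fin by (intro card_mono) auto
    also have "\<dots> = card ?hi - card ?lo" using x1 fin by (intro card_Diff_subset) auto
    finally have "card ?bad \<le> card ?hi - card ?lo" .
    moreover have "card ?hi div d = card ?lo div d" using lab[of x1] x1 by simp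
    then have "card ?hi - card ?lo < d" using diff_less_of_div_eq[OF d] by blast
    ultimately show ?thesis by linarith
  qed
  have "{x \<in> Q. \<theta> \<le> f x} \<subseteq> {x \<in> Q. \<theta> \<le> f (\<phi> x)} \<union> ?bad" by auto
  then have "card {x \<in> Q. \<theta> \<le> f x} \<le> card ({x \<in> Q. \<theta> \<le> f (\<phi> x)} \<union> ?bad)"
    using fin by (intro card_mono) auto
  also have "\<dots> \<le> card {x \<in> Q. \<theta> \<le> f (\<phi> x)} + card ?bad" by (rule card_Un_le)
  also have "card {x \<in> Q. \<theta> \<le> f (\<phi> x)} = card {y \<in> R. \<theta> \<le> f y}"
  proof (rule bij_betw_same_card)
    show "bij_betw \<phi> {x \<in> Q. \<theta> \<le> f (\<phi> x)} {y \<in> R. \<theta> \<le> f y}"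
      using \<phi> by (rule bij_betw_subset) (use \<phi> in \<open>auto simp: bij_betw_def\<close>)
  qed
  finally show ?thesis using bad by linarith
qed

text \<open>If \<open>f y\<close> were smaller, \<open>x\<close> itself would be counted in the rank
  of \<open>x\<close> but not in that of \<open>y\<close>. This serves strips of width one, where
  equal labels mean equal ranks.\<close>

lemma strip_ge:
  fixes f :: "'a \<Rightarrow> nat"
  assumes fin: "finite Q" and x: "x \<in> Q" and eq: "card {z \<in> Q. f z \<le> f y} = card {z \<in> Q. f z \<le> f x}"
  shows "f x \<le> f y"
proof (rule ccontr)
  assume "\<not> f x \<le> f y"
  then have "{z \<in> Q. f z \<le> f y} \<subset> {z \<in> Q. f z \<le> f x}" using x by auto
  then have "card {z \<in> Q. f z \<le> f y} < card {z \<in> Q. f z \<le> f x}" using fin by (intro psubset_card_mono) auto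
  then show False using eq by simp
qed

definition set_cover :: "nat list set \<Rightarrow> nat \<Rightarrow> nat" where
  "set_cover O' e = (\<Sum>t\<in>O'. if uses t e then t ! 2 else 0)"

definition set_cost :: "nat list set \<Rightarrow> nat" where
  "set_cost O' = (\<Sum>t\<in>O'. t ! 3)"

lemma cover_eq_set_cover: "distinct l \<Longrightarrow> cover l e = set_cover (set l) e"
  by (simp add: cover_def set_cover_def sum_list_distinct_conv_sum_set)

lemma cost_eq_set_cost: "distinct l \<Longrightarrow> cost l = set_cost (set l)"
  by (simp add: cost_def set_cost_def sum_list_distinct_conv_sum_set)

lemma set_cover_Un: "finite X \<Longrightarrow> finite Y \<Longrightarrow> X \<inter> Y = {} \<Longrightarrow> set_cover (X \<union> Y) e = set_cover X e + set_cover Y e"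
  by (simp add: set_cover_def sum.union_disjoint)

lemma set_cost_Un: "finite X \<Longrightarrow> finite Y \<Longrightarrow> X \<inter> Y = {} \<Longrightarrow> set_cost (X \<union> Y) = set_cost X + set_cost Y"
  by (simp add: set_cost_def sum.union_disjoint)

lemma set_cover_mono: "finite Y \<Longrightarrow> X \<subseteq> Y \<Longrightarrow> set_cover X e \<le> set_cover Y e"
  by (simp add: set_cover_def sum_mono2)

lemma set_cover_alt: "finite X \<Longrightarrow> set_cover X e = (\<Sum>t\<in>{t \<in> X. uses t e}. t ! 2)"
  by (simp add: set_cover_def sum.inter_filter)

section \<open>Sets reachable by instruction sequences\<close>

text \<open>Because all tasks share the edge \<open>m\<close>, a task uses an edge right of
  \<open>m\<close> iff it ends late enough, and an edge left of \<open>m\<close> iff it starts early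
  enough. Covering becomes a one-dimensional threshold condition on either side.\<close>

locale crossing =
  fixes TM :: "nat list list" and m :: nat
  assumes dist: "distinct TM" and crosses: "\<And>t. t \<in> set TM \<Longrightarrow> uses t m"
begin

text \<open>The second component is empty, that is, all unselected tasks are candidates. Instruction
  blocks therefore compose: each starts from the kind of state in which the previous one
  ended.\<close>

definition selectable :: "nat \<Rightarrow> nat list set \<Rightarrow> bool" where
  "selectable k S \<longleftrightarrow> (\<exists>R l. moves TM k (TM, [], []) (R, [], l) \<and> distinct (R @ l) \<and> set l = S \<and>
     set R = set TM - S \<and> S \<subseteq> set TM)"

definition valid_filters :: "(nat \<times> nat list) list \<Rightarrow> bool" where
  "valid_filters Fs \<longleftrightarrow> (\<forall>(op, piv) \<in> set Fs. op < 8 \<and> piv \<in> set TM)"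

definition region :: "(nat \<times> nat list) list \<Rightarrow> nat list set" where
  "region Fs = {t \<in> set TM. \<forall>(op, piv) \<in> set Fs. passes op piv t}"

lemma finite_region [simp]: "finite (region Fs)"
  by (simp add: region_def)

lemma region_append: "region (Fs @ Gs) = region Fs \<inter> region Gs"
  by (auto simp: region_def)

lemma selectable_subset: "selectable k S \<Longrightarrow> S \<subseteq> set TM"
  by (auto simp: selectable_def)

lemma selectable_mono: "selectable k S \<Longrightarrow> k \<le> k' \<Longrightarrow> selectable k' S"
  unfolding selectable_def using moves_mono by blast

lemma selectable_empty: "selectable 0 {}"
  unfolding selectable_def using moves_refl[of TM 0 "(TM, [], [])"] dist by auto

lemma moves_filters:
  "valid_filters Fs \<Longrightarrow> distinct (W @ N) \<Longrightarrow>
    \<exists>W' N'. moves TM (length Fs) (W, N, S) (W', N', S) \<and> distinct (W' @ N') \<and>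
      set W' = {t \<in> set W. \<forall>(op, piv) \<in> set Fs. passes op piv t} \<and> set (W' @ N') = set (W @ N)"
proof (induction Fs arbitrary: W N)
  case Nil
  then show ?case by (intro exI[of _ W] exI[of _ N]) (auto intro: moves_refl)
next
  case (Cons F Fs)
  obtain op piv where F: "F = (op, piv)" by fastforce
  let ?W = "filter (passes op piv) W" and ?N = "filter (\<lambda>t. \<not> passes op piv t) W @ N"
  have "valid_filters Fs" "distinct (?W @ ?N)" using Cons.prems by (auto simp: valid_filters_def)
  from Cons.IH[OF this] obtain W' N' where *:
    "moves TM (length Fs) (?W, ?N, S) (W', N', S)" "distinct (W' @ N')"
    "set W' = {t \<in> set ?W. \<forall>(op, piv) \<in> set Fs. passes op piv t}" "set (W' @ N') = set (?W @ ?N)" by blast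
  have "moves TM (Suc (length Fs)) (W, N, S) (W', N', S)"
    by (rule moves_filter[OF _ _ *(1)]) (use Cons.prems F in \<open>auto simp: valid_filters_def\<close>)
  then show ?case using *(2,3,4) F by (intro exI[of _ W'] exI[of _ N']) auto
qed

text \<open>One instruction per filter and one for the selection. Which of the remaining candidates
  are taken depends on the order of the list, so only their number is known.\<close>

lemma selectable_pick:
  assumes sel: "selectable k S" and Fs: "valid_filters Fs"
  shows "\<exists>Pk \<subseteq> region Fs - S. card Pk = min j (card (region Fs - S)) \<and>
    selectable (k + length Fs + 1) (S \<union> Pk)"
proof (cases "j = 0")
  case True
  then show ?thesis using selectable_mono[OF sel, of "k + length Fs + 1"] by (intro exI[of _ "{}"]) auto
next
  case False
  from sel obtain R l where m: "moves TM k (TM, [], []) (R, [], l)" and d: "distinct (R @ l)"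
    and l: "set l = S" "set R = set TM - S" "S \<subseteq> set TM" unfolding selectable_def by blast
  from moves_filters[OF Fs, of R "[]" l] d obtain W N where
    mf: "moves TM (length Fs) (R, [], l) (W, N, l)" and WN: "distinct (W @ N)"
      "set W = {t \<in> set R. \<forall>(op, piv) \<in> set Fs. passes op piv t}" "set (W @ N) = set R" by auto
  have W: "set W = region Fs - S" using WN(2) l by (auto simp: region_def)
  have lenW: "length W = card (region Fs - S)" using W WN(1) by (metis distinct_append distinct_card)
  show ?thesis
  proof (cases "TM = []")
    case True
    then have "set TM = {}" by simp
    have "region Fs \<subseteq> set TM" by (auto simp: region_def)
    then have "region Fs = {}" unfolding \<open>set TM = {}\<close> subset_empty .
    moreover have "S = {}" using l(3) unfolding \<open>set TM = {}\<close> subset_empty .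
    moreover have "selectable (k + length Fs + 1) S" by (rule selectable_mono[OF sel]) simp
    ultimately show ?thesis by (intro exI[of _ "{}"]) simp
  next
    case ne: False
    \<comment> \<open>\<open>moves_pick\<close> allows counts up to \<open>length TM\<close>;
      capping \<open>j\<close> there changes nothing, since there are never more candidates.\<close>
    define i where "i = min j (length TM)"
    have i: "0 < i" "i \<le> length TM" using False ne by (auto simp: i_def)
    have "length W \<le> length TM"
      using W WN(1) by (intro length_le_of_distinct_subset) (auto simp: region_def)
    then have ti: "take i W = take j W" by (auto simp: i_def min_def)
    have mp: "moves TM (Suc 0) (W, N, l) (drop i W @ N, [], rev (take i W) @ l)"
      by (rule moves_pick[OF i moves_refl])
    have mv: "moves TM (k + length Fs + Suc 0) (TM, [], []) (drop i W @ N, [], rev (take i W) @ l)"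
      by (rule moves_trans[OF moves_trans[OF m mf] mp])
    have dW: "distinct W" "set W \<inter> set N = {}" using WN(1) by auto
    have td: "set (take i W) \<inter> set (drop i W) = {}" "set (take i W) \<union> set (drop i W) = set W"
      using set_take_disj_set_drop_if_distinct[OF dW(1), of i i] by (auto simp flip: set_append)
    have N: "set N = set R - set W" using WN(1,3) by auto
    have WR: "set W \<subseteq> set R" using WN(2) by blast
    have ld: "distinct l" "set R \<inter> set l = {}" using d by auto
    have t1: "distinct ((drop i W @ N) @ rev (take i W) @ l)"
      using ld WN(1) td N WR by (simp add: distinct_append) blast
    have Diff_Un_left_eq: "Z - (X \<union> Y) = (Z - X) - Y" for X Y Z :: "nat list set" by blast
    have t2: "set (drop i W @ N) = set TM - (S \<union> set (take i W))"
    proof -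
      have "Y \<union> (Z - V) = Z - X" if "X \<inter> Y = {}" "X \<union> Y = V" "V \<subseteq> Z" for X Y Z V :: "nat list set"
        using that by auto
      from this[OF td WR] show ?thesis
        unfolding set_append N Diff_Un_left_eq l(2)[symmetric] .
    qed
    have t3: "set (take i W) \<subseteq> region Fs - S" unfolding W[symmetric] by (rule set_take_subset)
    have t4: "set (take i W) \<subseteq> set TM" using WR l(2) set_take_subset[of i W] by (metis Diff_subset subset_trans)
    have t5: "card (set (take i W)) = min j (card (region Fs - S))"
      using ti lenW dW(1) by (simp add: distinct_card)
    have "selectable (k + length Fs + 1) (S \<union> set (take i W))"
      unfolding selectable_def
    proof (intro exI conjI)
      show "moves TM (k + length Fs + 1) (TM, [], []) (drop i W @ N, [], rev (take i W) @ l)"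
        using mv by simp
      show "set (rev (take i W) @ l) = S \<union> set (take i W)" using l(1) by auto
      show "S \<union> set (take i W) \<subseteq> set TM" using t4 l(3) by blast
    qed (fact t1 t2)+
    then show ?thesis using t3 t5 by blast
  qed
qed

text \<open>The \<open>n\<close> candidates that reach farthest are taken by selecting first everything strictly beyond
  the \<open>n\<close>-th farthest and then \<open>n\<close> more from there. Afterwards every threshold is passed by \<open>n\<close> new
  tasks unless all candidates beyond it are selected.\<close>

lemma selectable_extremes:
  fixes f :: "nat list \<Rightarrow> nat"
  assumes sel: "selectable k S" and Fs: "valid_filters Fs" and op: "op < 8"
    and f: "\<And>s t. s \<in> set TM \<Longrightarrow> t \<in> set TM \<Longrightarrow> passes op s t \<longleftrightarrow> f s \<le> f t"
  shows "\<exists>E \<subseteq> region Fs - S. card E \<le> 2 * n \<and> selectable (k + 2 * (length Fs + 2)) (S \<union> E) \<and>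
    (\<forall>\<theta>. {t \<in> region Fs. \<theta> \<le> f t} \<subseteq> S \<union> E \<or> n \<le> card {t \<in> E. \<theta> \<le> f t})"
proof -
  define V where "V = region Fs"
  define U where "U = V - S"
  have finU: "finite U" by (simp add: U_def V_def)
  have UTM: "U \<subseteq> set TM" by (auto simp: U_def V_def region_def)
  show ?thesis
  proof (cases "card U \<le> n")
    case True
    obtain E where E: "E \<subseteq> region Fs - S" "card E = min n (card (region Fs - S))"
      "selectable (k + length Fs + 1) (S \<union> E)" using selectable_pick[OF sel Fs] by blast
    have "E = region Fs - S"
      using E(1,2) True finU by (simp add: U_def V_def card_subset_eq)
    moreover have "selectable (k + 2 * (length Fs + 2)) (S \<union> E)" by (rule selectable_mono[OF E(3)]) simp
    moreover have "card E \<le> 2 * n" using E(2) by simp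
    ultimately show ?thesis by (intro exI[of _ E]) auto
  next
    case False
    then have Une: "U \<noteq> {}" by auto
    \<comment> \<open>\<open>t0\<close> will be the farthest task with at least \<open>n\<close>
      tasks of \<open>U\<close> at or beyond it, so at most \<open>n\<close> lie strictly beyond. A
      single selection would not do: ties at \<open>t0\<close> could be taken in place of tasks
      beyond it.\<close>
    define R where "R = {t \<in> U. n \<le> card {t' \<in> U. f t \<le> f t'}}"
    have "Min (f ` U) \<in> f ` U" using Une finU by simp
    then obtain tm where tm: "tm \<in> U" "f tm = Min (f ` U)" by auto
    then have "{t' \<in> U. f tm \<le> f t'} = U" using finU by auto
    then have "tm \<in> R" using tm False by (simp add: R_def)
    moreover have finR: "finite R" using finU by (simp add: R_def)
    ultimately have "Max (f ` R) \<in> f ` R" by (intro Max_in) auto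
    then obtain t0 where t0: "t0 \<in> R" "f t0 = Max (f ` R)" by auto
    have t0U: "t0 \<in> U" using t0 by (simp add: R_def)
    define U1 where "U1 = {t \<in> U. f t0 < f t}"
    have finU1: "finite U1" using finU by (simp add: U1_def)
    have U1: "card U1 \<le> n \<and> selectable (k + length Fs + 2) (S \<union> U1)"
    proof (cases "U1 = {}")
      case True
      then show ?thesis using selectable_mono[OF sel] by simp
    next
      case False
      have "Min (f ` U1) \<in> f ` U1" using False finU1 by simp
      \<comment> \<open>Filters compare non-strictly, so being strictly beyond \<open>t0\<close> is
        expressed as being at or beyond the nearest such task \<open>t1\<close>.\<close>
      then obtain t1 where t1: "t1 \<in> U1" "f t1 = Min (f ` U1)" by auto
      have t1U: "t1 \<in> U" "f t0 < f t1" using t1 by (auto simp: U1_def)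
      have "{t' \<in> U. f t1 \<le> f t'} = U1"
        using t1 finU1 by (auto simp: U1_def intro: Min_le)
      moreover have "t1 \<notin> R"
      proof
        assume "t1 \<in> R"
        then have "f t1 \<le> f t0" using t0(2) finR by simp
        then show False using t1U by simp
      qed
      ultimately have c: "card U1 < n" using t1U by (auto simp: R_def not_le)
      have v: "valid_filters (Fs @ [(op, t1)])" using Fs op t1U UTM by (auto simp: valid_filters_def)
      have "region (Fs @ [(op, t1)]) - S = {t' \<in> U. f t1 \<le> f t'}"
        using t1U UTM f by (auto simp: region_append U_def V_def region_def)
      then have r: "region (Fs @ [(op, t1)]) - S = U1" using \<open>{t' \<in> U. f t1 \<le> f t'} = U1\<close> by simp
      obtain E where E: "E \<subseteq> U1" "card E = min n (card U1)"
        "selectable (k + length (Fs @ [(op, t1)]) + 1) (S \<union> E)"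
        using selectable_pick[OF sel v, of n] unfolding r by blast
      have "E = U1" using E(1,2) c finU1 by (simp add: card_subset_eq)
      then show ?thesis using E(3) c by (simp add: numeral_2_eq_2)
    qed
    have v: "valid_filters (Fs @ [(op, t0)])" using Fs op t0U UTM by (auto simp: valid_filters_def)
    have r: "region (Fs @ [(op, t0)]) = {t \<in> V. f t0 \<le> f t}"
      using t0U UTM f by (auto simp: region_append V_def region_def)
    let ?C = "{t \<in> V. f t0 \<le> f t} - (S \<union> U1)"
    obtain E2 where E2: "E2 \<subseteq> ?C" "card E2 = min n (card ?C)"
      "selectable (k + length Fs + 2 + length (Fs @ [(op, t0)]) + 1) (S \<union> U1 \<union> E2)"
      using selectable_pick[OF conjunct2[OF U1] v, of n] unfolding r by blast
    have finC: "finite ?C" by (simp add: V_def)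
    have finE2: "finite E2" using E2(1) finC finite_subset by blast
    define E where "E = U1 \<union> E2"
    have EU: "E \<subseteq> {t \<in> U. f t0 \<le> f t}" using E2(1) by (auto simp: E_def U1_def U_def)
    have "card E2 \<le> n" using E2(2) by simp
    then have "card E \<le> 2 * n" using conjunct1[OF U1] card_Un_le[of U1 E2] by (simp add: E_def)
    moreover have "selectable (k + 2 * (length Fs + 2)) (S \<union> E)"
      using E2(3) by (simp add: E_def Un_assoc algebra_simps numeral_2_eq_2)
    \<comment> \<open>If fewer than \<open>n\<close> tasks remain, all of them are taken, and
      \<open>E\<close> is everything in \<open>U\<close> at or beyond \<open>t0\<close>: at least
      \<open>n\<close> tasks by the choice of \<open>t0\<close>.\<close>
    moreover have "n \<le> card E"
    proof (cases "n \<le> card ?C")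
      case True
      then have "n \<le> card E2" using E2(2) by simp
      also have "\<dots> \<le> card E" using finE2 finU1 by (intro card_mono) (auto simp: E_def)
      finally show ?thesis .
    next
      case False
      then have "E2 = ?C" using E2(1,2) finC by (simp add: card_subset_eq)
      then have "E = {t \<in> U. f t0 \<le> f t}" by (auto simp: E_def U1_def U_def)
      then show ?thesis using t0(1) by (simp add: R_def)
    qed
    \<comment> \<open>Thresholds up to \<open>f t0\<close> are passed by all of \<open>E\<close>;
      beyond \<open>f t0\<close> every candidate is already selected.\<close>
    then have "{t \<in> V. \<theta> \<le> f t} \<subseteq> S \<union> E \<or> n \<le> card {t \<in> E. \<theta> \<le> f t}" for \<theta>
    proof (cases "\<theta> \<le> f t0")
      case True
      then have "{t \<in> E. \<theta> \<le> f t} = E" using EU by auto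
      then show ?thesis using \<open>n \<le> card E\<close> by simp
    next
      case False
      then have "{t \<in> V. \<theta> \<le> f t} \<subseteq> S \<union> U1" by (auto simp: U1_def U_def)
      then show ?thesis by (auto simp: E_def)
    qed
    ultimately show ?thesis using EU unfolding V_def U_def by (intro exI[of _ E]) auto
  qed
qed

definition in_range :: "nat list set \<Rightarrow> nat \<Rightarrow> nat list \<Rightarrow> bool" where
  "in_range Q a t \<longleftrightarrow> (\<exists>s\<in>Q. s ! a \<le> t ! a) \<and> (\<exists>s\<in>Q. t ! a \<le> s ! a)"

text \<open>The bounding box of \<open>Q\<close> in the coordinates \<open>as\<close>.\<close>

definition box :: "nat list set \<Rightarrow> nat list \<Rightarrow> nat list set" where
  "box Q as = {t \<in> set TM. \<forall>a\<in>set as. in_range Q a t}"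

lemma subset_box: "Q \<subseteq> set TM \<Longrightarrow> Q \<subseteq> box Q as"
  by (auto simp: box_def in_range_def)

text \<open>The bounds in each coordinate are attained by members of \<open>Q\<close>, which are
  admissible pivots; this gives two filters per coordinate.\<close>

lemma box_filters:
  assumes "Q \<subseteq> set TM" "Q \<noteq> {}"
  shows "set as \<subseteq> {..<4} \<Longrightarrow> \<exists>Fs. length Fs = 2 * length as \<and> valid_filters Fs \<and> region Fs = box Q as"
proof (induction as)
  case Nil
  show ?case by (intro exI[of _ "[]"]) (auto simp: valid_filters_def region_def box_def)
next
  case (Cons a as)
  then obtain Fs where Fs: "length Fs = 2 * length as" "valid_filters Fs" "region Fs = box Q as" by auto
  have fin: "finite ((\<lambda>t. t ! a) ` Q)" "(\<lambda>t. t ! a) ` Q \<noteq> {}" using assms finite_subset by auto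
  obtain lo where lo: "lo \<in> Q" "lo ! a = Min ((\<lambda>t. t ! a) ` Q)" using Min_in[OF fin] by auto
  obtain hi where hi: "hi \<in> Q" "hi ! a = Max ((\<lambda>t. t ! a) ` Q)" using Max_in[OF fin] by auto
  have *: "in_range Q a t \<longleftrightarrow> lo ! a \<le> t ! a \<and> t ! a \<le> hi ! a" for t
    unfolding in_range_def
    using lo hi Min_le[OF fin(1)] Max_ge[OF fin(1)] by (metis (no_types, lifting) imageI order_trans)
  have a: "a < 4" using Cons.prems by simp
  let ?Fs = "Fs @ [(a, lo), (a + 4, hi)]"
  have "valid_filters ?Fs" using Fs(2) a lo hi assms by (auto simp: valid_filters_def)
  moreover have "region ?Fs = box Q (a # as)"
    unfolding region_append Fs(3) using a by (auto simp: region_def box_def * passes_def)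
  ultimately show ?case using Fs(1) by (intro exI[of _ ?Fs]) auto
qed

end

section \<open>Domination within one class of sizes and costs\<close>

context crossing
begin

lemma selectable_cells:
  fixes lab :: "nat list \<Rightarrow> 'l"
  assumes sel: "selectable k S" and Q: "Q \<subseteq> set TM" and disj: "S \<inter> box Q [2, 3] = {}"
    and conv: "\<And>l t. {s \<in> Q. lab s = l} \<noteq> {} \<Longrightarrow> t \<in> box {s \<in> Q. lab s = l} [0, 1, 2, 3] \<Longrightarrow> lab t = l"
  shows "finite \<Lambda> \<Longrightarrow> \<exists>S' \<phi>. S' \<subseteq> box Q [2, 3] \<and> selectable (k + 9 * card \<Lambda>) (S \<union> S') \<and>
    bij_betw \<phi> {s \<in> Q. lab s \<in> \<Lambda>} S' \<and> (\<forall>s\<in>Q. lab s \<in> \<Lambda> \<longrightarrow> lab (\<phi> s) = lab s)"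
proof (induction \<Lambda> rule: finite_induct)
  case empty
  show ?case using sel by (intro exI[of _ "{}"] exI[of _ id]) (auto simp: bij_betw_def)
next
  case (insert l \<Lambda>)
  then obtain S' \<phi> where S': "S' \<subseteq> box Q [2, 3]" and sel': "selectable (k + 9 * card \<Lambda>) (S \<union> S')"
    and \<phi>: "bij_betw \<phi> {s \<in> Q. lab s \<in> \<Lambda>} S'" "\<forall>s\<in>Q. lab s \<in> \<Lambda> \<longrightarrow> lab (\<phi> s) = lab s" by blast
  define C where "C = {s \<in> Q. lab s = l}"
  show ?case
  proof (cases "C = {}")
    case True
    then have "{s \<in> Q. lab s \<in> insert l \<Lambda>} = {s \<in> Q. lab s \<in> \<Lambda>}" by (auto simp: C_def)
    moreover have "selectable (k + 9 * card (insert l \<Lambda>)) (S \<union> S')"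
      by (rule selectable_mono[OF sel']) (use insert.hyps in simp)
    ultimately show ?thesis using S' \<phi> True by (intro exI[of _ S'] exI[of _ \<phi>]) (auto simp: C_def)
  next
    case False
    have CTM: "C \<subseteq> set TM" using Q by (auto simp: C_def)
    have finC: "finite C" using CTM finite_subset by blast
    obtain Fs where Fs: "length Fs = 2 * length [0, 1, 2, 3 :: nat]" "valid_filters Fs"
      "region Fs = box C [0, 1, 2, 3]" using box_filters[OF CTM False, of "[0, 1, 2, 3]"] by auto
    obtain Pk where Pk: "Pk \<subseteq> box C [0, 1, 2, 3] - (S \<union> S')"
      "card Pk = min (card C) (card (box C [0, 1, 2, 3] - (S \<union> S')))"
      "selectable (k + 9 * card \<Lambda> + length Fs + 1) (S \<union> S' \<union> Pk)"
      using selectable_pick[OF sel' Fs(2), of "card C"] unfolding Fs(3) by blast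
    have box_sub: "box C [0, 1, 2, 3] \<subseteq> box Q [2, 3]" by (auto simp: box_def in_range_def C_def)
    have labPk: "lab t = l" if "t \<in> box C [0, 1, 2, 3]" for t
      using conv[of l t] that False by (simp add: C_def)
    have labS': "lab t \<in> \<Lambda>" if t: "t \<in> S'" for t
    proof -
      obtain s where "s \<in> Q" "lab s \<in> \<Lambda>" "t = \<phi> s" using t \<phi>(1) by (auto simp: bij_betw_def)
      then show ?thesis using \<phi>(2) by auto
    qed
    have "C \<subseteq> box C [0, 1, 2, 3] - (S \<union> S')"
      using subset_box[OF CTM, of "[0, 1, 2, 3]"] disj box_sub labS' insert.hyps
      by (auto simp: C_def)
    then have "card C \<le> card (box C [0, 1, 2, 3] - (S \<union> S'))"
      by (intro card_mono) (simp_all add: box_def)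
    then have "card Pk = card C" using Pk(2) by simp
    moreover have "finite Pk" using Pk(1) by (rule finite_subset) (simp add: box_def)
    ultimately obtain \<psi> where \<psi>: "bij_betw \<psi> C Pk" using finC by (metis finite_same_card_bij)
    define \<chi> where "\<chi> = (\<lambda>s. if lab s = l then \<psi> s else \<phi> s)"
    have "bij_betw \<chi> {s \<in> Q. lab s \<in> \<Lambda>} S'"
      using \<phi>(1) insert.hyps by (subst bij_betw_cong[of _ _ \<phi>]) (auto simp: \<chi>_def)
    moreover have "bij_betw \<chi> C Pk"
      using \<psi> by (subst bij_betw_cong[of _ _ \<psi>]) (auto simp: \<chi>_def C_def)
    moreover have "S' \<inter> Pk = {}" using Pk(1) by auto
    ultimately have "bij_betw \<chi> ({s \<in> Q. lab s \<in> \<Lambda>} \<union> C) (S' \<union> Pk)" by (rule bij_betw_combine)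
    moreover have "{s \<in> Q. lab s \<in> \<Lambda>} \<union> C = {s \<in> Q. lab s \<in> insert l \<Lambda>}" by (auto simp: C_def)
    moreover have "lab (\<chi> s) = lab s" if s: "s \<in> Q" "lab s \<in> insert l \<Lambda>" for s
    proof (cases "lab s = l")
      case True
      then have "\<psi> s \<in> Pk" using \<psi> s by (auto simp: bij_betw_def C_def)
      then show ?thesis using True labPk Pk(1) by (auto simp: \<chi>_def)
    next
      case False
      then show ?thesis using s \<phi>(2) by (auto simp: \<chi>_def)
    qed
    moreover have "selectable (k + 9 * card (insert l \<Lambda>)) (S \<union> (S' \<union> Pk))"
    proof -
      have "k + 9 * card \<Lambda> + length Fs + 1 = k + 9 * card (insert l \<Lambda>)"
        using Fs(1) insert.hyps by simp
      then show ?thesis using Pk(3) by (simp only: Un_assoc)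
    qed
    moreover have "S' \<union> Pk \<subseteq> box Q [2, 3]" using S' Pk(1) box_sub by auto
    ultimately show ?thesis by (intro exI[of _ "S' \<union> Pk"] exI[of _ \<chi>]) auto
  qed
qed

text \<open>Sizes and costs in \<open>Q\<close> agree up to a factor of \<open>1 + 1/D\<close>. Selecting as many tasks as \<open>Q\<close> has
  from each cell of a grid of strips loses fewer than \<open>d = card Q div D\<close> tasks at each edge, and the
  size differences lose at most \<open>2 d\<close> more. Hence \<open>3 d\<close> extreme tasks on each side make up for the
  loss, except where all tasks of this class are selected anyway. If \<open>d = 0\<close>, the cells
  determine the tasks up to domination and no extreme tasks are added.\<close>

lemma dominate_group:
  assumes sel: "selectable k S" and Q: "Q \<subseteq> set TM" "Q \<noteq> {}" and D: "0 < D"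
    and disj: "S \<inter> box Q [2, 3] = {}"
    and sizes: "\<And>s t. s \<in> Q \<Longrightarrow> t \<in> Q \<Longrightarrow> D * s ! 2 \<le> (D + 1) * t ! 2"
    and costs: "\<And>s t. s \<in> Q \<Longrightarrow> t \<in> Q \<Longrightarrow> D * s ! 3 \<le> (D + 1) * t ! 3"
  shows "\<exists>S' \<subseteq> box Q [2, 3]. selectable (k + (72 * D ^ 3 + 24)) (S \<union> S') \<and>
    (\<forall>e. set_cover Q e \<le> set_cover S' e) \<and> D * D * set_cost S' \<le> (D + 1) * (D + 12) * set_cost Q"
proof -
  define V where "V = box Q [2, 3]"
  define c where "c = card Q"
  define d where "d = c div D"
  \<comment> \<open>Strips need positive width. If \<open>Q\<close> has fewer than \<open>D\<close>
    tasks, the width is one and labels determine ranks exactly.\<close>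
  define d1 where "d1 = max 1 d"
  \<comment> \<open>Subtracting from \<open>m\<close> makes larger values reach farther on the left
    side too; crossing tasks start at or before \<open>m\<close>, so the natural subtraction loses
    nothing.\<close>
  define x where "x = (\<lambda>t :: nat list. m - t ! 0)"
  define y where "y = (\<lambda>t :: nat list. t ! 1)"
  define p where "p = (\<lambda>t :: nat list. t ! 2)"
  define cnt where "cnt = (\<lambda>(f :: nat list \<Rightarrow> nat) t. card {z \<in> Q. f z \<le> f t} div d1)"
  define lab where "lab = (\<lambda>t. (cnt x t, cnt y t, cnt p t))"
  have finQ: "finite Q" using Q finite_subset by blast
  have c: "0 < c" using Q finQ by (simp add: c_def card_gt_0_iff)
  have d1: "0 < d1" by (simp add: d1_def)
  have le_m: "t ! 0 \<le> m" "m < t ! 1" if "t \<in> set TM" for t using crosses[OF that] by (auto simp: uses_def)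
  have cnt_mono: "cnt f s \<le> cnt f t" if "f s \<le> f t" for f s t
    unfolding cnt_def using that finQ by (intro div_le_mono card_mono) auto
  \<comment> \<open>Rounding in \<open>d = c div D\<close> increases the number of strips by at most
    a factor of two.\<close>
  have cnt_less: "cnt f t < 2 * D" for f t
  proof -
    have "card {z \<in> Q. f z \<le> f t} \<le> c" unfolding c_def using finQ by (intro card_mono) auto
    then have "cnt f t \<le> c div d1" unfolding cnt_def by (rule div_le_mono)
    also have "c div d1 < 2 * D"
    proof (cases "d = 0")
      case True
      then have "c < D" using D by (simp add: d_def div_eq_0_iff)
      then show ?thesis using True by (simp add: d1_def)
    next
      case False
      have "c < (d + 1) * D" unfolding d_def using dividend_less_times_div[OF D, of c] by (simp add: algebra_simps)
      also have "\<dots> \<le> (2 * D) * d" using False by (cases d) auto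
      finally show ?thesis using False by (simp add: d1_def less_mult_imp_div_less)
    qed
    finally show ?thesis .
  qed
  \<comment> \<open>Ranks are monotone, so a task between two members of a cell in one coordinate
    has a rank between theirs and hence the same label component.\<close>
  have conv: "lab t = l" if ne: "{s \<in> Q. lab s = l} \<noteq> {}" and t: "t \<in> box {s \<in> Q. lab s = l} [0, 1, 2, 3]" for l t
  proof -
    let ?C = "{s \<in> Q. lab s = l}"
    have eq: "cnt f t = cnt f s" if f: "\<exists>s\<in>?C. f s \<le> f t" "\<exists>s\<in>?C. f t \<le> f s"
      and same: "\<And>s s'. s \<in> ?C \<Longrightarrow> s' \<in> ?C \<Longrightarrow> cnt f s = cnt f s'" and s: "s \<in> ?C" for f s
      using f cnt_mono same[OF s] by (metis (no_types, lifting) le_antisym)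
    obtain s where s: "s \<in> ?C" using ne by blast
    have r: "in_range ?C 0 t" "in_range ?C 1 t" "in_range ?C 2 t" "t \<in> set TM"
      using t by (auto simp: box_def)
    have "\<exists>s\<in>?C. x s \<le> x t" "\<exists>s\<in>?C. x t \<le> x s"
      using r(1) unfolding in_range_def x_def by (meson diff_le_mono2)+
    then have "cnt x t = cnt x s" by (rule eq) (use s in \<open>auto simp: lab_def\<close>)
    moreover have "\<exists>s\<in>?C. y s \<le> y t" "\<exists>s\<in>?C. y t \<le> y s" using r(2) unfolding in_range_def y_def by auto
    then have "cnt y t = cnt y s" by (rule eq) (use s in \<open>auto simp: lab_def\<close>)
    moreover have "\<exists>s\<in>?C. p s \<le> p t" "\<exists>s\<in>?C. p t \<le> p s" using r(3) unfolding in_range_def p_def by auto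
    then have "cnt p t = cnt p s" by (rule eq) (use s in \<open>auto simp: lab_def\<close>)
    ultimately show ?thesis using s by (simp add: lab_def)
  qed
  have "lab ` Q \<subseteq> {..<2 * D} \<times> {..<2 * D} \<times> {..<2 * D}" using cnt_less by (auto simp: lab_def)
  then have "card (lab ` Q) \<le> card ({..<2 * D} \<times> {..<2 * D} \<times> {..<2 * D})" by (intro card_mono) auto
  also have "\<dots> = 8 * D ^ 3" by (simp add: card_cartesian_product power3_eq_cube)
  finally have labs: "card (lab ` Q) \<le> 8 * D ^ 3" .
  have "\<exists>S0 \<phi>. S0 \<subseteq> box Q [2, 3] \<and> selectable (k + 9 * card (lab ` Q)) (S \<union> S0) \<and>
    bij_betw \<phi> {s \<in> Q. lab s \<in> lab ` Q} S0 \<and> (\<forall>s\<in>Q. lab s \<in> lab ` Q \<longrightarrow> lab (\<phi> s) = lab s)"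
    using finQ by (intro selectable_cells[OF sel Q(1) disj conv]) auto
  then obtain S0 \<phi> where S0: "S0 \<subseteq> V" "selectable (k + 9 * card (lab ` Q)) (S \<union> S0)"
    and \<phi>': "bij_betw \<phi> {s \<in> Q. lab s \<in> lab ` Q} S0" "\<forall>s\<in>Q. lab s \<in> lab ` Q \<longrightarrow> lab (\<phi> s) = lab s"
    unfolding V_def by (elim exE conjE)
  have "{s \<in> Q. lab s \<in> lab ` Q} = Q" by auto
  then have \<phi>: "bij_betw \<phi> Q S0" "\<And>s. s \<in> Q \<Longrightarrow> lab (\<phi> s) = lab s" using \<phi>' by auto
  \<comment> \<open>Nine instructions for each of at most \<open>(2 * D) ^ 3\<close> labels.\<close>
  have sel0: "selectable (k + 72 * D ^ 3) (S \<union> S0)" by (rule selectable_mono[OF S0(2)]) (use labs in simp)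
  obtain Fs where Fs: "length Fs = 2 * length [2, 3 :: nat]" "valid_filters Fs" "region Fs = V"
    using box_filters[OF Q, of "[2, 3]"] by (auto simp: V_def)
  \<comment> \<open>Code \<open>4\<close> bounds the start vertex from above, which is a lower bound
    on \<open>x\<close>; code \<open>1\<close> is a lower bound on \<open>y\<close>. With the four
    filters of \<open>V\<close>, each side takes \<open>2 * (4 + 2)\<close> instructions, which
    makes up the \<open>24\<close>.\<close>
  have "passes 4 s t \<longleftrightarrow> x s \<le> x t" if "s \<in> set TM" "t \<in> set TM" for s t
    using le_m[OF that(1)] le_m[OF that(2)] by (auto simp: passes_def x_def)
  then obtain E1 where E1: "E1 \<subseteq> V - (S \<union> S0)" "card E1 \<le> 2 * (3 * d)"
    "selectable (k + 72 * D ^ 3 + 2 * (length Fs + 2)) (S \<union> S0 \<union> E1)"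
    "\<And>\<theta>. {t \<in> V. \<theta> \<le> x t} \<subseteq> S \<union> S0 \<union> E1 \<or> 3 * d \<le> card {t \<in> E1. \<theta> \<le> x t}"
    using selectable_extremes[OF sel0 Fs(2), of 4 x "3 * d"] unfolding Fs(3) by auto
  have "passes 1 s t \<longleftrightarrow> y s \<le> y t" if "s \<in> set TM" "t \<in> set TM" for s t
    by (auto simp: passes_def y_def)
  then obtain E2 where E2: "E2 \<subseteq> V - (S \<union> S0 \<union> E1)" "card E2 \<le> 2 * (3 * d)"
    "selectable (k + 72 * D ^ 3 + 2 * (length Fs + 2) + 2 * (length Fs + 2)) (S \<union> S0 \<union> E1 \<union> E2)"
    "\<And>\<theta>. {t \<in> V. \<theta> \<le> y t} \<subseteq> S \<union> S0 \<union> E1 \<union> E2 \<or> 3 * d \<le> card {t \<in> E2. \<theta> \<le> y t}"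
    using selectable_extremes[OF E1(3) Fs(2), of 1 y "3 * d"] unfolding Fs(3) by auto
  define S' where "S' = S0 \<union> E1 \<union> E2"
  have S'V: "S' \<subseteq> V" using S0(1) E1(1) E2(1) by (auto simp: S'_def)
  have finV: "finite V" by (simp add: V_def box_def)
  have fin: "finite S'" "finite S0" "finite E1" "finite E2"
    using S'V finV finite_subset unfolding S'_def by (blast, auto)
  have QV: "Q \<subseteq> V" unfolding V_def by (rule subset_box[OF Q(1)])
  have VTM: "V \<subseteq> set TM" by (auto simp: V_def box_def)
  have "selectable (k + (72 * D ^ 3 + 24)) (S \<union> S')"
    using E2(3) Fs(1) by (simp add: S'_def Un_assoc add.assoc)
  moreover have "D * D * set_cost S' \<le> (D + 1) * (D + 12) * set_cost Q"
  proof -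
    define cm where "cm = Min ((\<lambda>t. t ! 3) ` Q)"
    have "cm \<in> (\<lambda>t. t ! 3) ` Q" unfolding cm_def using finQ Q by (intro Min_in) auto
    then obtain q where q: "q \<in> Q" "q ! 3 = cm" by auto
    have cm: "cm \<le> t ! 3" if "t \<in> Q" for t using that finQ by (simp add: cm_def)
    \<comment> \<open>\<open>S'\<close> stays in the bounding box, so none of its tasks is dearer
      than the dearest of \<open>Q\<close>; the up to \<open>12 * d\<close> extra tasks are at most
      a \<open>12 / D\<close> fraction of \<open>Q\<close>.\<close>
    have "D * t ! 3 \<le> (D + 1) * cm" if t: "t \<in> S'" for t
    proof -
      obtain s where "s \<in> Q" "t ! 3 \<le> s ! 3" using t S'V by (auto simp: V_def box_def in_range_def)
      then have "D * t ! 3 \<le> D * s ! 3" by simp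
      also have "\<dots> \<le> (D + 1) * cm" using costs[OF \<open>s \<in> Q\<close> q(1)] q(2) by simp
      finally show ?thesis .
    qed
    then have "D * set_cost S' \<le> card S' * ((D + 1) * cm)"
      unfolding set_cost_def sum_distrib_left using sum_bounded_above[of S' "\<lambda>t. D * t ! 3"] by simp
    then have "D * (D * set_cost S') \<le> D * (card S' * ((D + 1) * cm))" by (rule mult_le_mono2)
    also have "\<dots> = (D * card S') * ((D + 1) * cm)" by simp
    also have "\<dots> \<le> (c * (D + 12)) * ((D + 1) * cm)"
    proof (rule mult_le_mono1)
      have "card S0 = c" using bij_betw_same_card[OF \<phi>(1)] by (simp add: c_def)
      moreover have "card S' \<le> card S0 + card E1 + card E2"
        unfolding S'_def by (meson add_le_mono1 card_Un_le le_trans)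
      ultimately have "card S' \<le> c + 12 * d" using E1(2) E2(2) by simp
      then have "D * card S' \<le> D * (c + 12 * d)" by simp
      also have "\<dots> = D * c + 12 * (D * d)" by (simp add: algebra_simps)
      also have "D * d \<le> c" by (simp add: d_def)
      finally show "D * card S' \<le> c * (D + 12)" by (simp add: algebra_simps)
    qed
    also have "\<dots> = (D + 1) * (D + 12) * (c * cm)" by (simp add: algebra_simps)
    also have "\<dots> \<le> (D + 1) * (D + 12) * set_cost Q"
      unfolding set_cost_def c_def using sum_bounded_below[of Q cm "\<lambda>t. t ! 3"] cm
      by (intro mult_le_mono2) simp
    finally show ?thesis by (simp add: mult.assoc)
  qed
  moreover have "set_cover Q e \<le> set_cover S' e" for e
  proof -
    \<comment> \<open>The side of \<open>e\<close> decides which end point matters. On the right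
      \<open>\<theta>\<close> is \<open>e + 1\<close>, because a task uses \<open>e\<close> only if
      it ends strictly after \<open>e\<close>.\<close>
    obtain f \<theta> Ef where uses: "\<And>t. t \<in> set TM \<Longrightarrow> uses t e \<longleftrightarrow> \<theta> \<le> f t"
      and ext: "{t \<in> V. \<theta> \<le> f t} \<subseteq> S \<union> S' \<or> 3 * d \<le> card {t \<in> Ef. \<theta> \<le> f t}"
      and Ef: "Ef \<subseteq> S'" "Ef \<inter> S0 = {}" and f: "f = x \<or> f = y"
    proof (cases "m \<le> e")
      case True
      have "uses t e \<longleftrightarrow> e + 1 \<le> y t" if "t \<in> set TM" for t
        using le_m[OF that] True by (auto simp: uses_def y_def)
      moreover have "{t \<in> V. e + 1 \<le> y t} \<subseteq> S \<union> S' \<or> 3 * d \<le> card {t \<in> E2. e + 1 \<le> y t}"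
        using E2(4)[of "e + 1"] by (simp add: S'_def Un_assoc)
      ultimately show ?thesis using E2(1) by (intro that[where f = y and Ef = E2]) (auto simp: S'_def)
    next
      case False
      have "uses t e \<longleftrightarrow> m - e \<le> x t" if "t \<in> set TM" for t
        using le_m[OF that] False by (auto simp: uses_def x_def)
      moreover have "{t \<in> V. m - e \<le> x t} \<subseteq> S \<union> S' \<or> 3 * d \<le> card {t \<in> E1. m - e \<le> x t}"
        using E1(4)[of "m - e"] by (auto simp: S'_def)
      ultimately show ?thesis using E1(1) by (intro that[where f = x and Ef = E1]) (auto simp: S'_def)
    qed
    have labf: "cnt f (\<phi> s) = cnt f s" if "s \<in> Q" for s using \<phi>(2)[OF that] f by (auto simp: lab_def)
    have labp: "cnt p (\<phi> s) = cnt p s" if "s \<in> Q" for s using \<phi>(2)[OF that] by (auto simp: lab_def)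
    have covQ: "set_cover Q e = (\<Sum>t\<in>{t \<in> Q. \<theta> \<le> f t}. t ! 2)"
      unfolding set_cover_alt[OF finQ] using uses Q(1) by (intro sum.cong) auto
    have covS: "set_cover S' e = (\<Sum>t\<in>{t \<in> S'. \<theta> \<le> f t}. t ! 2)"
      unfolding set_cover_alt[OF fin(1)] using uses S'V VTM by (intro sum.cong) auto
    show ?thesis
    proof (cases "{t \<in> V. \<theta> \<le> f t} \<subseteq> S \<union> S'")
      case True
      \<comment> \<open>\<open>S\<close> avoids the box, so the tasks of the box that use
        \<open>e\<close>, those of \<open>Q\<close> among them, must all be in
        \<open>S'\<close>.\<close>
      then have "{t \<in> Q. \<theta> \<le> f t} \<subseteq> {t \<in> S'. \<theta> \<le> f t}" using QV disj by (auto simp: V_def)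
      then show ?thesis unfolding covQ covS using fin(1) by (intro sum_mono2) auto
    next
      case False
      show ?thesis
      proof (cases "d = 0")
        case True
        then have d1': "d1 = 1" by (simp add: d1_def)
        \<comment> \<open>With strips of width one, \<open>\<phi>\<close> maps each task to one that
          reaches at least as far and is at least as large. This case is why labels record size
          ranks.\<close>
        have ge: "f s \<le> f (\<phi> s)" "p s \<le> p (\<phi> s)" if s: "s \<in> Q" for s
          using strip_ge[OF finQ s, of f "\<phi> s"] strip_ge[OF finQ s, of p "\<phi> s"] labf[OF s] labp[OF s]
          by (simp_all add: cnt_def d1')
        have \<phi>V: "\<phi> s \<in> set TM" if "s \<in> Q" for s using \<phi>(1) S0(1) VTM that by (auto simp: bij_betw_def)
        have "set_cover Q e \<le> (\<Sum>s\<in>Q. if uses (\<phi> s) e then \<phi> s ! 2 else 0)"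
          unfolding set_cover_def
        proof (rule sum_mono)
          fix s assume s: "s \<in> Q"
          show "(if uses s e then s ! 2 else 0) \<le> (if uses (\<phi> s) e then \<phi> s ! 2 else 0)"
            using ge[OF s] uses[of s] uses[of "\<phi> s"] \<phi>V[OF s] s Q(1) by (auto simp: p_def)
        qed
        also have "\<dots> = set_cover S0 e"
          unfolding set_cover_def by (rule sum.reindex_bij_betw[OF \<phi>(1)])
        also have "\<dots> \<le> set_cover S' e" by (rule set_cover_mono) (use fin in \<open>auto simp: S'_def\<close>)
        finally show ?thesis .
      next
        case d: False
        then have dd: "d1 = d" by (simp add: d1_def)
        have E: "3 * d \<le> card {t \<in> Ef. \<theta> \<le> f t}" using ext False by blast
        define n where "n = card {t \<in> Q. \<theta> \<le> f t}"
        have "n < card {t \<in> S0. \<theta> \<le> f t} + d1"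
          unfolding n_def using labf by (intro strip_count[OF finQ \<phi>(1) d1]) (auto simp: cnt_def)
        moreover have "card {t \<in> S0. \<theta> \<le> f t} + card {t \<in> Ef. \<theta> \<le> f t} \<le> card {t \<in> S'. \<theta> \<le> f t}"
        proof -
          have finEf: "finite Ef" using Ef fin finite_subset by blast
          have "card {t \<in> S0. \<theta> \<le> f t} + card {t \<in> Ef. \<theta> \<le> f t} = card ({t \<in> S0. \<theta> \<le> f t} \<union> {t \<in> Ef. \<theta> \<le> f t})"
            using fin finEf Ef by (subst card_Un_disjoint) auto
          also have "\<dots> \<le> card {t \<in> S'. \<theta> \<le> f t}" using fin Ef by (intro card_mono) (auto simp: S'_def)
          finally show ?thesis .
        qed
        \<comment> \<open>Fewer than \<open>d\<close> tasks are lost through \<open>\<phi>\<close>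
          and \<open>3 * d\<close> are gained. The surplus of \<open>2 * d\<close> pays for the size
          differences, which amount to at most \<open>n * pm / D\<close>, since
          \<open>n \<le> 2 * d * D\<close>.\<close>
        ultimately have cards: "n + 2 * d \<le> card {t \<in> S'. \<theta> \<le> f t}" using E dd by linarith
        define pm where "pm = Min ((\<lambda>t. t ! 2) ` Q)"
        have "pm \<in> (\<lambda>t. t ! 2) ` Q" unfolding pm_def using finQ Q by (intro Min_in) auto
        then obtain q where q: "q \<in> Q" "q ! 2 = pm" by auto
        have pm: "pm \<le> t ! 2" if t: "t \<in> V" for t
        proof -
          obtain s where "s \<in> Q" "s ! 2 \<le> t ! 2" using t by (auto simp: V_def box_def in_range_def)
          moreover have "pm \<le> s ! 2" using \<open>s \<in> Q\<close> finQ by (simp add: pm_def)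
          ultimately show ?thesis by simp
        qed
        have "n \<le> c" unfolding n_def c_def using finQ by (intro card_mono) auto
        also have "c < (d + 1) * D" unfolding d_def using dividend_less_times_div[OF D, of c] by (simp add: algebra_simps)
        also have "\<dots> \<le> 2 * d * D" using d by (cases d) auto
        finally have n: "n \<le> 2 * d * D" by simp
        have "D * set_cover Q e \<le> n * ((D + 1) * pm)"
          unfolding covQ sum_distrib_left n_def
          using sum_bounded_above[of "{t \<in> Q. \<theta> \<le> f t}" "\<lambda>t. D * t ! 2" "(D + 1) * pm"] sizes[OF _ q(1)] q(2)
          by auto
        also have "\<dots> = D * (n * pm) + n * pm" by (simp add: algebra_simps)
        also have "\<dots> \<le> D * (n * pm) + (2 * d * D) * pm" using n by (intro add_mono mult_le_mono1) auto
        also have "\<dots> = D * ((n + 2 * d) * pm)" by (simp add: algebra_simps)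
        also have "\<dots> \<le> D * set_cover S' e"
        proof (rule mult_le_mono2)
          have "(n + 2 * d) * pm \<le> card {t \<in> S'. \<theta> \<le> f t} * pm" using cards by (rule mult_le_mono1)
          also have "\<dots> \<le> set_cover S' e"
            unfolding covS using sum_bounded_below[of "{t \<in> S'. \<theta> \<le> f t}" pm "\<lambda>t. t ! 2"] pm S'V by auto
          finally show "(n + 2 * d) * pm \<le> set_cover S' e" .
        qed
        finally show ?thesis using D by simp
      qed
    qed
  qed
  ultimately show ?thesis using S'V unfolding V_def by blast
qed

end

section \<open>Geometric classes of sizes and costs\<close>

definition scale_class :: "nat \<Rightarrow> nat \<Rightarrow> int" where
  "scale_class D x = \<lfloor>log (1 + 1 / real D) (real x)\<rfloor>"

lemma scale_class_mono: "0 < D \<Longrightarrow> 0 < x \<Longrightarrow> x \<le> y \<Longrightarrow> scale_class D x \<le> scale_class D y"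
  unfolding scale_class_def by (intro floor_mono) simp

lemma scale_class_eq:
  assumes D: "0 < D" and xy: "0 < x" "0 < y" and eq: "scale_class D x = scale_class D y"
  shows "D * x \<le> (D + 1) * y"
proof -
  define b where "b = 1 + 1 / real D"
  have b: "1 < b" using D by (simp add: b_def)
  have "log b (real x) < log b (real y) + 1"
    using eq unfolding scale_class_def b_def[symmetric] by linarith
  also have "\<dots> = log b (b * real y)" using b xy by (simp add: log_mult)
  finally have "real x < b * real y" using b xy by (subst (asm) log_less_cancel_iff) auto
  then have "real D * real x < real D * (b * real y)" using D by simp
  also have "\<dots> = (real D + 1) * real y" using D by (simp add: b_def field_simps)
  finally have "real (D * x) < real ((D + 1) * y)" by (simp add: algebra_simps)
  then show ?thesis by linarith
qed

text \<open>By Bernoulli's inequality \<open>(1 + 1/D) ^ D \<ge> 2\<close>, so \<open>D\<close>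
  classes are enough for each doubling.\<close>

lemma log_scale_le:
  assumes D: "0 < D" and x: "0 < x" and le: "x \<le> 2 ^ L"
  shows "log (1 + 1 / real D) (real x) \<le> real (D * L)"
proof -
  let ?b = "1 + 1 / real D"
  have b: "1 < ?b" using D by simp
  have "1 + real D * (1 / real D) \<le> ?b ^ D" by (intro Bernoulli_inequality) (simp add: order_trans[of _ 0])
  then have "2 \<le> ?b ^ D" using D by simp
  then have "2 ^ L \<le> (?b ^ D) ^ L" by (rule power_mono) simp
  moreover have "real x \<le> 2 ^ L" using le by (metis of_nat_le_iff of_nat_numeral of_nat_power)
  ultimately have "real x \<le> ?b ^ (D * L)" unfolding power_mult by linarith
  then have "log ?b (real x) \<le> log ?b (?b ^ (D * L))" using b x by (subst log_le_cancel_iff) auto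
  also have "\<dots> = real (D * L)" using b by (intro log_pow_cancel) linarith+
  finally show ?thesis .
qed

context crossing
begin

text \<open>If \<open>C\<close> is the largest cost in \<open>Q\<close>, all tasks of cost at most \<open>C / (D n)\<close> together cost at most
  \<open>C / D\<close> and are selected. This leaves logarithmically many classes of costs.\<close>

lemma dominate:
  assumes D: "0 < D" and sizes: "\<And>t. t \<in> set TM \<Longrightarrow> 0 < t ! 2 \<and> t ! 2 \<le> 2 ^ L"
    and len: "length TM \<le> 2 ^ L" and Q: "Q \<subseteq> set TM"
  shows "\<exists>S. selectable (2 + (D * L + 1) * (D * (D + L) + 2) * (72 * D ^ 3 + 24)) S \<and>
    (\<forall>e. set_cover Q e \<le> set_cover S e) \<and> D * set_cost S \<le> (D + 26) * set_cost Q"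
proof (cases "Q = {}")
  case True
  then show ?thesis using selectable_mono[OF selectable_empty]
    by (intro exI[of _ "{}"]) (auto simp: set_cover_def set_cost_def)
next
  case False
  define n where "n = length TM"
  define C where "C = Max ((\<lambda>t. t ! 3) ` Q)"
  define G where "G = 72 * D ^ 3 + 24"
  have finQ: "finite Q" using Q finite_subset by blast
  have n: "0 < n" using False Q by (auto simp: n_def)
  have card_TM: "card (set TM) = n" using dist by (simp add: n_def distinct_card)
  have "C \<in> (\<lambda>t. t ! 3) ` Q" unfolding C_def using finQ False by (intro Max_in) auto
  then obtain q where q: "q \<in> Q" "q ! 3 = C" by auto
  have leC: "t ! 3 \<le> C" if "t \<in> Q" for t using that finQ by (simp add: C_def)
  have CQ: "C \<le> set_cost Q" unfolding set_cost_def q(2)[symmetric] using q(1) finQ by (intro member_le_sum) auto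
  define cheap where "cheap = {t \<in> set TM. D * n * t ! 3 \<le> C}"
  have fincheap: "finite cheap" by (simp add: cheap_def)
  have sel_cheap: "selectable 2 cheap"
  proof (cases "cheap = {}")
    case True
    then show ?thesis using selectable_mono[OF selectable_empty] by simp
  next
    case False
    have "Max ((\<lambda>t. t ! 3) ` cheap) \<in> (\<lambda>t. t ! 3) ` cheap" using fincheap False by (intro Max_in) auto
    then obtain t0 where t0: "t0 \<in> cheap" "t0 ! 3 = Max ((\<lambda>t. t ! 3) ` cheap)" by auto
    \<comment> \<open>Code \<open>7\<close> bounds the cost from above; with a dearest cheap task as
      the pivot, one filter and one selection describe \<open>cheap\<close> exactly.\<close>
    have "valid_filters [(7, t0)]" using t0 by (simp add: valid_filters_def cheap_def)
    from selectable_pick[OF selectable_empty this, of n] obtain Pk where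
      Pk: "Pk \<subseteq> region [(7, t0)]" "card Pk = min n (card (region [(7, t0)]))" "selectable 2 Pk"
      by (auto simp: numeral_2_eq_2)
    have "region [(7, t0)] = cheap"
    proof
      show "cheap \<subseteq> region [(7, t0)]" using t0(2) fincheap by (auto simp: region_def passes_def cheap_def)
      show "region [(7, t0)] \<subseteq> cheap"
      proof
        fix t assume "t \<in> region [(7, t0)]"
        then have t: "t \<in> set TM" "t ! 3 \<le> t0 ! 3" by (auto simp: region_def passes_def)
        have "D * n * t ! 3 \<le> D * n * t0 ! 3" using t(2) by simp
        also have "\<dots> \<le> C" using t0(1) by (simp add: cheap_def)
        finally show "t \<in> cheap" using t(1) by (simp add: cheap_def)
      qed
    qed
    moreover have "card cheap \<le> n" unfolding card_TM[symmetric] by (intro card_mono) (auto simp: cheap_def)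
    ultimately have "Pk = cheap" using Pk(1,2) fincheap by (simp add: card_subset_eq)
    then show ?thesis using Pk(3) by simp
  qed
  have cost_cheap: "D * set_cost cheap \<le> set_cost Q"
  proof -
    have "n * (D * set_cost cheap) = (\<Sum>t\<in>cheap. D * n * t ! 3)"
      by (simp add: set_cost_def sum_distrib_left algebra_simps)
    also have "\<dots> \<le> (\<Sum>t\<in>cheap. C)" by (intro sum_mono) (simp add: cheap_def)
    also have "\<dots> = card cheap * C" by simp
    also have "\<dots> \<le> n * C" unfolding card_TM[symmetric] by (intro mult_le_mono1 card_mono) (auto simp: cheap_def)
    finally have "D * set_cost cheap \<le> C" using n by simp
    then show ?thesis using CQ by simp
  qed
  define Q' where "Q' = Q - cheap"
  have Q': "Q' \<subseteq> set TM" "finite Q'" using Q finQ by (auto simp: Q'_def)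
  define cls where "cls = (\<lambda>t :: nat list. (scale_class D (t ! 2), scale_class D (t ! 3)))"
  \<comment> \<open>Tasks of cost zero are cheap, so logarithms of costs make sense outside
    \<open>cheap\<close>.\<close>
  have cost_pos: "0 < t ! 3" if "t \<in> set TM" "t \<notin> cheap" for t
    using that by (cases "t ! 3") (auto simp: cheap_def)
  \<comment> \<open>Keeping \<open>S'\<close> inside the classes already treated and outside
    \<open>cheap\<close> yields the disjointness from the next group's box that
    \<open>dominate_group\<close> demands.\<close>
  have groups: "finite \<Gamma> \<Longrightarrow> \<exists>S' \<subseteq> {t \<in> set TM. t \<notin> cheap \<and> cls t \<in> \<Gamma>}.
    selectable (2 + card \<Gamma> * G) (cheap \<union> S') \<and>
    (\<forall>e. set_cover {t \<in> Q'. cls t \<in> \<Gamma>} e \<le> set_cover S' e) \<and>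
    D * D * set_cost S' \<le> (D + 1) * (D + 12) * set_cost {t \<in> Q'. cls t \<in> \<Gamma>}" for \<Gamma>
  proof (induction \<Gamma> rule: finite_induct)
    case empty
    show ?case using sel_cheap by (intro exI[of _ "{}"]) (simp add: set_cover_def set_cost_def)
  next
    case (insert g \<Gamma>)
    then obtain S' where S': "S' \<subseteq> {t \<in> set TM. t \<notin> cheap \<and> cls t \<in> \<Gamma>}"
      and sel': "selectable (2 + card \<Gamma> * G) (cheap \<union> S')"
      and cov': "\<And>e. set_cover {t \<in> Q'. cls t \<in> \<Gamma>} e \<le> set_cover S' e"
      and cost': "D * D * set_cost S' \<le> (D + 1) * (D + 12) * set_cost {t \<in> Q'. cls t \<in> \<Gamma>}" by blast
    define Qg where "Qg = {t \<in> Q'. cls t = g}"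
    have split: "{t \<in> Q'. cls t \<in> insert g \<Gamma>} = {t \<in> Q'. cls t \<in> \<Gamma>} \<union> Qg" by (auto simp: Qg_def)
    show ?case
    proof (cases "Qg = {}")
      case True
      have "selectable (2 + card (insert g \<Gamma>) * G) (cheap \<union> S')"
        by (rule selectable_mono[OF sel']) (use insert.hyps in simp)
      then show ?thesis unfolding split True using S' cov' cost' by (intro exI[of _ S']) auto
    next
      case ne: False
      have QgTM: "Qg \<subseteq> set TM" using Q' by (auto simp: Qg_def)
      \<comment> \<open>In the box, sizes and costs lie between those of members of one class, so
        the class is the same; and a task at least as dear as one that is not cheap is not cheap
        either.\<close>
      have box_cls: "cls t = g \<and> t \<notin> cheap" if t: "t \<in> box Qg [2, 3]" for t
      proof -
        have tTM: "t \<in> set TM" using t by (simp add: box_def)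
        obtain a b where ab: "a \<in> Qg" "b \<in> Qg" "a ! 2 \<le> t ! 2" "t ! 2 \<le> b ! 2"
          using t by (auto simp: box_def in_range_def)
        obtain a' b' where ab': "a' \<in> Qg" "b' \<in> Qg" "a' ! 3 \<le> t ! 3" "t ! 3 \<le> b' ! 3"
          using t by (auto simp: box_def in_range_def)
        have a'p: "0 < a' ! 3" "a' \<notin> cheap" using ab'(1) QgTM cost_pos by (auto simp: Qg_def Q'_def)
        have "\<not> D * n * a' ! 3 \<le> C" using a'p(2) ab'(1) QgTM by (auto simp: cheap_def)
        moreover have "D * n * a' ! 3 \<le> D * n * t ! 3" using ab'(3) by simp
        ultimately have nc: "t \<notin> cheap" unfolding cheap_def by (metis (no_types, lifting) le_trans mem_Collect_eq)
        have "0 < a ! 2" using sizes ab(1) QgTM by auto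
        then have "scale_class D (a ! 2) \<le> scale_class D (t ! 2)" "scale_class D (t ! 2) \<le> scale_class D (b ! 2)"
          using ab(3,4) sizes[OF tTM] by (auto intro!: scale_class_mono[OF D])
        moreover have "scale_class D (a' ! 3) \<le> scale_class D (t ! 3)" "scale_class D (t ! 3) \<le> scale_class D (b' ! 3)"
          using ab'(3,4) a'p(1) by (auto intro!: scale_class_mono[OF D])
        moreover have "cls a = g" "cls b = g" "cls a' = g" "cls b' = g" using ab ab' by (auto simp: Qg_def)
        ultimately show ?thesis using nc by (auto simp: cls_def)
      qed
      have disj: "(cheap \<union> S') \<inter> box Qg [2, 3] = {}" using box_cls S' insert.hyps by auto
      have "\<exists>Sg \<subseteq> box Qg [2, 3]. selectable (2 + card \<Gamma> * G + (72 * D ^ 3 + 24)) (cheap \<union> S' \<union> Sg) \<and>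
        (\<forall>e. set_cover Qg e \<le> set_cover Sg e) \<and> D * D * set_cost Sg \<le> (D + 1) * (D + 12) * set_cost Qg"
      proof (rule dominate_group[OF sel' QgTM ne D disj])
        fix s t assume st: "s \<in> Qg" "t \<in> Qg"
        then have "cls s = cls t" by (simp add: Qg_def)
        moreover have "0 < s ! 2" "0 < t ! 2" using sizes st QgTM by auto
        moreover have "0 < s ! 3" "0 < t ! 3" using cost_pos st QgTM by (auto simp: Qg_def Q'_def)
        ultimately show "D * s ! 2 \<le> (D + 1) * t ! 2" "D * s ! 3 \<le> (D + 1) * t ! 3"
          using scale_class_eq[OF D] by (auto simp: cls_def)
      qed
      then obtain Sg where Sg: "Sg \<subseteq> box Qg [2, 3]"
        "selectable (2 + card \<Gamma> * G + (72 * D ^ 3 + 24)) (cheap \<union> S' \<union> Sg)"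
        "\<And>e. set_cover Qg e \<le> set_cover Sg e"
        "D * D * set_cost Sg \<le> (D + 1) * (D + 12) * set_cost Qg" by blast
      have fin: "finite S'" "finite Sg" "finite Qg" "finite {t \<in> Q'. cls t \<in> \<Gamma>}"
        using S' Sg(1) Q'(2) finite_subset[of Sg "box Qg [2, 3]"] finite_subset[of S' "set TM"]
        by (auto simp: box_def Qg_def)
      have dS: "S' \<inter> Sg = {}" using Sg(1) disj by blast
      have dQ: "{t \<in> Q'. cls t \<in> \<Gamma>} \<inter> Qg = {}" using insert.hyps by (auto simp: Qg_def)
      have "S' \<union> Sg \<subseteq> {t \<in> set TM. t \<notin> cheap \<and> cls t \<in> insert g \<Gamma>}"
        using S' Sg(1) box_cls by (auto simp: box_def)
      moreover have "selectable (2 + card (insert g \<Gamma>) * G) (cheap \<union> (S' \<union> Sg))"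
      proof -
        have "2 + card \<Gamma> * G + (72 * D ^ 3 + 24) = 2 + card (insert g \<Gamma>) * G"
          using insert.hyps by (simp add: G_def)
        then show ?thesis using Sg(2) by (simp only: Un_assoc)
      qed
      moreover have "set_cover {t \<in> Q'. cls t \<in> insert g \<Gamma>} e \<le> set_cover (S' \<union> Sg) e" for e
        unfolding split set_cover_Un[OF fin(1,2) dS] set_cover_Un[OF fin(4,3) dQ]
        by (rule add_mono[OF cov' Sg(3)])
      moreover have "D * D * set_cost (S' \<union> Sg) \<le> (D + 1) * (D + 12) * set_cost {t \<in> Q'. cls t \<in> insert g \<Gamma>}"
        unfolding split set_cost_Un[OF fin(1,2) dS] set_cost_Un[OF fin(4,3) dQ]
          distrib_left[of "D * D"] distrib_left[of "(D + 1) * (D + 12)"]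
        by (rule add_mono[OF cost' Sg(4)])
      ultimately show ?thesis by (intro exI[of _ "S' \<union> Sg"]) auto
    qed
  qed
  define \<Gamma> where "\<Gamma> = cls ` Q'"
  have fin\<Gamma>: "finite \<Gamma>" using Q'(2) by (simp add: \<Gamma>_def)
  have all\<Gamma>: "{t \<in> Q'. cls t \<in> \<Gamma>} = Q'" by (auto simp: \<Gamma>_def)
  obtain S' where S': "S' \<subseteq> {t \<in> set TM. t \<notin> cheap \<and> cls t \<in> \<Gamma>}"
    and sel': "selectable (2 + card \<Gamma> * G) (cheap \<union> S')"
    and cov': "\<And>e. set_cover Q' e \<le> set_cover S' e"
    and cost': "D * D * set_cost S' \<le> (D + 1) * (D + 12) * set_cost Q'"
    using groups[OF fin\<Gamma>] unfolding all\<Gamma> by blast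
  have finS': "finite S'" using S' finite_subset[of S' "set TM"] by blast
  have dcS: "cheap \<inter> S' = {}" using S' by blast
  have card\<Gamma>: "card \<Gamma> \<le> (D * L + 1) * (D * (D + L) + 2)"
  proof -
    let ?b = "1 + 1 / real D"
    have b: "1 < ?b" using D by simp
    define \<gamma> where "\<gamma> = \<lfloor>log ?b (real C)\<rfloor>"
    \<comment> \<open>Sizes range over \<open>[1, 2 ^ L]\<close> and costs over
      \<open>(C / (D * n), C]\<close> with \<open>D * n \<le> 2 ^ (D + L)\<close>; the
      \<open>- 1\<close> leaves slack for the floors.\<close>
    have "cls t \<in> {0..int (D * L)} \<times> {\<gamma> - int (D * (D + L)) - 1..\<gamma>}" if t: "t \<in> Q'" for t
    proof -
      have tTM: "t \<in> set TM" "t \<notin> cheap" "t \<in> Q" using t Q' by (auto simp: Q'_def)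
      have c: "0 < t ! 3" by (rule cost_pos[OF tTM(1,2)])
      have C: "0 < C" using c leC[OF tTM(3)] by simp
      have p: "0 < t ! 2" "t ! 2 \<le> 2 ^ L" using sizes[OF tTM(1)] by auto
      have "0 \<le> log ?b (real (t ! 2))" using b p by simp
      moreover have "log ?b (real (t ! 2)) \<le> real (D * L)" by (rule log_scale_le[OF D p])
      ultimately have 1: "0 \<le> scale_class D (t ! 2)" "scale_class D (t ! 2) \<le> int (D * L)"
        unfolding scale_class_def by (auto simp: floor_le_iff simp del: of_nat_mult)
      have "scale_class D (t ! 3) \<le> \<gamma>"
        unfolding scale_class_def \<gamma>_def using b c leC[OF tTM(3)] by (intro floor_mono) simp
      moreover have "\<gamma> - int (D * (D + L)) - 1 \<le> scale_class D (t ! 3)"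
      proof -
        have "D * n \<le> 2 ^ (D + L)"
        proof -
          have "D \<le> 2 ^ D" by (simp add: less_imp_le)
          then have "D * n \<le> 2 ^ D * 2 ^ L" using len by (intro mult_le_mono) (simp_all add: n_def)
          then show ?thesis by (simp add: power_add)
        qed
        then have Dn: "log ?b (real (D * n)) \<le> real (D * (D + L))" using D n by (intro log_scale_le) auto
        have "C \<le> D * n * t ! 3" using tTM(1,2) by (auto simp: cheap_def)
        then have "real C \<le> real (D * n) * real (t ! 3)" by (metis of_nat_le_iff of_nat_mult)
        then have "log ?b (real C) \<le> log ?b (real (D * n) * real (t ! 3))"
          using b C c D n by (subst log_le_cancel_iff) auto
        also have "\<dots> = log ?b (real (D * n)) + log ?b (real (t ! 3))"
          using b c D n by (subst log_mult) auto
        finally have "log ?b (real C) \<le> real (D * (D + L)) + log ?b (real (t ! 3))" using Dn by linarith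
        then show ?thesis unfolding \<gamma>_def scale_class_def by linarith
      qed
      ultimately show ?thesis using 1 by (simp add: cls_def)
    qed
    then have "\<Gamma> \<subseteq> {0..int (D * L)} \<times> {\<gamma> - int (D * (D + L)) - 1..\<gamma>}" unfolding \<Gamma>_def by blast
    then have "card \<Gamma> \<le> card ({0..int (D * L)} \<times> {\<gamma> - int (D * (D + L)) - 1..\<gamma>})" by (intro card_mono) auto
    also have "\<dots> = (D * L + 1) * (D * (D + L) + 2)"
    proof -
      have "card {0..int (D * L)} = D * L + 1" unfolding card_atLeastAtMost_int by linarith
      moreover have "card {\<gamma> - int (D * (D + L)) - 1..\<gamma>} = D * (D + L) + 2"
        unfolding card_atLeastAtMost_int by linarith
      ultimately show ?thesis by (simp only: card_cartesian_product)
    qed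
    finally show ?thesis .
  qed
  have "selectable (2 + (D * L + 1) * (D * (D + L) + 2) * (72 * D ^ 3 + 24)) (cheap \<union> S')"
    by (rule selectable_mono[OF sel']) (unfold G_def, intro add_left_mono mult_le_mono1 card\<Gamma>)
  moreover have "set_cover Q e \<le> set_cover (cheap \<union> S') e" for e
  proof -
    have "set_cover Q e = set_cover (Q \<inter> cheap) e + set_cover Q' e"
      using finQ by (subst set_cover_Un[symmetric]) (auto simp: Q'_def Int_Diff_Un)
    also have "\<dots> \<le> set_cover cheap e + set_cover S' e"
      by (intro add_mono set_cover_mono cov') (auto simp: fincheap)
    also have "\<dots> = set_cover (cheap \<union> S') e" by (rule set_cover_Un[OF fincheap finS' dcS, symmetric])
    finally show ?thesis .
  qed
  moreover have "D * set_cost (cheap \<union> S') \<le> (D + 26) * set_cost Q"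
  proof -
    have "set_cost Q' \<le> set_cost Q" unfolding set_cost_def using finQ by (intro sum_mono2) (auto simp: Q'_def)
    then have S'Q: "D * D * set_cost S' \<le> (D + 1) * (D + 12) * set_cost Q"
      using cost' by (meson le_trans mult_le_mono2)
    have "D * (D * set_cost (cheap \<union> S')) = D * (D * set_cost cheap) + D * D * set_cost S'"
      by (simp add: set_cost_Un[OF fincheap finS' dcS] algebra_simps)
    also have "\<dots> \<le> D * set_cost Q + (D + 1) * (D + 12) * set_cost Q"
      by (intro add_mono S'Q mult_le_mono2 cost_cheap)
    also have "\<dots> = (D * D + 14 * D + 12) * set_cost Q" by (simp add: algebra_simps)
    \<comment> \<open>\<open>12 \<le> 12 * D\<close> absorbs the constant term; this fixes the
      constant \<open>26\<close>.\<close>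
    also have "\<dots> \<le> (D * (D + 26)) * set_cost Q"
      using D by (intro mult_le_mono1) (simp add: algebra_simps)
    finally have "D * (D * set_cost (cheap \<union> S')) \<le> D * ((D + 26) * set_cost Q)" by (simp only: mult.assoc)
    then show ?thesis using D by simp
  qed
  ultimately show ?thesis by blast
qed

end

section \<open>Completeness of the recursion\<close>

text \<open>\<open>Q\<close> is the part of a given solution that lies inside the interval. Its
  crossing part is exchanged for a dominating selection; as domination holds at all edges, the rest
  of \<open>Q\<close> together with the credited selection still meets the demands of both halves.
  The three parts are disjoint, so the factor \<open>(D + 26) / D\<close> applies to each separately
  and does not compound.\<close>

lemma rec_fun_complete:
  assumes dist: "distinct T" and D: "0 < D" and len: "length T \<le> 2 ^ L"
    and sizes: "\<And>t. t \<in> set T \<Longrightarrow> 0 < t ! 2 \<and> t ! 2 \<le> 2 ^ L"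
    and K: "2 + (D * L + 1) * (D * (D + L) + 2) * (72 * D ^ 3 + 24) \<le> K"
  shows "b - a < 2 ^ h \<Longrightarrow> Q \<subseteq> {t \<in> set T. a \<le> t ! 0 \<and> t ! 1 \<le> b} \<Longrightarrow>
    (\<And>e. a \<le> e \<Longrightarrow> e < b \<Longrightarrow> us ! e \<le> set_cover Q e + cover A e) \<Longrightarrow>
    \<exists>c l. rec_fun us T K h a b A = Some (c, l) \<and> D * c \<le> (D + 26) * set_cost Q"
proof (induction h arbitrary: a b A Q)
  case 0
  then show ?case by simp
next
  case (Suc h)
  show ?case
  proof (cases "a < b")
    case False
    then show ?thesis by simp
  next
    case True
    define m where "m = (a + b) div 2"
    define TM where "TM = middle_tasks T a m b"
    have m: "a \<le> m" "m < b" using True by (auto simp: m_def)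
    have h: "m - a < 2 ^ h" "b - (m + 1) < 2 ^ h" using Suc.prems(1) True by (auto simp: m_def)
    have TM: "distinct TM" "set TM = {t \<in> set T. a \<le> t ! 0 \<and> uses t m \<and> t ! 1 \<le> b}"
      using dist by (auto simp: TM_def middle_tasks_def)
    interpret crossing TM m by unfold_locales (use TM in auto)
    \<comment> \<open>\<open>t ! 0 \<le> m\<close> in \<open>QL\<close> keeps it disjoint from
      \<open>QR\<close>, as nothing here forces a task to end after it starts.\<close>
    define QM QL QR where "QM = Q \<inter> set TM" and "QL = {t \<in> Q. t ! 0 \<le> m \<and> t ! 1 \<le> m}" and "QR = {t \<in> Q. m + 1 \<le> t ! 0}"
    have finQ: "finite Q" using Suc.prems(2) finite_subset by fastforce
    have fin: "finite QM" "finite QL" "finite QR" using finQ by (auto simp: QM_def QL_def QR_def)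
    have le: "length TM \<le> 2 ^ L" using len length_filter_le le_trans unfolding TM_def middle_tasks_def by blast
    have "\<exists>S. selectable (2 + (D * L + 1) * (D * (D + L) + 2) * (72 * D ^ 3 + 24)) S \<and>
      (\<forall>e. set_cover QM e \<le> set_cover S e) \<and> D * set_cost S \<le> (D + 26) * set_cost QM"
      by (rule dominate[OF D _ le]) (use sizes TM in \<open>auto simp: QM_def\<close>)
    then obtain S where S: "selectable K S" "\<And>e. set_cover QM e \<le> set_cover S e"
      "D * set_cost S \<le> (D + 26) * set_cost QM" using selectable_mono[OF _ K] by blast
    then obtain R l where mv: "moves TM K (TM, [], []) (R, [], l)" and l: "distinct l" "set l = S"
      unfolding selectable_def by auto
    have disj: "QM \<inter> QL = {}" "QM \<inter> QR = {}" "QL \<inter> QR = {}"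
      using TM(2) by (auto simp: QM_def QL_def QR_def uses_def)
    \<comment> \<open>A task that uses an edge left of \<open>m\<close> starts before
      \<open>m\<close>, so it either ends by \<open>m\<close> or crosses \<open>m\<close>.\<close>
    have QL: "set_cover Q e \<le> set_cover QM e + set_cover QL e" if e: "e < m" for e
    proof -
      have "set_cover Q e = (\<Sum>t\<in>{t \<in> Q. uses t e}. t ! 2)" by (rule set_cover_alt[OF finQ])
      also have "{t \<in> Q. uses t e} \<subseteq> {t \<in> QM \<union> QL. uses t e}"
        using e Suc.prems(2) TM(2) by (auto simp: QM_def QL_def uses_def)
      then have "(\<Sum>t\<in>{t \<in> Q. uses t e}. t ! 2) \<le> (\<Sum>t\<in>{t \<in> QM \<union> QL. uses t e}. t ! 2)"
        using fin by (intro sum_mono2) auto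
      also have "\<dots> = set_cover (QM \<union> QL) e" using fin by (subst set_cover_alt) auto
      also have "\<dots> = set_cover QM e + set_cover QL e" by (rule set_cover_Un[OF fin(1,2) disj(1)])
      finally show ?thesis .
    qed
    have QR: "set_cover Q e \<le> set_cover QM e + set_cover QR e" if e: "m + 1 \<le> e" for e
    proof -
      have "set_cover Q e = (\<Sum>t\<in>{t \<in> Q. uses t e}. t ! 2)" by (rule set_cover_alt[OF finQ])
      also have "{t \<in> Q. uses t e} \<subseteq> {t \<in> QM \<union> QR. uses t e}"
        using e Suc.prems(2) TM(2) by (auto simp: QM_def QR_def uses_def)
      then have "(\<Sum>t\<in>{t \<in> Q. uses t e}. t ! 2) \<le> (\<Sum>t\<in>{t \<in> QM \<union> QR. uses t e}. t ! 2)"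
        using fin by (intro sum_mono2) auto
      also have "\<dots> = set_cover (QM \<union> QR) e" using fin by (subst set_cover_alt) auto
      also have "\<dots> = set_cover QM e + set_cover QR e" by (rule set_cover_Un[OF fin(1,3) disj(2)])
      finally show ?thesis .
    qed
    have covl: "set_cover QM e \<le> cover l e" for e using S(2) l by (simp add: cover_eq_set_cover)
    have cov_m: "us ! m \<le> cover (l @ A) m"
    proof -
      have "set_cover Q m = set_cover QM m"
        unfolding set_cover_alt[OF finQ] set_cover_alt[OF fin(1)]
        using Suc.prems(2) TM(2) by (intro sum.cong) (auto simp: QM_def)
      then show ?thesis using Suc.prems(3)[OF m] covl[of m] by simp
    qed
    have "us ! e \<le> set_cover QL e + cover (l @ A) e" if "a \<le> e" "e < m" for e
      using Suc.prems(3)[of e] that m QL[of e] covl[of e] by simp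
    then obtain c1 l1 where r1: "rec_fun us T K h a m (l @ A) = Some (c1, l1)" "D * c1 \<le> (D + 26) * set_cost QL"
      using Suc.IH[OF h(1), of QL "l @ A"] Suc.prems(2) by (auto simp: QL_def)
    have "us ! e \<le> set_cover QR e + cover (l @ A) e" if "m + 1 \<le> e" "e < b" for e
      using Suc.prems(3)[of e] that m QR[of e] covl[of e] by simp
    then obtain c2 l2 where r2: "rec_fun us T K h (m + 1) b (l @ A) = Some (c2, l2)" "D * c2 \<le> (D + 26) * set_cost QR"
      using Suc.IH[OF h(2), of QR "l @ A"] Suc.prems(2) by (auto simp: QR_def)
    have "at_most (finish_fun (rec_fun us T K h) us a m b A l) (c1 + c2 + cost l)"
      using cov_m r1(1) r2(1) by (auto simp: finish_fun_def at_most_def cost_def)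
    from at_most_search_fun[where fin = "finish_fun (rec_fun us T K h) us a m b A", OF this mv] obtain c l' where
      c: "rec_fun us T K (Suc h) a b A = Some (c, l')" "c \<le> c1 + c2 + cost l"
      using True by (auto simp: at_most_def Let_def m_def TM_def)
    have "set_cost QL + set_cost QR + set_cost QM \<le> set_cost Q"
    proof -
      have "set_cost QL + set_cost QR + set_cost QM = set_cost (QL \<union> QR \<union> QM)"
        using fin disj by (subst set_cost_Un; auto)+
      also have "\<dots> \<le> set_cost Q"
        unfolding set_cost_def using finQ by (intro sum_mono2) (auto simp: QM_def QL_def QR_def)
      finally show ?thesis .
    qed
    then have "(D + 26) * (set_cost QL + set_cost QR + set_cost QM) \<le> (D + 26) * set_cost Q" by (rule mult_le_mono2)
    moreover have "D * c \<le> D * (c1 + c2 + cost l)" using c(2) by (rule mult_le_mono2)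
    moreover have "D * (c1 + c2 + cost l) \<le> (D + 26) * (set_cost QL + set_cost QR + set_cost QM)"
      using r1(2) r2(2) S(3) l unfolding distrib_left[of D] distrib_left[of "D + 26"]
      by (simp only: cost_eq_set_cost add_mono)
    ultimately have "D * c \<le> (D + 26) * set_cost Q" by (meson le_trans)
    then show ?thesis using c(1) by blast
  qed
qed

section \<open>From instances to natural numbers\<close>

definition rat_num :: "rat \<Rightarrow> nat" where
  "rat_num q = nat (fst (quotient_of q))"

definition rat_den :: "rat \<Rightarrow> nat" where
  "rat_den q = nat (snd (quotient_of q))"

lemma enc_rat_eq: "enc_rat q = VPair (VNat (rat_num q)) (VNat (rat_den q))"
  by (simp add: enc_rat_def rat_num_def rat_den_def)

text \<open>A common denominator that makes all costs integral. The scaled costs may be huge, but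
  \<open>dominate\<close> counts cost classes only relative to the dearest task.\<close>

definition cost_den :: "task list \<Rightarrow> nat" where
  "cost_den js = prod_list (map (\<lambda>j. rat_den (task_cost j)) js)"

text \<open>The position in the last entry makes equal tasks different lists, so that sets of lists
  represent sets of tasks.\<close>

definition conv_task :: "nat \<Rightarrow> nat \<Rightarrow> task \<Rightarrow> nat list" where
  "conv_task d i j = [start_vertex j, end_vertex j, rat_num (task_size j),
     (d div rat_den (task_cost j)) * rat_num (task_cost j), i]"

fun conv_tasks :: "nat \<Rightarrow> nat \<Rightarrow> task list \<Rightarrow> nat list list" where
  "conv_tasks d i [] = []"
| "conv_tasks d i (j # js) = conv_task d i j # conv_tasks d (Suc i) js"

definition rat_ceil :: "rat \<Rightarrow> nat" where
  "rat_ceil q = (rat_num q + rat_den q - 1) div rat_den q"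

lemma enc_task_eq: "enc_task j = VPair (VNat (start_vertex j)) (VPair (VNat (end_vertex j))
    (VPair (VPair (VNat (rat_num (task_size j))) (VNat (rat_den (task_size j))))
    (VPair (VPair (VNat (rat_num (task_cost j))) (VNat (rat_den (task_cost j)))) (VNat 0))))"
  by (simp add: enc_task_def enc_rat_eq)

section \<open>Unit cost of the conversion and of the whole program\<close>

lemma calls_dens:
  "(\<And>j. j \<in> set js \<Longrightarrow> floorlog 2 (rat_den (task_cost j)) \<le> N) \<Longrightarrow>
    calls A fDens [enc_list (map enc_task js)] (VNat (cost_den js)) (length js * (40 * N + 100) + 10)"
proof (induction js)
  case Nil
  show ?case by (rule calls_wpI) (simp add: dens_body_def cost_den_def)
next
  case (Cons j js)
  then have j: "floorlog 2 (rat_den (task_cost j)) \<le> N" by simp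
  have IH: "calls A fDens [enc_list (map enc_task js)] (VNat (cost_den js)) (length js * (40 * N + 100) + 10)"
    using Cons by simp
  show ?case
    apply (rule calls_wpI)
    apply (simp add: dens_body_def)
    apply (rule call_callsI[OF IH])
     apply simp
    apply (simp add: enc_task_eq[of j])
    apply (rule call_callsI[OF calls_mul])
    using j by (simp_all add: cost_den_def)
qed

lemma calls_conv:
  "(\<And>j. j \<in> set js \<Longrightarrow> floorlog 2 (rat_num (task_cost j)) \<le> N) \<Longrightarrow>
    calls A fConv [enc_list (map enc_task js), VNat i, VNat d] (enc_natss (conv_tasks d i js))
      (length js * (40 * N + 200) + 10)"
proof (induction js arbitrary: i)
  case Nil
  show ?case by (rule calls_wpI) (simp add: conv_body_def)
next
  case (Cons j js)
  then have j: "floorlog 2 (rat_num (task_cost j)) \<le> N" by simp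
  have IH: "calls A fConv [enc_list (map enc_task js), VNat (Suc i), VNat d]
      (enc_natss (conv_tasks d (Suc i) js)) (length js * (40 * N + 200) + 10)"
    using Cons by simp
  show ?case
    apply (rule calls_wpI)
    apply (simp add: conv_body_def enc_task_eq[of j])
    apply (rule call_callsI[OF calls_mul])
     apply simp
    apply simp?
    apply (rule call_callsI[OF IH])
    using j by (simp_all add: conv_task_def)
qed

lemma calls_ceils:
  "calls A fCeils [enc_list (map enc_rat us)] (enc_nats (map rat_ceil us)) (100 * length us + 10)"
proof (induction us)
  case Nil
  show ?case by (rule calls_wpI) (simp add: ceils_body_def)
next
  case (Cons u us)
  show ?case
    apply (rule calls_wpI)
    apply (simp add: ceils_body_def enc_rat_eq[of u])
    apply (rule call_callsI[OF Cons.IH])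
    by (simp_all add: rat_ceil_def[of u])
qed

lemma conv_tasks_nth:
  "length (conv_tasks d i js) = length js"
  "k < length js \<Longrightarrow> conv_tasks d i js ! k = conv_task d (i + k) (js ! k)"
proof (induction js arbitrary: i k)
  case (Cons j js)
  { case 1 show ?case using Cons.IH(1) by simp }
  { case 2 then show ?case using Cons.IH(2) by (cases k) auto }
qed simp_all

lemma set_conv_tasks: "set (conv_tasks d 0 js) = (\<lambda>k. conv_task d k (js ! k)) ` {..<length js}"
proof -
  have "set (conv_tasks d 0 js) = (\<lambda>k. conv_tasks d 0 js ! k) ` {..<length js}"
    by (auto simp: set_conv_nth conv_tasks_nth(1))
  also have "\<dots> = (\<lambda>k. conv_task d k (js ! k)) ` {..<length js}"
    by (intro image_cong) (simp_all add: conv_tasks_nth)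
  finally show ?thesis .
qed

lemma tasks_ok_conv_tasks: "tasks_ok (conv_tasks d i js)"
  by (auto simp: tasks_ok_def in_set_conv_nth conv_tasks_nth conv_task_def)

lemma distinct_conv_tasks: "distinct (conv_tasks d i js)"
  by (auto simp: distinct_conv_nth conv_tasks_nth conv_task_def)

text \<open>For positive integral sizes, a single \<open>L\<close> such that the number of tasks and
  every size are at most \<open>2 ^ L\<close>. The program computes it from the input and so need
  not know the size bound. \<open>Suc\<close> keeps it positive even without tasks.\<close>

definition size_log :: "ufp_instance \<Rightarrow> nat" where
  "size_log I = floorlog 2 (Suc (\<Sum>j\<leftarrow>tasks I. rat_num (task_size j)))"

definition ceil_demands :: "ufp_instance \<Rightarrow> nat list" where
  "ceil_demands I = map rat_ceil (demands I)"

definition int_tasks :: "ufp_instance \<Rightarrow> nat list list" where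
  "int_tasks I = conv_tasks (cost_den (tasks I)) 0 (tasks I)"

definition solve :: "nat \<Rightarrow> ufp_instance \<Rightarrow> result" where
  "solve A I = rec_fun (ceil_demands I) (int_tasks I) (size_log I * size_log I * A)
     (floorlog 2 (length (demands I))) 0 (length (demands I)) []"

definition ufp_output :: "nat \<Rightarrow> ufp_instance \<Rightarrow> val" where
  "ufp_output A I = (case solve A I of None \<Rightarrow> VNat 0 | Some (c, l) \<Rightarrow> enc_nats (map (\<lambda>t. t ! 4) l))"

lemma val_size_le_list: "v \<in> set vs \<Longrightarrow> val_size v < val_size (enc_list vs)"
  by (induction vs) (auto simp: floorlog_def)

lemma length_le_val_size: "length vs < val_size (enc_list vs)"
  by (induction vs) (auto simp: floorlog_def)

lemma max_bits_less_val_size: "max_bits v < val_size v"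
  by (induction v) auto

lemma input_size_bounds:
  "length (demands I) < input_size I" "length (tasks I) < input_size I"
  "j \<in> set (tasks I) \<Longrightarrow> floorlog 2 (rat_num (task_cost j)) < input_size I"
  "j \<in> set (tasks I) \<Longrightarrow> floorlog 2 (rat_den (task_cost j)) < input_size I"
proof -
  have I: "input_size I = 1 + val_size (enc_list (map enc_rat (demands I))) + val_size (enc_list (map enc_task (tasks I)))"
    by (simp add: input_size_def enc_instance_def)
  show "length (demands I) < input_size I" "length (tasks I) < input_size I"
    using length_le_val_size[of "map enc_rat (demands I)"] length_le_val_size[of "map enc_task (tasks I)"] I
    by simp_all
  assume "j \<in> set (tasks I)"
  then have "val_size (enc_task j) < input_size I"
    using val_size_le_list[of "enc_task j" "map enc_task (tasks I)"] I by simp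
  then show "floorlog 2 (rat_num (task_cost j)) < input_size I" "floorlog 2 (rat_den (task_cost j)) < input_size I"
    by (simp_all add: enc_task_eq)
qed

lemma runs_main:
  fixes A :: nat and I :: ufp_instance
  defines "N \<equiv> input_size I" and "L \<equiv> size_log I"
  shows "runs (prog A) [enc_instance I] (main_body A) (ufp_output A I)
    (4000 * (N + L + A + 10) ^ 2 * (10 * (20 * (N + 1)) ^ (L * L * A)) ^ floorlog 2 N)"
proof -
  define T where "T = int_tasks I"
  define us where "us = ceil_demands I"
  define K where "K = L * L * A"
  define h where "h = floorlog 2 (length (demands I))"
  define h' where "h' = floorlog 2 N"
  define W where "W = N + L + A + 10"
  define Z where "Z = 10 * (20 * (N + 1)) ^ K"
  note ib = input_size_bounds[where I = I, folded N_def]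
  have m: "length (demands I) \<le> N" and n: "length (tasks I) \<le> N" using ib(1,2) by auto
  have T: "tasks_ok T" "distinct T" "length T \<le> N"
    using n by (simp_all add: T_def int_tasks_def tasks_ok_conv_tasks distinct_conv_tasks conv_tasks_nth)
  have lenT: "length T = length (tasks I)" by (simp add: T_def int_tasks_def conv_tasks_nth)
  have us: "length us = length (demands I)" by (simp add: us_def ceil_demands_def)
  have Lsum: "(\<Sum>t\<leftarrow>T. t ! 2) = (\<Sum>j\<leftarrow>tasks I. rat_num (task_size j))"
  proof -
    have "(\<Sum>t\<leftarrow>conv_tasks d i js. t ! 2) = (\<Sum>j\<leftarrow>js. rat_num (task_size j))" for d i js
      by (induction js arbitrary: i) (auto simp: conv_task_def)
    then show ?thesis by (simp add: T_def int_tasks_def)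
  qed
  have hh: "h \<le> h'" unfolding h_def h'_def using m by (intro floorlog_mono)
  have hN: "h \<le> N"
  proof -
    have "h \<le> length (demands I)" unfolding h_def by (simp add: floorlog_le_iff_less)
    then show ?thesis using m by simp
  qed
  \<comment> \<open>At most \<open>N\<close> tasks are credited per level, so \<open>h * N\<close>
    can serve as the bound \<open>M\<close> of \<open>calls_rec\<close>.\<close>
  define Y where "Y = 1000 * (N + h * N + length us + 10)"
  have rec: "calls A fRec [VPair (enc_nats us) (VPair (enc_natss T) (VNat K)), VNat 0, VNat (length us), VNat 0]
      (enc_res (solve A I)) (Y * Z ^ h)"
    using calls_rec[OF T refl, of "length us" 0 h us "[]" "h * N" A K] less_power_floorlog[of "length us"] us
    by (simp add: Y_def Z_def solve_def T_def us_def K_def L_def h_def)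
  have len_out: "length l \<le> N \<and> tasks_ok l" if "solve A I = Some (c, l)" for c l
  proof -
    have "distinct l" "set l \<subseteq> set T"
      using rec_fun_sound[OF T(2), of us K h 0 "length (demands I)" "[]" c l] that less_power_floorlog
      by (auto simp: solve_def T_def us_def K_def L_def h_def)
    then show ?thesis
      using length_le_of_distinct_subset[of l T] T tasks_ok_subset by (metis le_trans)
  qed
  have LL: "floorlog 2 L \<le> L" "floorlog 2 A \<le> A" by (simp_all add: floorlog_le_iff_less)
  have dens: "calls A fDens [enc_list (map enc_task (tasks I))] (VNat (cost_den (tasks I)))
      (length (tasks I) * (40 * N + 100) + 10)" using ib(4) by (intro calls_dens) (simp add: less_imp_le)
  have conv: "calls A fConv [enc_list (map enc_task (tasks I)), VNat 0, VNat (cost_den (tasks I))] (enc_natss T)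
      (length (tasks I) * (40 * N + 200) + 10)"
    unfolding T_def int_tasks_def using ib(3) by (intro calls_conv) (simp add: less_imp_le)
  have ceils: "calls A fCeils [enc_list (map enc_rat (demands I))] (enc_nats us) (100 * length us + 10)"
    using calls_ceils[of A "demands I"] by (simp add: us_def ceil_demands_def)
  have two: "(2::nat) < 5" by simp
  have sums: "calls A fSum [enc_natss T, VNat 2] (VNat (\<Sum>t\<leftarrow>T. t ! 2)) (100 * length T + 10)"
    by (rule calls_sum[OF two T(1)])
  have logs: "calls A fLog [VNat (Suc (\<Sum>t\<leftarrow>T. t ! 2))] (VNat L) (20 * L + 10)"
    using calls_log[of A "Suc (\<Sum>t\<leftarrow>T. t ! 2)"] unfolding Lsum L_def size_log_def .
  have lens: "calls A fLen [enc_nats us] (VNat (length us)) (10 * length us + 10)"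
    using calls_len[of A "map VNat us"] by (simp add: enc_nats_def)
  have mul1: "calls A fMul [VNat L, VNat L] (VNat (L * L)) (40 * L + 10)"
    by (rule calls_mono[OF calls_mul]) (use LL in simp)
  have mul2: "calls A fMul [VNat (L * L), VNat A] (VNat K) (40 * A + 10)"
    unfolding K_def by (rule calls_mono[OF calls_mul]) (use LL in simp)
  define X where "X = length (tasks I) * (40 * N + 100) + length (tasks I) * (40 * N + 200) +
    110 * length us + 100 * length T + 60 * L + 41 * A + 120 * N + 500"
  have main: "runs (prog A) [enc_instance I] (main_body A) (ufp_output A I) (X + Y * Z ^ h)"
  proof (cases "solve A I")
    case None
    show ?thesis
      apply (rule runs_wpI)
      apply (simp add: main_body_def enc_instance_def)
      apply (rule call_callsI[OF dens])
       apply simp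
      apply simp?
      apply (rule call_callsI[OF conv])
       apply simp
      apply simp?
      apply (rule call_callsI[OF ceils])
       apply simp
      apply simp?
      apply (rule call_callsI[OF sums])
       apply simp
      apply simp?
      apply (rule call_callsI[OF logs])
       apply simp
      apply simp?
      apply (rule call_callsI[OF mul1])
       apply simp
      apply simp?
      apply (rule call_callsI[OF mul2])
       apply simp
      apply simp?
      apply (rule call_callsI[OF lens])
       apply simp
      apply simp?
      apply (rule call_callsI[OF rec])
       apply simp
      using None by (simp add: ufp_output_def X_def)
  next
    case (Some p)
    obtain c l where p: "p = (c, l)" by fastforce
    have l: "length l \<le> N" "tasks_ok l" using len_out Some p by auto
    show ?thesis
      apply (rule runs_wpI)
      apply (simp add: main_body_def enc_instance_def)
      apply (rule call_callsI[OF dens])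
       apply simp
      apply simp?
      apply (rule call_callsI[OF conv])
       apply simp
      apply simp?
      apply (rule call_callsI[OF ceils])
       apply simp
      apply simp?
      apply (rule call_callsI[OF sums])
       apply simp
      apply simp?
      apply (rule call_callsI[OF logs])
       apply simp
      apply simp?
      apply (rule call_callsI[OF mul1])
       apply simp
      apply simp?
      apply (rule call_callsI[OF mul2])
       apply simp
      apply simp?
      apply (rule call_callsI[OF lens])
       apply simp
      apply simp?
      apply (rule call_callsI[OF rec])
       apply simp
      apply (simp add: Some p)
      apply (rule call_callsI[OF calls_idxs[OF l(2)]])
       apply simp
      using Some p l(1) by (simp add: ufp_output_def X_def)
  qed
  have WN: "N \<le> W" "10 \<le> W" "L \<le> W" "A \<le> W" by (auto simp: W_def)
  have WW: "10 * W \<le> W * W" using WN(2) by (rule mult_le_mono1)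
  have NN: "N * N \<le> W * W" using WN by (intro mult_le_mono) auto
  have Z1: "1 \<le> Z ^ h" by (simp add: Z_def)
  have X: "X \<le> 1000 * (W * W)"
  proof -
    have "length (tasks I) * (40 * N + 100) \<le> N * (40 * N + 100)" "length (tasks I) * (40 * N + 200) \<le> N * (40 * N + 200)"
      using n by (auto intro: mult_le_mono1)
    then have "X \<le> N * (40 * N + 100) + N * (40 * N + 200) + 110 * N + 100 * N + 60 * L + 41 * A + 120 * N + 500"
      unfolding X_def us using m T(3) by linarith
    also have "\<dots> \<le> 80 * (N * N) + 900 * W" using WN by (simp add: algebra_simps)
    also have "\<dots> \<le> 1000 * (W * W)" using NN WW by linarith
    finally show ?thesis .
  qed
  have Y: "Y \<le> 3000 * (W * W)"
  proof -
    have "h * N \<le> N * N" using hN by (rule mult_le_mono1)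
    then have "N + h * N + length us + 10 \<le> W * W + 3 * W" unfolding us using NN m WN by linarith
    then have "Y \<le> 1000 * (W * W + 3 * W)" unfolding Y_def by (rule mult_le_mono2)
    also have "1000 * (q + 3 * W) \<le> 3000 * q" if "10 * W \<le> q" for q using that by simp
    note this[OF WW]
    finally show ?thesis .
  qed
  have "X + Y * Z ^ h \<le> 1000 * (W * W) * Z ^ h + 3000 * (W * W) * Z ^ h"
    using mult_le_mono[OF X Z1] mult_le_mono1[OF Y, of "Z ^ h"] by linarith
  also have "\<dots> = 4000 * W ^ 2 * Z ^ h" by (simp add: power2_eq_square)
  also have "\<dots> \<le> 4000 * W ^ 2 * Z ^ h'"
  proof (rule mult_le_mono2)
    show "Z ^ h \<le> Z ^ h'" using hh by (intro power_increasing) (auto simp: Z_def)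
  qed
  finally show ?thesis using runs_mono[OF main] by (simp add: W_def Z_def K_def h'_def)
qed

section \<open>Correctness of the output for integral sizes\<close>

lemma rat_den_pos: "0 < rat_den q"
  using quotient_of_denom_pos'[of q] by (simp add: rat_den_def)

lemma rat_eq_num_den: "0 \<le> q \<Longrightarrow> q = of_nat (rat_num q) / of_nat (rat_den q)"
proof -
  assume q: "0 \<le> q"
  obtain n d where nd: "quotient_of q = (n, d)" by fastforce
  have d: "0 < d" using quotient_of_denom_pos[OF nd] .
  have eq: "q = of_int n / of_int d" using quotient_of_div[OF nd] .
  then have "0 \<le> n" using q d by (simp add: zero_le_divide_iff)
  then show ?thesis using eq d nd by (simp add: rat_num_def rat_den_def)
qed

lemma rat_eq_num: "q \<in> \<int> \<Longrightarrow> 0 \<le> q \<Longrightarrow> q = of_nat (rat_num q)"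
  by (auto simp: Ints_def rat_num_def)

text \<open>The adjunction between rounding up and the embedding of the naturals. Integral sizes
  give integral covers, so by it rounding up the demands does not change feasibility.\<close>

lemma rat_ceil_le_iff: "0 \<le> q \<Longrightarrow> rat_ceil q \<le> x \<longleftrightarrow> q \<le> of_nat x"
proof -
  assume q: "0 \<le> q"
  let ?n = "rat_num q" and ?d = "rat_den q"
  have d: "0 < ?d" by (rule rat_den_pos)
  have "rat_ceil q \<le> x \<longleftrightarrow> (?n + ?d - 1) div ?d < Suc x" by (auto simp: rat_ceil_def)
  also have "\<dots> \<longleftrightarrow> ?n + ?d - 1 < Suc x * ?d" by (rule div_less_iff_less_mult[OF d])
  also have "\<dots> \<longleftrightarrow> ?n \<le> x * ?d" using d by auto
  also have "\<dots> \<longleftrightarrow> (of_nat ?n :: rat) \<le> of_nat (x * ?d)" by (simp only: of_nat_le_iff)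
  also have "\<dots> \<longleftrightarrow> of_nat ?n / of_nat ?d \<le> (of_nat x :: rat)" using d by (simp add: divide_le_eq)
  also have "\<dots> \<longleftrightarrow> q \<le> of_nat x" using rat_eq_num_den[OF q] by simp
  finally show ?thesis .
qed

text \<open>The budget of \<open>dominate\<close> at \<open>L = 1\<close>. Its two factors that
  depend on \<open>L\<close> grow at most linearly, so \<open>L * L\<close> times this value
  suffices for every \<open>L \<ge> 1\<close>, and the part that depends on \<open>D\<close> can be
  a constant of the program.\<close>

definition num_instructions :: "nat \<Rightarrow> nat" where
  "num_instructions D = 2 + (D + 1) * (D * D + D + 2) * (72 * D ^ 3 + 24)"

locale integral_instance =
  fixes I :: ufp_instance
  assumes valid: "valid_instance I"
    and integral: "\<And>j. j \<in> set (tasks I) \<Longrightarrow> task_size j \<in> \<int>"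
begin

definition int_task :: "nat \<Rightarrow> nat list" where
  "int_task i = conv_task (cost_den (tasks I)) i (tasks I ! i)"

lemma set_int_tasks: "set (int_tasks I) = int_task ` task_indices I"
  by (simp add: int_tasks_def set_conv_tasks int_task_def task_indices_def)

lemma int_task_nth:
  "int_task i ! 0 = start_vertex (tasks I ! i)" "int_task i ! 1 = end_vertex (tasks I ! i)"
  "int_task i ! 2 = rat_num (task_size (tasks I ! i))" "int_task i ! 4 = i"
  by (simp_all add: int_task_def conv_task_def)

lemma inj_int_task: "inj int_task"
  by (rule injI) (metis int_task_nth(4))

lemma task_bounds:
  assumes "i \<in> task_indices I"
  shows "end_vertex (tasks I ! i) \<le> length (demands I)" "0 < task_size (tasks I ! i)"
    "0 \<le> task_cost (tasks I ! i)" "task_size (tasks I ! i) = of_nat (int_task i ! 2)" "0 < int_task i ! 2"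
proof -
  have j: "tasks I ! i \<in> set (tasks I)" using assms by (simp add: task_indices_def)
  show *: "end_vertex (tasks I ! i) \<le> length (demands I)" "0 < task_size (tasks I ! i)"
    "0 \<le> task_cost (tasks I ! i)" using valid j by (auto simp: valid_instance_def)
  show eq: "task_size (tasks I ! i) = of_nat (int_task i ! 2)"
    unfolding int_task_nth using * integral[OF j] by (intro rat_eq_num) auto
  show "0 < int_task i ! 2" using *(2) unfolding eq by (rule of_nat_0_less_iff[THEN iffD1])
qed

lemma int_task_cost:
  assumes "i \<in> task_indices I"
  shows "of_nat (int_task i ! 3) = of_nat (cost_den (tasks I)) * task_cost (tasks I ! i)"
proof -
  let ?c = "task_cost (tasks I ! i)" and ?D = "cost_den (tasks I)"
  have "tasks I ! i \<in> set (tasks I)" using assms by (simp add: task_indices_def)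
  then have "rat_den ?c dvd ?D" unfolding cost_den_def by (intro prod_list_dvd) auto
  then obtain k where k: "?D = rat_den ?c * k" by blast
  have d: "0 < rat_den ?c" by (rule rat_den_pos)
  have "int_task i ! 3 = k * rat_num ?c" using d by (simp add: int_task_def conv_task_def k)
  moreover have "of_nat ?D * ?c = of_nat k * of_nat (rat_num ?c)"
    using d by (subst rat_eq_num_den[OF task_bounds(3)[OF assms]]) (simp add: k)
  ultimately show ?thesis by simp
qed

lemma cost_den_pos: "0 < cost_den (tasks I)"
proof -
  have "0 < prod_list (map (\<lambda>j. rat_den (task_cost j)) js)" for js
    by (induction js) (auto simp: rat_den_pos)
  then show ?thesis by (simp add: cost_den_def)
qed

lemma set_cost_int_task:
  assumes "S \<subseteq> task_indices I"
  shows "of_nat (set_cost (int_task ` S)) = of_nat (cost_den (tasks I)) * total_cost I S"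
proof -
  have "set_cost (int_task ` S) = (\<Sum>i\<in>S. int_task i ! 3)"
    unfolding set_cost_def using inj_int_task by (subst sum.reindex) (auto intro: inj_on_subset)
  then have "(of_nat (set_cost (int_task ` S)) :: rat) = (\<Sum>i\<in>S. of_nat (int_task i ! 3))" by simp
  also have "\<dots> = (\<Sum>i\<in>S. of_nat (cost_den (tasks I)) * task_cost (tasks I ! i))"
    using assms by (intro sum.cong refl int_task_cost) auto
  finally show ?thesis by (simp add: total_cost_def sum_distrib_left)
qed

lemma set_cover_int_task:
  assumes "S \<subseteq> task_indices I"
  shows "of_nat (set_cover (int_task ` S) e) = (\<Sum>i \<in> S \<inter> tasks_using I e. task_size (tasks I ! i))"
proof -
  have finS: "finite S" using assms finite_subset by (auto simp: task_indices_def)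
  have "set_cover (int_task ` S) e = (\<Sum>i\<in>S. if uses (int_task i) e then int_task i ! 2 else 0)"
    unfolding set_cover_def using inj_int_task by (subst sum.reindex) (auto intro: inj_on_subset)
  then have "(of_nat (set_cover (int_task ` S) e) :: rat)
      = (\<Sum>i\<in>S. of_nat (if uses (int_task i) e then int_task i ! 2 else 0))" by simp
  also have "\<dots> = (\<Sum>i\<in>S. if i \<in> tasks_using I e then task_size (tasks I ! i) else 0)"
  proof (intro sum.cong refl)
    fix i assume "i \<in> S"
    then have i: "i \<in> task_indices I" using assms by blast
    have "uses (int_task i) e \<longleftrightarrow> i \<in> tasks_using I e"
      using i unfolding uses_def int_task_nth tasks_using_def by simp
    then show "of_nat (if uses (int_task i) e then int_task i ! 2 else 0)
      = (if i \<in> tasks_using I e then task_size (tasks I ! i) else 0)"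
      using task_bounds(4)[OF i] by simp
  qed
  also have "\<dots> = (\<Sum>i \<in> S \<inter> tasks_using I e. task_size (tasks I ! i))"
    using finS by (simp add: sum.inter_restrict)
  finally show ?thesis .
qed

lemma feasible_iff:
  "feasible I S \<longleftrightarrow> S \<subseteq> task_indices I \<and>
     (\<forall>e < length (demands I). ceil_demands I ! e \<le> set_cover (int_task ` S) e)"
proof -
  have "ceil_demands I ! e \<le> set_cover (int_task ` S) e \<longleftrightarrow>
      demands I ! e \<le> (\<Sum>i \<in> S \<inter> tasks_using I e. task_size (tasks I ! i))"
    if "S \<subseteq> task_indices I" "e < length (demands I)" for e
  proof -
    have "0 \<le> demands I ! e" using valid that(2) by (auto simp: valid_instance_def)
    then show ?thesis
      using that(2) set_cover_int_task[OF that(1), of e]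
      by (simp add: ceil_demands_def rat_ceil_le_iff)
  qed
  then show ?thesis by (auto simp: feasible_def)
qed

text \<open>Sizes are positive integers, so their sum bounds the number of tasks as well as each
  size.\<close>

lemma size_log_bounds:
  "length (int_tasks I) \<le> 2 ^ size_log I" "0 < size_log I"
  "t \<in> set (int_tasks I) \<Longrightarrow> 0 < t ! 2 \<and> t ! 2 \<le> 2 ^ size_log I"
proof -
  define s where "s = (\<Sum>j\<leftarrow>tasks I. rat_num (task_size j))"
  have s: "s < 2 ^ size_log I"
    using less_power_floorlog[of "Suc s"] by (simp add: size_log_def s_def)
  have pos: "0 < rat_num (task_size j)" if "j \<in> set (tasks I)" for j
    using that task_bounds(5) unfolding int_task_nth by (auto simp: in_set_conv_nth task_indices_def)
  have "length js \<le> (\<Sum>j\<leftarrow>js. rat_num (task_size j))" if "set js \<subseteq> set (tasks I)" for js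
    using that
  proof (induction js)
    case (Cons j js)
    then show ?case using pos[of j] by simp
  qed simp
  then have "length (tasks I) \<le> s" by (simp add: s_def)
  then show "length (int_tasks I) \<le> 2 ^ size_log I" using s by (simp add: int_tasks_def conv_tasks_nth)
  have "floorlog 2 (Suc s) \<noteq> 0" using floorlog_le_iff_less[of "Suc s" 0] by simp
  then show "0 < size_log I" by (simp add: size_log_def s_def)
  assume "t \<in> set (int_tasks I)"
  then obtain i where i: "i \<in> task_indices I" "t = int_task i" by (auto simp: set_int_tasks)
  have "t ! 2 \<le> s" unfolding i(2) int_task_nth s_def
    using i(1) by (intro member_le_sum_list) (auto simp: task_indices_def)
  then show "0 < t ! 2 \<and> t ! 2 \<le> 2 ^ size_log I" using s task_bounds(5)[OF i(1)] i(2) by simp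
qed

text \<open>The last entry inverts \<open>int_task\<close>, so the distinct list that is returned
  yields distinct positions.\<close>

lemma solve_sound:
  assumes "solve A I = Some (c, l)"
  shows "\<exists>S. encodes_set (ufp_output A I) S \<and> feasible I S \<and>
    of_nat c = of_nat (cost_den (tasks I)) * total_cost I S"
proof -
  have d: "distinct (int_tasks I)" by (simp add: int_tasks_def distinct_conv_tasks)
  have "length (demands I) - 0 < 2 ^ floorlog 2 (length (demands I))" using less_power_floorlog by simp
  from rec_fun_sound[OF d assms[unfolded solve_def] this]
  have l: "distinct l" "set l \<subseteq> set (int_tasks I)" "c = cost l"
    "\<forall>e < length (demands I). ceil_demands I ! e \<le> cover l e" by auto
  define S where "S = {i \<in> task_indices I. int_task i \<in> set l}"
  have S: "S \<subseteq> task_indices I" "int_task ` S = set l" using l(2) by (auto simp: S_def set_int_tasks)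
  have "(\<lambda>t. t ! 4) ` set l = S" unfolding S(2)[symmetric] by (simp add: image_image int_task_nth)
  moreover have "inj_on (\<lambda>t. t ! 4) (set l)"
    unfolding S(2)[symmetric] by (auto simp: inj_on_def int_task_nth)
  ultimately have "encodes_set (ufp_output A I) S"
    unfolding encodes_set_def using assms l(1)
    by (intro exI[of _ "map (\<lambda>t. t ! 4) l"]) (auto simp: ufp_output_def enc_nats_def distinct_map)
  moreover have "feasible I S" unfolding feasible_iff S(2) using S(1) l by (simp add: cover_eq_set_cover)
  moreover have "of_nat c = of_nat (cost_den (tasks I)) * total_cost I S"
    using set_cost_int_task[OF S(1)] l(1,3) S(2) by (simp add: cost_eq_set_cost)
  ultimately show ?thesis by blast
qed

lemma solve_complete:
  assumes D: "0 < D" and feas: "feasible I S"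
  shows "\<exists>c l. solve (num_instructions D) I = Some (c, l) \<and>
    of_nat (D * c) \<le> of_nat (D + 26) * (of_nat (cost_den (tasks I)) * total_cost I S)"
proof -
  define L where "L = size_log I"
  define G where "G = 72 * D ^ 3 + 24"
  have L: "1 \<le> L" using size_log_bounds(2) by (simp add: L_def)
  have LL: "L \<le> L * L" "1 \<le> L * L" using L by (auto simp: mult_le_mono1[of 1 L L, simplified])
  have K: "2 + (D * L + 1) * (D * (D + L) + 2) * G \<le> L * L * num_instructions D"
  proof -
    have 1: "D * L + 1 \<le> L * (D + 1)" using L by (simp add: algebra_simps)
    have "D * D \<le> L * (D * D)" using mult_le_mono1[OF L, of "D * D"] by simp
    then have "D * D + (L * D + 2) \<le> L * (D * D) + (L * D + L * 2)" using L by (intro add_mono) auto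
    then have 2: "D * (D + L) + 2 \<le> L * (D * D + D + 2)" by (simp only: distrib_left add.assoc mult.commute[of D L])
    have "(D * L + 1) * (D * (D + L) + 2) * G \<le> (L * (D + 1)) * (L * (D * D + D + 2)) * G"
      by (intro mult_le_mono1 mult_le_mono 1 2)
    also have "\<dots> = L * L * ((D + 1) * (D * D + D + 2) * G)" by (simp only: mult_ac)
    finally have "2 + (D * L + 1) * (D * (D + L) + 2) * G \<le> L * L * 2 + L * L * ((D + 1) * (D * D + D + 2) * G)"
      using LL(2) by linarith
    then show ?thesis unfolding num_instructions_def G_def distrib_left[of "L * L"] .
  qed
  have S: "S \<subseteq> task_indices I" "\<And>e. e < length (demands I) \<Longrightarrow> ceil_demands I ! e \<le> set_cover (int_task ` S) e"
    using feas by (auto simp: feasible_iff)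
  have "int_task ` S \<subseteq> {t \<in> set (int_tasks I). 0 \<le> t ! 0 \<and> t ! 1 \<le> length (demands I)}"
    using S(1) task_bounds(1) unfolding set_int_tasks by (auto simp: int_task_nth(2)[simplified])
  then have "\<exists>c l. solve (num_instructions D) I = Some (c, l) \<and> D * c \<le> (D + 26) * set_cost (int_task ` S)"
    unfolding solve_def L_def[symmetric]
    using size_log_bounds K less_power_floorlog S(2)
    by (intro rec_fun_complete[OF _ D, where L = L]) (auto simp: G_def L_def int_tasks_def distinct_conv_tasks)
  then obtain c l where cl: "solve (num_instructions D) I = Some (c, l)" "D * c \<le> (D + 26) * set_cost (int_task ` S)"
    by blast
  have "(of_nat (D * c) :: rat) \<le> of_nat ((D + 26) * set_cost (int_task ` S))" using cl(2) by (simp only: of_nat_le_iff)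
  also have "\<dots> = of_nat (D + 26) * (of_nat (cost_den (tasks I)) * total_cost I S)"
    by (simp only: of_nat_mult set_cost_int_task[OF S(1)])
  finally show ?thesis using cl(1) by blast
qed

text \<open>The comparison set is an optimal one, which exists because there are finitely many
  feasible sets; dividing by the positive \<open>cost_den\<close> undoes the scaling of
  costs.\<close>

lemma output_approx:
  assumes D: "0 < D" "26 / \<epsilon> \<le> real D" and \<epsilon>: "0 < \<epsilon>" and feas: "feasible I S0"
  shows "\<exists>S. encodes_set (ufp_output (num_instructions D) I) S \<and> approx_solution \<epsilon> I S"
proof -
  have fin: "finite {S. feasible I S}"
    by (rule finite_subset[of _ "Pow (task_indices I)"]) (auto simp: feasible_def task_indices_def)
  then have "opt_cost I \<in> total_cost I ` {S. feasible I S}"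
    unfolding opt_cost_def using feas by (intro Min_in) auto
  then obtain S1 where S1: "feasible I S1" "total_cost I S1 = opt_cost I" by auto
  obtain c l where cl: "solve (num_instructions D) I = Some (c, l)"
    "of_nat (D * c) \<le> of_nat (D + 26) * (of_nat (cost_den (tasks I)) * opt_cost I)"
    using solve_complete[OF D(1) S1(1)] S1(2) by auto
  obtain S where S: "encodes_set (ufp_output (num_instructions D) I) S" "feasible I S"
    "of_nat c = of_nat (cost_den (tasks I)) * total_cost I S" using solve_sound[OF cl(1)] by blast
  have opt: "0 \<le> opt_cost I"
    unfolding S1(2)[symmetric] total_cost_def using S1(1) task_bounds(3)
    by (intro sum_nonneg) (auto simp: feasible_def)
  have "of_nat (cost_den (tasks I)) * (of_nat D * total_cost I S)
      \<le> of_nat (cost_den (tasks I)) * (of_nat (D + 26) * opt_cost I)"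
    using cl(2) S(3) by (simp add: mult_ac)
  then have "of_nat D * total_cost I S \<le> of_nat (D + 26) * opt_cost I" using cost_den_pos by simp
  then have "real_of_rat (of_nat D * total_cost I S) \<le> real_of_rat (of_nat (D + 26) * opt_cost I)"
    by (simp only: of_rat_less_eq)
  then have "real D * real_of_rat (total_cost I S) \<le> (real D + 26) * real_of_rat (opt_cost I)"
    by (simp add: of_rat_mult of_rat_add)
  also have "\<dots> \<le> (real D * (1 + \<epsilon>)) * real_of_rat (opt_cost I)"
    using D(2) \<epsilon> opt by (intro mult_right_mono) (auto simp: field_simps)
  finally have "real_of_rat (total_cost I S) \<le> (1 + \<epsilon>) * real_of_rat (opt_cost I)"
    using D(1) by (simp add: mult.assoc)
  then show ?thesis using S by (auto simp: approx_solution_def)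
qed

end

section \<open>Running time\<close>

definition time_exponent :: "nat \<Rightarrow> nat \<Rightarrow> nat \<Rightarrow> nat" where
  "time_exponent A N L = L + floorlog 2 N + A + 10"

text \<open>The base contributes about \<open>s\<close> to the exponent, the number of instructions
  \<open>s ^ 3\<close>, and the depth another \<open>s\<close>, which gives order
  \<open>s ^ 5\<close>. As \<open>10 \<le> s\<close>, one more factor \<open>s\<close> absorbs all
  constants and lower-order terms.\<close>

lemma unit_time_le:
  fixes A N L :: nat
  defines "s \<equiv> time_exponent A N L"
  shows "4000 * (N + L + A + 10) ^ 2 * (10 * (20 * (N + 1)) ^ (L * L * A)) ^ floorlog 2 N \<le> 2 ^ (s ^ 6)"
proof -
  have s: "10 \<le> s" "L \<le> s" "A \<le> s" "floorlog 2 N \<le> s" by (auto simp: s_def time_exponent_def)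
  have "N < 2 ^ floorlog 2 N" by (rule less_power_floorlog)
  also have "(2::nat) ^ floorlog 2 N \<le> 2 ^ s" using s by simp
  finally have N: "N + 1 \<le> 2 ^ s" by simp
  have "N + L + A + 10 \<le> 2 ^ s + s"
  proof -
    have "N < 2 ^ floorlog 2 N" by (rule less_power_floorlog)
    also have "(2::nat) ^ floorlog 2 N \<le> 2 ^ s" using s by simp
    finally have "N \<le> 2 ^ s" by simp
    then show ?thesis by (simp add: s_def time_exponent_def)
  qed
  also have "\<dots> \<le> 2 ^ s + 2 ^ s" by (simp add: less_imp_le)
  finally have "N + L + A + 10 \<le> 2 ^ (s + 1)" by simp
  then have "(N + L + A + 10) ^ 2 \<le> (2 ^ (s + 1)) ^ 2" by (rule power_mono) simp
  then have a: "4000 * (N + L + A + 10) ^ 2 \<le> 2 ^ 12 * 2 ^ (2 * (s + 1))"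
    by (intro mult_le_mono) (simp_all flip: power_mult add: mult.commute)
  have "20 * (N + 1) \<le> 2 ^ 5 * 2 ^ s" using N by (intro mult_le_mono) auto
  then have "(20 * (N + 1)) ^ (L * L * A) \<le> (2 ^ (5 + s)) ^ (L * L * A)"
    unfolding power_add by (rule power_mono) simp
  also have "\<dots> \<le> (2 ^ (5 + s)) ^ (s * s * s)" using s by (intro power_increasing mult_le_mono) auto
  finally have "10 * (20 * (N + 1)) ^ (L * L * A) \<le> 2 ^ 4 * (2 ^ (5 + s)) ^ (s * s * s)"
    by (intro mult_le_mono) auto
  also have "\<dots> = 2 ^ (4 + (5 + s) * (s * s * s))" by (simp only: power_mult power_add)
  finally have "(10 * (20 * (N + 1)) ^ (L * L * A)) ^ floorlog 2 N \<le> (2 ^ (4 + (5 + s) * (s * s * s))) ^ floorlog 2 N"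
    by (rule power_mono) simp
  also have "\<dots> \<le> (2 ^ (4 + (5 + s) * (s * s * s))) ^ s" using s by (intro power_increasing) auto
  finally have b: "(10 * (20 * (N + 1)) ^ (L * L * A)) ^ floorlog 2 N \<le> 2 ^ ((4 + (5 + s) * (s * s * s)) * s)"
    by (simp only: power_mult)
  have "4000 * (N + L + A + 10) ^ 2 * (10 * (20 * (N + 1)) ^ (L * L * A)) ^ floorlog 2 N
      \<le> (2 ^ 12 * 2 ^ (2 * (s + 1))) * 2 ^ ((4 + (5 + s) * (s * s * s)) * s)" by (rule mult_le_mono[OF a b])
  also have "\<dots> = 2 ^ (12 + 2 * (s + 1) + (4 + (5 + s) * (s * s * s)) * s)" by (simp only: power_add)
  also have "\<dots> \<le> 2 ^ (s ^ 6)"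
  proof (rule power_increasing)
    have s2: "10 * s \<le> s ^ 2" unfolding power2_eq_square using s(1) by (rule mult_le_mono1)
    have p: "s ^ 2 \<le> s ^ 5" "s ^ 4 * 10 \<le> s ^ 4 * s" using s(1) by (auto intro: power_increasing)
    have "12 + 2 * (s + 1) + (4 + (5 + s) * (s * s * s)) * s = 14 + 6 * s + 5 * s ^ 4 + s ^ 5"
      by (simp add: algebra_simps power_numeral_reduce)
    also have "\<dots> \<le> s ^ 5 + s ^ 5 + s ^ 5"
    proof -
      have "14 + 6 * s \<le> s ^ 2" using s2 s(1) by linarith
      moreover have "s ^ 4 * s = s ^ 5" by (simp add: power_numeral_reduce)
      ultimately show ?thesis using p by linarith
    qed
    also have "\<dots> = 3 * s ^ 5" by simp
    also have "\<dots> \<le> s * s ^ 5" using s(1) by (intro mult_le_mono1) simp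
    also have "\<dots> = s ^ 6" by (simp add: power_numeral_reduce)
    finally show "12 + 2 * (s + 1) + (4 + (5 + s) * (s * s * s)) * s \<le> s ^ 6" .
  qed simp
  finally show ?thesis .
qed

text \<open>Passing from unit to logarithmic cost squares the bound up to a constant, so the
  exponent \<open>s ^ 6\<close> becomes \<open>2 * s ^ 6 + 3\<close>, which is at most
  \<open>s ^ 7\<close> as \<open>10 \<le> s\<close>.\<close>

lemma computes_prog:
  fixes A :: nat and I :: ufp_instance
  assumes L: "size_log I \<le> L"
  shows "\<exists>k. computes (prog A) (enc_instance I) (ufp_output A I) k \<and>
    k \<le> 2 ^ (time_exponent A (input_size I) L ^ 7)"
proof -
  define N where "N = input_size I"
  define s where "s = time_exponent A N L"
  define s' where "s' = time_exponent A N (size_log I)"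
  have s: "10 \<le> s" "s' \<le> s" using L by (auto simp: s_def s'_def time_exponent_def)
  have "runs (prog A) [enc_instance I] (main_body A) (ufp_output A I) (2 ^ (s' ^ 6))"
    unfolding s'_def N_def by (rule runs_mono[OF runs_main unit_time_le])
  moreover have "(2::nat) ^ (s' ^ 6) \<le> 2 ^ (s ^ 6)" using s(2) by (simp add: power_mono)
  ultimately have run: "runs (prog A) [enc_instance I] (main_body A) (ufp_output A I) (2 ^ (s ^ 6))"
    by (rule runs_mono)
  have "\<forall>x\<in>set [enc_instance I]. max_bits x \<le> N"
    using max_bits_less_val_size[of "enc_instance I"] by (simp add: N_def input_size_def)
  from runs_imp_eval(1)[OF run this] obtain k where k: "eval (prog A) [enc_instance I] (main_body A) (ufp_output A I) k"
    "k \<le> 2 ^ (s ^ 6) * (1 + 2 * (N + 2 ^ (s ^ 6)))" by blast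
  have "N \<le> 2 ^ (s ^ 6)"
  proof -
    have "N < 2 ^ floorlog 2 N" by (rule less_power_floorlog)
    also have "(2::nat) ^ floorlog 2 N \<le> 2 ^ s" by (simp add: s_def time_exponent_def)
    also have "(2::nat) ^ s \<le> 2 ^ (s ^ 6)"
      using s(1) power_increasing[of 1 6 s] by (intro power_increasing) auto
    finally show ?thesis by simp
  qed
  moreover have "1 + 2 * (N + q) \<le> 8 * q" if "N \<le> q" "1 \<le> q" for q using that by presburger
  moreover have "(1::nat) \<le> 2 ^ (s ^ 6)" by (rule one_le_power) simp
  ultimately have "1 + 2 * (N + 2 ^ (s ^ 6)) \<le> 8 * 2 ^ (s ^ 6)" by blast
  then have "1 + 2 * (N + 2 ^ (s ^ 6)) \<le> 2 ^ 3 * 2 ^ (s ^ 6)" by simp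
  then have "2 ^ (s ^ 6) * (1 + 2 * (N + 2 ^ (s ^ 6))) \<le> 2 ^ (s ^ 6) * (2 ^ 3 * 2 ^ (s ^ 6))" by (rule mult_le_mono2)
  also have "\<dots> = 2 ^ (s ^ 6 + (3 + s ^ 6))" by (simp only: power_add)
  also have "\<dots> \<le> 2 ^ (s ^ 7)"
  proof (rule power_increasing)
    have "1 \<le> s ^ 6" using s(1) by simp
    then have "s ^ 6 + (3 + s ^ 6) \<le> 10 * s ^ 6" by linarith
    also have "\<dots> \<le> s * s ^ 6" using s(1) by (rule mult_le_mono1)
    also have "\<dots> = s ^ 7" by (simp add: power_numeral_reduce)
    finally show "s ^ 6 + (3 + s ^ 6) \<le> s ^ 7" .
  qed simp
  finally have "k \<le> 2 ^ (s ^ 7)" using k(2) by simp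
  moreover have "computes (prog A) (enc_instance I) (ufp_output A I) k"
    using k(1) by (simp add: computes_def) (simp add: prog_def)
  ultimately show ?thesis unfolding s_def N_def by blast
qed

lemma floorlog_le_log: "0 < n \<Longrightarrow> real (floorlog 2 n) \<le> log 2 (real n) + 1"
proof -
  assume n: "0 < n"
  then have "real (floorlog 2 n) = real_of_int \<lfloor>log 2 (real n)\<rfloor> + 1"
    by (simp add: floorlog_def)
  then show ?thesis by linarith
qed

text \<open>With \<open>l = log 2 n\<close> and \<open>b n \<le> 2 powr (l ^ k)\<close>, the product
  \<open>n * b n\<close> has about \<open>l + l ^ k\<close> bits; for large \<open>n\<close> this
  and the remaining summands of \<open>time_exponent\<close> stay below
  \<open>l ^ (k + 2)\<close>.\<close>

lemma quasi_poly_time_exponent: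
  assumes "quasi_poly b"
  shows "quasi_poly (\<lambda>N. 2 ^ (time_exponent A N (floorlog 2 (N * nat \<lfloor>b N\<rfloor> + 1)) ^ 7))"
proof -
  from assms obtain k where k: "\<forall>\<^sub>F n in sequentially. b n \<le> 2 powr (log 2 (real n) ^ k)"
    unfolding quasi_poly_def by blast
  have "\<forall>\<^sub>F n in sequentially. real A + 20 \<le> log 2 (real n)"
  proof -
    have "real A + 20 \<le> log 2 (real n)" if n: "nat \<lceil>2 powr (real A + 20)\<rceil> \<le> n" for n
    proof -
      have le: "2 powr (real A + 20) \<le> real n" using n by linarith
      moreover have "0 < (2::real) powr (real A + 20)" by simp
      ultimately have "0 < real n" by linarith
      then show ?thesis using le by (subst le_log_iff) auto
    qed
    then show ?thesis by (rule eventually_sequentiallyI)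
  qed
  with k have "\<forall>\<^sub>F n in sequentially. 2 ^ (time_exponent A n (floorlog 2 (n * nat \<lfloor>b n\<rfloor> + 1)) ^ 7)
      \<le> 2 powr (log 2 (real n) ^ ((k + 2) * 7))"
  proof eventually_elim
    case (elim n)
    define l where "l = log 2 (real n)"
    have l: "real A + 20 \<le> l" "20 \<le> l" using elim(2) by (auto simp: l_def)
    have n: "0 < n" using l by (cases "n = 0") (auto simp: l_def log_def)
    have nl: "real n = 2 powr l" using n by (simp add: l_def)
    define e where "e = l ^ k"
    have e: "1 \<le> e" unfolding e_def using l by (intro one_le_power) simp
    let ?x = "n * nat \<lfloor>b n\<rfloor> + 1"
    have "real (nat \<lfloor>b n\<rfloor>) \<le> 2 powr e"
    proof (cases "0 \<le> b n")
      case True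
      then have "real (nat \<lfloor>b n\<rfloor>) \<le> b n" by simp
      then show ?thesis using elim(1) by (simp add: e_def l_def)
    qed simp
    then have "real n * real (nat \<lfloor>b n\<rfloor>) \<le> 2 powr l * 2 powr e" unfolding nl by (intro mult_left_mono) auto
    then have "real ?x \<le> 2 powr (l + e) + 1" by (simp add: powr_add)
    also have "\<dots> \<le> 2 powr (l + e) * 2 powr 1" using ge_one_powr_ge_zero[of 2 "l + e"] l e by simp
    also have "\<dots> = 2 powr (l + e + 1)" by (simp add: powr_add)
    finally have "log 2 (real ?x) \<le> log 2 (2 powr (l + e + 1))"
      by (subst log_le_cancel_iff) (auto intro: add_pos_nonneg)
    then have "log 2 (real ?x) \<le> l + e + 1" by simp
    then have x: "real (floorlog 2 ?x) \<le> l + e + 2" using floorlog_le_log[of ?x] by simp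
    have "real (floorlog 2 n) \<le> l + 1" using floorlog_le_log[OF n] by (simp add: l_def)
    \<comment> \<open>The additive constants, \<open>A\<close> included, are absorbed by the third
      \<open>l\<close>, which is at least \<open>A + 20\<close>.\<close>
    then have "real (time_exponent A n (floorlog 2 ?x)) \<le> 3 * l + e"
      using x l by (simp add: time_exponent_def)
    also have "\<dots> \<le> 4 * l * e"
    proof -
      have "3 * l * 1 \<le> 3 * l * e" "1 * e \<le> l * e" using l e by (intro mult_mono; simp)+
      then show ?thesis by linarith
    qed
    also have "\<dots> \<le> l * l * e" using l e by (intro mult_right_mono) auto
    also have "\<dots> = l ^ (k + 2)" by (simp add: e_def power_add power2_eq_square)
    finally have "real (time_exponent A n (floorlog 2 ?x)) \<le> l ^ (k + 2)" .
    then have "real (time_exponent A n (floorlog 2 ?x)) ^ 7 \<le> (l ^ (k + 2)) ^ 7" by (rule power_mono) simp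
    then have "real (time_exponent A n (floorlog 2 ?x) ^ 7) \<le> l ^ ((k + 2) * 7)"
      by (simp only: power_mult of_nat_power)
    then have "2 powr real (time_exponent A n (floorlog 2 ?x) ^ 7) \<le> 2 powr (l ^ ((k + 2) * 7))"
      by (rule powr_mono) simp
    then show ?case by (simp only: powr_realpow l_def zero_less_numeral)
  qed
  then show ?thesis unfolding quasi_poly_def by blast
qed

lemma size_log_le:
  assumes valid: "valid_instance I" and sizes: "integral_sizes_upto I b"
  shows "size_log I \<le> floorlog 2 (input_size I * nat \<lfloor>b\<rfloor> + 1)"
proof -
  have le: "rat_num (task_size j) \<le> nat \<lfloor>b\<rfloor>" if j: "j \<in> set (tasks I)" for j
  proof -
    have "task_size j = of_nat (rat_num (task_size j))"
      using valid sizes j by (intro rat_eq_num) (auto simp: valid_instance_def integral_sizes_upto_def less_imp_le)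
    then have "real (rat_num (task_size j)) = real_of_rat (task_size j)" by (metis of_rat_of_nat_eq)
    also have "\<dots> \<le> b" using sizes j by (simp add: integral_sizes_upto_def)
    finally show ?thesis by (simp add: le_nat_floor)
  qed
  have "(\<Sum>j\<leftarrow>js. rat_num (task_size j)) \<le> length js * nat \<lfloor>b\<rfloor>" if "set js \<subseteq> set (tasks I)" for js
    using that
  proof (induction js)
    case (Cons j js)
    then show ?case using le[of j] by simp
  qed simp
  then have "(\<Sum>j\<leftarrow>tasks I. rat_num (task_size j)) \<le> length (tasks I) * nat \<lfloor>b\<rfloor>" by simp
  also have "\<dots> \<le> input_size I * nat \<lfloor>b\<rfloor>"
    using input_size_bounds(2)[of I] by (intro mult_le_mono1) simp
  finally show ?thesis unfolding size_log_def by (intro floorlog_mono) simp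
qed

theorem theorem1:
  fixes \<epsilon> :: real
  assumes "\<epsilon> > 0"
  shows "\<exists>P :: program. \<forall>b. quasi_poly b \<longrightarrow>
    (\<exists>t. quasi_poly t \<and>
      (\<forall>I. valid_instance I \<and> integral_sizes_upto I (b (input_size I)) \<longrightarrow>
        (\<exists>v k. computes P (enc_instance I) v k \<and> real k \<le> t (input_size I) \<and>
          ((\<exists>S. feasible I S) \<longrightarrow>
            (\<exists>S. encodes_set v S \<and> approx_solution \<epsilon> I S)))))"
proof -
  \<comment> \<open>\<open>26\<close> is the constant of \<open>dominate\<close>: the relative loss
    \<open>26 / D\<close> is then at most \<open>\<epsilon>\<close>.\<close>
  define D where "D = nat \<lceil>26 / \<epsilon>\<rceil>"
  have D: "0 < D" "26 / \<epsilon> \<le> real D" using assms by (auto simp: D_def real_nat_ceiling_ge)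
  define A where "A = num_instructions D"
  show ?thesis
  \<comment> \<open>The program depends on \<open>\<epsilon>\<close> only; the size range
    \<open>b\<close> comes after it and enters through the time bound alone.\<close>
  proof (intro exI[of _ "prog A"] allI impI)
    fix b :: "nat \<Rightarrow> real"
    assume b: "quasi_poly b"
    define t :: "nat \<Rightarrow> real" where
      "t = (\<lambda>N. 2 ^ (time_exponent A N (floorlog 2 (N * nat \<lfloor>b N\<rfloor> + 1)) ^ 7))"
    have "\<exists>v k. computes (prog A) (enc_instance I) v k \<and> real k \<le> t (input_size I) \<and>
        ((\<exists>S. feasible I S) \<longrightarrow> (\<exists>S. encodes_set v S \<and> approx_solution \<epsilon> I S))"
      if I: "valid_instance I" "integral_sizes_upto I (b (input_size I))" for I
    proof -
      interpret integral_instance I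
        by unfold_locales (use I in \<open>auto simp: integral_sizes_upto_def\<close>)
      obtain k where k: "computes (prog A) (enc_instance I) (ufp_output A I) k"
        "k \<le> 2 ^ (time_exponent A (input_size I)
          (floorlog 2 (input_size I * nat \<lfloor>b (input_size I)\<rfloor> + 1)) ^ 7)"
        using computes_prog[OF size_log_le[OF I]] by blast
      have "real k \<le> t (input_size I)"
        using k(2) unfolding t_def by (metis of_nat_le_iff of_nat_numeral of_nat_power)
      then show ?thesis using k(1) output_approx[OF D assms] unfolding A_def by blast
    qed
    then show "\<exists>t. quasi_poly t \<and>
      (\<forall>I. valid_instance I \<and> integral_sizes_upto I (b (input_size I)) \<longrightarrow>
        (\<exists>v k. computes (prog A) (enc_instance I) v k \<and> real k \<le> t (input_size I) \<and>
          ((\<exists>S. feasible I S) \<longrightarrow> (\<exists>S. encodes_set v S \<and> approx_solution \<epsilon> I S))))"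
      using quasi_poly_time_exponent[OF b, of A] unfolding t_def by blast
  qed
qed

end
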